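(* For each $N$ and $L=L(N)$, let $\mathbf{G}_{N,L}$ be an $N\times L$ Gaussian-like random matrix, and let $\mathbf{A}_N^{1/2}$ be an $N\times L$ random matrix independent of $\mathbf{G}_{N,L}$ with $\mathbf{A}_N=\mathbf{A}_N^{1/2}(\mathbf{A}_N^{1/2})'$, an $N\times N$ symmetric/Hermitian random matrix. Suppose $\mathbf{A}_N\overset{a.s.}{\longmapsto}A\in\mathcal{M}_{\mathrm{alg}}$, and let $s>0$ be a real scalar. If $N,L\to\infty$ with $N/L\to c\in(0,\infty)$, then $$\mathbf{B}_N=(\mathbf{A}_N^{1/2}+\sqrt{s}\,\mathbf{G}_{N,L})(\mathbf{A}_N^{1/2}+\sqrt{s}\,\mathbf{G}_{N,L})'\overset{a.s.}{\longmapsto}B\in\mathcal{M}_{\mathrm{alg}}.$$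
   Context: For an $N\times N$ matrix $\mathbf{M}$ with real eigenvalues, let $F^{\mathbf{M}}(x)=\frac1N\#\{\text{eigenvalues of }\mathbf{M}\le x\}$ (counted with multiplicity). For a sequence of random matrices $\mathbf{A}_N$ of size $N\times N$ with real eigenvalues, $\mathbf{A}_N\overset{a.s.}{\longmapsto}A$ means that there is a non-random probability distribution function $F^A$ on $\mathbb{R}$ such that, almost surely, $F^{\mathbf{A}_N}(x)\to F^A(x)$ as $N\to\infty$ at every continuity point $x$ of $F^A$; here $A$ is only a symbol naming the limit. The Stieltjes transform of $F^A$ is $m_A(z)=\int\frac{1}{x-z}\,dF^A(x)$ for $z\in\mathbb{C}^+$ (the open upper half plane). The distribution $F^A$ is algebraic if there is a nonzero bivariate polynomial $L(m,z)$ with real coefficients such that $L(m_A(z),z)=0$ for all $z\in\mathbb{C}^+$. One writes $\mathbf{A}_N\overset{a.s.}{\longmapsto}A\in\mathcal{M}_{\mathrm{alg}}$ if $\mathbf{A}_N\overset{a.s.}{\longmapsto}A$ and $F^A$ is algebraic. A conclusion $\mathbf{B}_N\overset{a.s.}{\longmapsto}B\in\mathcal{M}_{\mathrm{alg}}$ asserts both that the limiting distribution $F^B$ exists and that it is algebraic. An $N\times L$ Gaussian-like random matrix is $\mathbf{G}_{N,L}=\frac{1}{\sqrt{L}}\mathbf{Y}_{N,L}$, where $\mathbf{Y}_{N,L}$ is an $N\times L$ matrix with i.i.d. (real or complex) entries of zero mean and unit variance, with all higher order moments bounded (uniformly in the dimensions). The prime $'$ denotes transpose (conjugate transpose in the complex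 case). *)

theory Defs
  imports
    "HOL-Probability.Probability"
    "Jordan_Normal_Form.Char_Poly"
    "Jordan_Normal_Form.Schur_Decomposition"
begin

text \<open>
  All matrices are complex; a real matrix is one whose entries happen to be real, and then
  \<^const>\<open>mat_adjoint\<close> (the conjugate transpose) is the transpose.
\<close>

text \<open>
  Normalised eigenvalue counting function. It is meant for matrices with real spectrum, on which
  \<^const>\<open>Re\<close> only converts an eigenvalue to type \<^typ>\<open>real\<close>.
\<close>

definition esd :: "complex mat \<Rightarrow> real \<Rightarrow> real" where
  "esd B x =
     real (\<Sum>z | eigenvalue B z \<and> Re z \<le> x. Polynomial.order z (char_poly B)) / real (dim_row B)"

definition random_matrix :: "'w measure \<Rightarrow> nat \<Rightarrow> nat \<Rightarrow> ('w \<Rightarrow> complex mat) \<Rightarrow> bool" where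
  "random_matrix M m n X \<longleftrightarrow>
     (\<forall>\<omega>\<in>space M. X \<omega> \<in> carrier_mat m n) \<and>
     (\<forall>i<m. \<forall>j<n. (\<lambda>\<omega>. X \<omega> $$ (i, j)) \<in> borel_measurable M)"

text \<open>The two matrices are independent as random vectors of all their entries.\<close>

definition indep_matrices ::
    "'w measure \<Rightarrow> nat \<Rightarrow> nat \<Rightarrow> ('w \<Rightarrow> complex mat) \<Rightarrow> ('w \<Rightarrow> complex mat) \<Rightarrow> bool" where
  "indep_matrices M m n X Y \<longleftrightarrow>
     prob_space.indep_var M
       (Pi\<^sub>M ({..<m} \<times> {..<n}) (\<lambda>_. borel)) (\<lambda>\<omega>. \<lambda>p\<in>{..<m} \<times> {..<n}. X \<omega> $$ p)
       (Pi\<^sub>M ({..<m} \<times> {..<n}) (\<lambda>_. borel)) (\<lambda>\<omega>. \<lambda>p\<in>{..<m} \<times> {..<n}. Y \<omega> $$ p)"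

text \<open>
  I.i.d. entries of mean zero and unit variance. Integrability is explicit because the Bochner
  integral of a non-integrable function is zero.
\<close>

definition iid_standardized :: "'w measure \<Rightarrow> nat \<Rightarrow> nat \<Rightarrow> ('w \<Rightarrow> complex mat) \<Rightarrow> bool" where
  "iid_standardized M m n Y \<longleftrightarrow>
     random_matrix M m n Y \<and>
     prob_space.indep_vars M (\<lambda>_. borel) (\<lambda>p \<omega>. Y \<omega> $$ p) ({..<m} \<times> {..<n}) \<and>
     (\<exists>D. \<forall>i<m. \<forall>j<n. distr M borel (\<lambda>\<omega>. Y \<omega> $$ (i, j)) = D) \<and>
     (\<forall>i<m. \<forall>j<n.
        integrable M (\<lambda>\<omega>. Y \<omega> $$ (i, j)) \<and>
        (LINT \<omega>|M. Y \<omega> $$ (i, j)) = 0 \<and>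
        integrable M (\<lambda>\<omega>. (norm (Y \<omega> $$ (i, j)))\<^sup>2) \<and>
        (LINT \<omega>|M. (norm (Y \<omega> $$ (i, j)))\<^sup>2) = 1)"

text \<open>
  The entry distribution may vary with \<open>N\<close>; only the moment bounds are uniform in \<open>N\<close>. No relation
  between the matrices of different sizes is imposed.
\<close>

definition gaussian_like ::
    "'w measure \<Rightarrow> (nat \<Rightarrow> nat) \<Rightarrow> (nat \<Rightarrow> 'w \<Rightarrow> complex mat) \<Rightarrow> bool" where
  "gaussian_like M L G \<longleftrightarrow>
     (\<exists>Y. (\<forall>N>0. iid_standardized M N (L N) (Y N)) \<and>
          (\<forall>k. \<exists>C. \<forall>N>0. \<forall>i<N. \<forall>j<L N.
             integrable M (\<lambda>\<omega>. norm (Y N \<omega> $$ (i, j)) ^ k) \<and>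
             (LINT \<omega>|M. norm (Y N \<omega> $$ (i, j)) ^ k) \<le> C) \<and>
          (\<forall>N>0. \<forall>\<omega>\<in>space M.
             G N \<omega> = complex_of_real (1 / sqrt (real (L N))) \<cdot>\<^sub>m Y N \<omega>))"

definition as_converges_to ::
    "'w measure \<Rightarrow> (nat \<Rightarrow> 'w \<Rightarrow> complex mat) \<Rightarrow> real measure \<Rightarrow> bool" where
  "as_converges_to M A \<mu> \<longleftrightarrow>
     real_distribution \<mu> \<and> (AE \<omega> in M. weak_conv (\<lambda>N. esd (A N \<omega>)) (cdf \<mu>))"

definition stieltjes :: "real measure \<Rightarrow> complex \<Rightarrow> complex" where
  "stieltjes \<mu> z = (LINT x|\<mu>. 1 / (complex_of_real x - z))"

text \<open>
  A bivariate polynomial $L(m,z)$ is a polynomial in $m$ whose coefficients are polynomials in $z$.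
\<close>

definition bivar_eval :: "real poly poly \<Rightarrow> complex \<Rightarrow> complex \<Rightarrow> complex" where
  "bivar_eval L m z = poly (poly (map_poly (map_poly complex_of_real) L) [:m:]) z"

definition algebraic_distribution :: "real measure \<Rightarrow> bool" where
  "algebraic_distribution \<mu> \<longleftrightarrow>
     (\<exists>L. L \<noteq> 0 \<and> (\<forall>z. Im z > 0 \<longrightarrow> bivar_eval L (stieltjes \<mu> z) z = 0))"

definition as_converges_Malg :: "'w measure \<Rightarrow> (nat \<Rightarrow> 'w \<Rightarrow> complex mat) \<Rightarrow> bool" where
  "as_converges_Malg M A \<longleftrightarrow> (\<exists>\<mu>. as_converges_to M A \<mu> \<and> algebraic_distribution \<mu>)"

end

theory Submission
  imports Defs "HOL-Complex_Analysis.Complex_Analysis"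
begin

text \<open>
  Write \<open>X = A\<^sup>1\<^sup>/\<^sup>2 + \<sigma> Y\<close> with \<open>\<sigma>\<^sup>2 = s / L\<close>, and let \<open>R\<close> be the resolvent at \<open>w\<close>, with \<open>Im w > 0\<close>, of the
  Hermitization of \<open>X\<close>. Up to the factor \<open>w\<close> the normalised trace of its upper block is the Stieltjes
  transform of \<open>B\<close> at \<open>z = w\<^sup>2\<close>. Condition on \<open>A\<^sup>1\<^sup>/\<^sup>2\<close>. Since a single entry perturbs \<open>R\<close> by rank two, the
  Efron-Stein inequality bounds the variance of the normalised trace by a multiple of \<open>1 / N\<^sup>2\<close>, which
  gives almost sure convergence to the conditional mean; and a first order expansion in each single
  entry shows that the mean satisfies, up to an error of order \<open>1 / sqrt L\<close>, the fixed point equation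
  \<open>m = \<delta> m\<^sub>A(z \<delta>\<^sup>2 - s (1 - c) \<delta>)\<close> with \<open>\<delta> = 1 + s c m\<close>.
  For large \<open>Im w\<close> the equation is a contraction, so the Stieltjes transforms of \<open>B\<close> converge at
  countably many points of the imaginary axis. Their behaviour far up the axis gives tightness, and
  their values at a sequence of points with a limit point in the upper half plane determine the
  limit. The fixed point equation turns a polynomial relation for \<open>m\<^sub>A\<close> into one for the limit.
\<close>

section \<open>Dissipative matrices and their inverses\<close>

text \<open>Nothing bounds the spectrum of \<open>A\<close>, and it converges only for almost every
  outcome. Hence all resolvent bounds depend on \<open>Im w\<close> alone, and the mean trace is
  taken over the noise with \<open>A\<close> frozen: the fixed point equation then holds, up to an
  explicit error, for each single outcome, and only the variance bound is integrated over
  \<open>A\<close>. In the Hermitization the noise enters linearly. The price is two self-energies,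
  one per block; the deterministic relation between the two block traces reduces them to one unknown
  and is the origin of the term with \<open>1 - c\<close>. The entries need not be Gaussian, and the
  mean of \<open>y\<^sup>2\<close> may be any number that unit variance allows. A Taylor expansion
  in one entry, with third moments in the remainder, replaces Gaussian integration by parts.
  Matrices of different sizes may be coupled in any way, so almost sure convergence has to come from
  summable variances. A crude bound on the change of the trace would lose a factor of order
  \<open>L\<close>; the first order coefficients have to be kept and their squares summed over all
  positions.\<close>

definition dissipative :: "nat \<Rightarrow> real \<Rightarrow> (nat \<Rightarrow> nat \<Rightarrow> complex) \<Rightarrow> bool" where
  "dissipative n \<eta> T \<longleftrightarrow>
     (\<forall>v. Im (\<Sum>a<n. \<Sum>c<n. cnj (v a) * T a c * v c) \<le> - \<eta> * (\<Sum>a<n. (cmod (v a))\<^sup>2))"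

definition inverse_pair :: "nat \<Rightarrow> (nat \<Rightarrow> nat \<Rightarrow> complex) \<Rightarrow> (nat \<Rightarrow> nat \<Rightarrow> complex) \<Rightarrow> bool" where
  "inverse_pair n T R \<longleftrightarrow>
     (\<forall>a<n. \<forall>b<n. (\<Sum>c<n. T a c * R c b) = of_bool (a = b)) \<and>
     (\<forall>a<n. \<forall>b<n. (\<Sum>c<n. R a c * T c b) = of_bool (a = b))"

text \<open>Cramer's rule, chosen because it makes measurability evident; junk when the determinant vanishes.\<close>

definition minv :: "nat \<Rightarrow> (nat \<Rightarrow> nat \<Rightarrow> complex) \<Rightarrow> nat \<Rightarrow> nat \<Rightarrow> complex" where
  "minv n T a b = cofactor (mat n n (\<lambda>(i,j). T i j)) b a / det (mat n n (\<lambda>(i,j). T i j))"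

text \<open>A kernel vector would make the quadratic form vanish, against its strictly negative
  imaginary part. So the determinant is nonzero, and the two adjugate identities, divided by it,
  make \<open>minv\<close> a two-sided inverse.\<close>

lemma dissipative_inverse_pair:
  assumes d: "dissipative n \<eta> T" and \<eta>: "\<eta> > 0"
  shows "inverse_pair n T (minv n T)"
proof -
  define A where "A = mat n n (\<lambda>(i,j). T i j)"
  have A: "A \<in> carrier_mat n n" by (simp add: A_def)
  have det0: "det A \<noteq> 0"
  proof
    assume "det A = 0"
    then obtain v where v: "v \<in> carrier_vec n" "v \<noteq> 0\<^sub>v n" "A *\<^sub>v v = 0\<^sub>v n"
      using det_0_iff_vec_prod_zero[OF A] by auto
    have row: "(\<Sum>c<n. T a c * v $ c) = 0" if "a < n" for a
    proof -
      have "(A *\<^sub>v v) $ a = (\<Sum>c<n. T a c * v $ c)"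
        using that v(1) by (auto simp: A_def scalar_prod_def atLeast0LessThan intro!: sum.cong)
      then show ?thesis using v(3) that by simp
    qed
    have "(\<Sum>a<n. \<Sum>c<n. cnj (v $ a) * T a c * v $ c) = (\<Sum>a<n. cnj (v $ a) * (\<Sum>c<n. T a c * v $ c))"
      by (simp add: sum_distrib_left mult.assoc)
    also have "\<dots> = 0" using row by simp
    finally have "0 \<le> - \<eta> * (\<Sum>a<n. (cmod (v $ a))\<^sup>2)"
      using d[unfolded dissipative_def, rule_format, of "\<lambda>a. v $ a"] by simp
    then have "(\<Sum>a<n. (cmod (v $ a))\<^sup>2) \<le> 0" using \<eta> by (simp add: mult_le_0_iff)
    then have "(\<Sum>a<n. (cmod (v $ a))\<^sup>2) = 0"
      by (intro antisym sum_nonneg) auto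
    then have "\<forall>a<n. v $ a = 0" by (subst (asm) sum_nonneg_eq_0_iff) auto
    then have "v = 0\<^sub>v n" using v(1) by (intro eq_vecI) auto
    with v(2) show False by simp
  qed
  have adj: "A * adj_mat A = det A \<cdot>\<^sub>m 1\<^sub>m n" "adj_mat A * A = det A \<cdot>\<^sub>m 1\<^sub>m n" "adj_mat A \<in> carrier_mat n n"
    using adj_mat[OF A] by auto
  have mi: "minv n T a b = adj_mat A $$ (a,b) / det A" if "a < n" "b < n" for a b
    using that by (simp add: minv_def adj_mat_def A_def)
  have "(\<Sum>c<n. T a c * minv n T c b) = of_bool (a = b)" if "a < n" "b < n" for a b
  proof -
    have "(A * adj_mat A) $$ (a,b) = (\<Sum>c<n. T a c * adj_mat A $$ (c,b))"
      using that A adj(3) by (auto simp: scalar_prod_def A_def atLeast0LessThan intro!: sum.cong)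
    then have "(\<Sum>c<n. T a c * adj_mat A $$ (c,b)) = det A * of_bool (a = b)"
      using adj(1) that by (cases "a = b") simp_all
    moreover have "(\<Sum>c<n. T a c * minv n T c b) = (\<Sum>c<n. T a c * adj_mat A $$ (c,b)) / det A"
      using that by (simp add: mi sum_divide_distrib)
    ultimately show ?thesis using det0 by simp
  qed
  moreover have "(\<Sum>c<n. minv n T a c * T c b) = of_bool (a = b)" if "a < n" "b < n" for a b
  proof -
    have "(adj_mat A * A) $$ (a,b) = (\<Sum>c<n. adj_mat A $$ (a,c) * T c b)"
      using that A adj(3) by (auto simp: scalar_prod_def A_def atLeast0LessThan intro!: sum.cong)
    then have "(\<Sum>c<n. adj_mat A $$ (a,c) * T c b) = det A * of_bool (a = b)"
      using adj(2) that by (cases "a = b") simp_all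
    moreover have "(\<Sum>c<n. minv n T a c * T c b) = (\<Sum>c<n. adj_mat A $$ (a,c) * T c b) / det A"
      using that by (simp add: mi sum_divide_distrib)
    ultimately show ?thesis using det0 by simp
  qed
  ultimately show ?thesis by (simp add: inverse_pair_def)
qed

text \<open>The plain transpose is meant, since the adjoint would flip the sign of the imaginary
  part: its form at \<open>v\<close> is the form of \<open>T\<close> at the conjugate of
  \<open>v\<close>. This turns column bounds for the inverse into row bounds.\<close>

lemma dissipative_transpose:
  assumes "dissipative n \<eta> T"
  shows "dissipative n \<eta> (\<lambda>a b. T b a)"
  unfolding dissipative_def
proof
  fix v :: "nat \<Rightarrow> complex"
  have "(\<Sum>a<n. \<Sum>c<n. cnj (v a) * T c a * v c) = (\<Sum>a<n. \<Sum>c<n. cnj (cnj (v a)) * T a c * cnj (v c))"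
    by (subst sum.swap) (simp add: mult.commute mult.left_commute)
  then show "Im (\<Sum>a<n. \<Sum>c<n. cnj (v a) * T c a * v c) \<le> - \<eta> * (\<Sum>a<n. (cmod (v a))\<^sup>2)"
    using assms[unfolded dissipative_def, rule_format, of "\<lambda>a. cnj (v a)"] by simp
qed

lemma inverse_pair_transpose:
  "inverse_pair n T R \<Longrightarrow> inverse_pair n (\<lambda>a b. T b a) (\<lambda>a b. R b a)"
  unfolding inverse_pair_def by (auto simp: mult.commute of_bool_def)

lemma inverse_pair_solve:
  assumes "inverse_pair n T R" "a < n"
  shows "(\<Sum>c<n. T a c * (\<Sum>b<n. R c b * x b)) = x a"
proof -
  have "(\<Sum>c<n. T a c * (\<Sum>b<n. R c b * x b)) = (\<Sum>b<n. (\<Sum>c<n. T a c * R c b) * x b)"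
    by (simp add: sum_distrib_left sum_distrib_right mult.assoc) (rule sum.swap)
  also have "\<dots> = (\<Sum>b<n. if a = b then x b else 0)"
    using assms by (intro sum.cong) (auto simp: inverse_pair_def)
  finally show ?thesis using assms(2) by simp
qed

lemma quadratic_form_inverse:
  assumes "inverse_pair n T R"
  shows "(\<Sum>a<n. \<Sum>c<n. cnj (\<Sum>b<n. R a b * x b) * T a c * (\<Sum>b<n. R c b * x b)) =
         (\<Sum>a<n. cnj (\<Sum>b<n. R a b * x b) * x a)"
proof -
  define u where "u a = (\<Sum>b<n. R a b * x b)" for a
  have "(\<Sum>a<n. \<Sum>c<n. cnj (u a) * T a c * u c) = (\<Sum>a<n. cnj (u a) * (\<Sum>c<n. T a c * u c))"
    by (simp add: sum_distrib_left mult.assoc)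
  also have "\<dots> = (\<Sum>a<n. cnj (u a) * x a)"
    using inverse_pair_solve[OF assms, of _ x] by (simp add: u_def)
  finally show ?thesis unfolding u_def .
qed

text \<open>For \<open>u = R x\<close> the form of \<open>T\<close> at \<open>u\<close> is the
  pairing of \<open>u\<close> with \<open>x\<close>, so dissipativity bounds \<open>\<eta>\<close>
  times the squared norm of \<open>u\<close> by that pairing. The operator norm of the inverse is
  thus at most \<open>1 / \<eta>\<close>, whatever the size of \<open>T\<close>.\<close>

lemma inverse_norm_le:
  assumes d: "dissipative n \<eta> T" and \<eta>: "\<eta> > 0" and R: "inverse_pair n T R"
  shows "(\<Sum>a<n. (cmod (\<Sum>b<n. R a b * x b))\<^sup>2) \<le> (\<Sum>a<n. (cmod (x a))\<^sup>2) / \<eta>\<^sup>2"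
proof -
  define u where "u a = (\<Sum>b<n. R a b * x b)" for a
  define S where "S = (\<Sum>a<n. (cmod (u a))\<^sup>2)"
  define X where "X = (\<Sum>a<n. (cmod (x a))\<^sup>2)"
  have "\<eta> * S \<le> - Im (\<Sum>a<n. cnj (u a) * x a)"
    using d[unfolded dissipative_def, rule_format, of u]
    unfolding u_def quadratic_form_inverse[OF R, of x] S_def by linarith
  also have "\<dots> \<le> cmod (\<Sum>a<n. cnj (u a) * x a)"
    using abs_Im_le_cmod[of "\<Sum>a<n. cnj (u a) * x a"] by linarith
  also have "\<dots> \<le> (\<Sum>a<n. cmod (u a) * cmod (x a))"
    by (rule order_trans[OF norm_sum]) (simp add: norm_mult)
  \<comment> \<open>Weighted arithmetic-geometric mean inequality, with the weight chosen so that
    half of \<open>\<eta> * S\<close> can be absorbed on the left.\<close>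
  also have "\<dots> \<le> (\<Sum>a<n. \<eta> / 2 * (cmod (u a))\<^sup>2 + (cmod (x a))\<^sup>2 / (2 * \<eta>))"
  proof (rule sum_mono)
    fix a
    have "0 \<le> (\<eta> * cmod (u a) - cmod (x a))\<^sup>2 / (2 * \<eta>)" using \<eta> by simp
    also have "\<dots> = \<eta> / 2 * (cmod (u a))\<^sup>2 + (cmod (x a))\<^sup>2 / (2 * \<eta>) - cmod (u a) * cmod (x a)"
      using \<eta> by (simp add: field_simps power2_eq_square)
    finally show "cmod (u a) * cmod (x a) \<le> \<eta> / 2 * (cmod (u a))\<^sup>2 + (cmod (x a))\<^sup>2 / (2 * \<eta>)" by simp
  qed
  also have "\<dots> = \<eta> / 2 * S + X / (2 * \<eta>)"
    by (simp add: S_def X_def sum.distrib sum_distrib_left sum_divide_distrib)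
  finally have "S \<le> X / \<eta>\<^sup>2" using \<eta> by (simp add: field_simps power2_eq_square)
  then show ?thesis by (simp add: S_def X_def u_def)
qed

lemma inverse_col_norm:
  assumes "dissipative n \<eta> T" "\<eta> > 0" "inverse_pair n T R" "b < n"
  shows "(\<Sum>a<n. (cmod (R a b))\<^sup>2) \<le> 1 / \<eta>\<^sup>2"
proof -
  have *: "(\<Sum>c<n. R a c * of_bool (c = b)) = R a b" for a
    using assms(4) by (simp add: if_distrib of_bool_def cong: if_cong)
  have **: "(\<Sum>a<n. (cmod (of_bool (a = b)))\<^sup>2) = 1"
  proof -
    have "(\<Sum>a<n. (cmod (of_bool (a = b)))\<^sup>2) = (\<Sum>a<n. if a = b then 1 else 0)"
      by (intro sum.cong) auto
    then show ?thesis using assms(4) by simp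
  qed
  show ?thesis using inverse_norm_le[OF assms(1-3), of "\<lambda>c. of_bool (c = b)"] unfolding * ** .
qed

lemma inverse_row_norm:
  assumes "dissipative n \<eta> T" "\<eta> > 0" "inverse_pair n T R" "a < n"
  shows "(\<Sum>b<n. (cmod (R a b))\<^sup>2) \<le> 1 / \<eta>\<^sup>2"
  using inverse_col_norm[OF dissipative_transpose[OF assms(1)] assms(2) inverse_pair_transpose[OF assms(3)] assms(4)] .

lemma inverse_entry_norm:
  assumes "dissipative n \<eta> T" "\<eta> > 0" "inverse_pair n T R" "a < n" "b < n"
  shows "cmod (R a b) \<le> 1 / \<eta>"
proof -
  have "(cmod (R a b))\<^sup>2 \<le> (\<Sum>b<n. (cmod (R a b))\<^sup>2)"
    using assms(5) by (intro member_le_sum) auto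
  also have "\<dots> \<le> (1 / \<eta>)\<^sup>2" using inverse_row_norm[OF assms(1-4)] by (simp add: power_divide)
  finally show ?thesis using assms(2) by (simp add: power2_le_iff_abs_le)
qed

text \<open>The form of \<open>T\<close> at column \<open>b\<close> of \<open>R\<close> is the
  conjugate of \<open>R b b\<close>. This sign later keeps the self-energies in the closed upper
  half plane.\<close>

lemma inverse_diag_Im_nonneg:
  assumes d: "dissipative n \<eta> T" and \<eta>: "\<eta> > 0" and R: "inverse_pair n T R" and b: "b < n"
  shows "Im (R b b) \<ge> 0"
proof -
  have *: "(\<Sum>c<n. R a c * of_bool (c = b)) = R a b" for a
    using b by (simp add: if_distrib of_bool_def cong: if_cong)
  have **: "(\<Sum>a<n. cnj (R a b) * of_bool (a = b)) = cnj (R b b)"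
    using b by (simp add: if_distrib of_bool_def cong: if_cong)
  have "(\<Sum>a<n. \<Sum>c<n. cnj (R a b) * T a c * R c b) = cnj (R b b)"
    using quadratic_form_inverse[OF R, of "\<lambda>c. of_bool (c = b)"] unfolding * ** .
  then have "- Im (R b b) \<le> - \<eta> * (\<Sum>a<n. (cmod (R a b))\<^sup>2)"
    using d[unfolded dissipative_def, rule_format, of "\<lambda>a. R a b"] by simp
  also have "\<dots> \<le> 0" using \<eta> by (simp add: sum_nonneg)
  finally show ?thesis by simp
qed

lemma resolvent_identity:
  assumes R: "inverse_pair n T R" and R': "inverse_pair n T' R'" and ab: "a < n" "b < n"
  shows "(\<Sum>c<n. \<Sum>d<n. R a c * (T c d - T' c d) * R' d b) = R' a b - R a b"
proof -
  have "(\<Sum>c<n. \<Sum>d<n. R a c * (T c d - T' c d) * R' d b) =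
        (\<Sum>c<n. \<Sum>d<n. R a c * T c d * R' d b) - (\<Sum>c<n. \<Sum>d<n. R a c * T' c d * R' d b)"
    by (simp add: algebra_simps sum_subtractf)
  also have "(\<Sum>c<n. \<Sum>d<n. R a c * T c d * R' d b) = (\<Sum>d<n. (\<Sum>c<n. R a c * T c d) * R' d b)"
    by (subst sum.swap) (simp add: sum_distrib_right)
  also have "\<dots> = (\<Sum>d<n. if a = d then R' d b else 0)"
    using R ab by (intro sum.cong) (auto simp: inverse_pair_def)
  also have "\<dots> = R' a b" using ab by simp
  also have "(\<Sum>c<n. \<Sum>d<n. R a c * T' c d * R' d b) = (\<Sum>c<n. R a c * (\<Sum>d<n. T' c d * R' d b))"
    by (simp add: sum_distrib_left mult.assoc)
  also have "\<dots> = (\<Sum>c<n. if c = b then R a c else 0)"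
    using R' ab by (intro sum.cong) (auto simp: inverse_pair_def)
  also have "\<dots> = R a b" using ab by simp
  finally show ?thesis .
qed

lemma cauchy_schwarz_bound:
  fixes f g :: "nat \<Rightarrow> complex"
  assumes "(\<Sum>k\<in>I. (cmod (f k))\<^sup>2) \<le> A\<^sup>2" "(\<Sum>k\<in>I. (cmod (g k))\<^sup>2) \<le> B\<^sup>2" "A \<ge> 0" "B \<ge> 0"
  shows "cmod (\<Sum>k\<in>I. f k * g k) \<le> A * B"
proof -
  have "cmod (\<Sum>k\<in>I. f k * g k) \<le> (\<Sum>k\<in>I. cmod (f k) * cmod (g k))"
    by (rule order_trans[OF norm_sum]) (simp add: norm_mult)
  moreover have "(\<Sum>k\<in>I. cmod (f k) * cmod (g k))\<^sup>2 \<le> (\<Sum>k\<in>I. (cmod (f k))\<^sup>2) * (\<Sum>k\<in>I. (cmod (g k))\<^sup>2)"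
    by (rule Cauchy_Schwarz_ineq_sum)
  moreover have "\<dots> \<le> A\<^sup>2 * B\<^sup>2" using assms by (intro mult_mono) (auto intro: sum_nonneg)
  ultimately have "(\<Sum>k\<in>I. cmod (f k) * cmod (g k))\<^sup>2 \<le> (A * B)\<^sup>2" by (simp add: power_mult_distrib)
  then have "(\<Sum>k\<in>I. cmod (f k) * cmod (g k)) \<le> A * B"
    by (rule power2_le_imp_le) (use assms in simp)
  then show ?thesis using \<open>cmod _ \<le> _\<close> by linarith
qed

section \<open>Hermitization of a rectangular matrix\<close>

text \<open>\<open>X\<close> enters linearly, whereas it enters the Gram matrix quadratically:
  changing one entry of \<open>X\<close> changes one entry here and its mirror image.\<close>

definition hermz :: "nat \<Rightarrow> (nat \<Rightarrow> nat \<Rightarrow> complex) \<Rightarrow> nat \<Rightarrow> nat \<Rightarrow> complex" where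
  "hermz N X a b =
     (if a < N \<and> N \<le> b then X a (b - N) else if N \<le> a \<and> b < N then cnj (X b (a - N)) else 0)"

text \<open>
  The block matrix with diagonal blocks \<open>- p\<close> and \<open>- q\<close> and off-diagonal blocks \<open>X\<close> and its adjoint.
  For \<open>p\<close> and \<open>q\<close> in the upper half plane its inverse is bounded whatever the size of \<open>X\<close>, which
  is why no truncation of the deterministic part is needed below.
\<close>

definition bmat :: "nat \<Rightarrow> complex \<Rightarrow> complex \<Rightarrow> (nat \<Rightarrow> nat \<Rightarrow> complex) \<Rightarrow> nat \<Rightarrow> nat \<Rightarrow> complex" where
  "bmat N p q X a b = hermz N X a b - (if a = b then if a < N then p else q else 0)"

lemma dissipative_bmat:
  assumes "Im p \<ge> \<eta>" "Im q \<ge> \<eta>"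
  shows "dissipative n \<eta> (bmat N p q X)"
  unfolding dissipative_def
proof
  fix v :: "nat \<Rightarrow> complex"
  define H where "H = (\<Sum>a<n. \<Sum>c<n. cnj (v a) * hermz N X a c * v c)"
  have cnjh: "cnj (hermz N X a c) = hermz N X c a" for a c by (auto simp: hermz_def)
  have "cnj H = H"
    unfolding H_def by (subst sum.swap) (simp add: cnjh mult.commute mult.left_commute)
  then have H0: "Im H = 0" by (metis complex_cnj_cancel_iff cnj.simps(2) neg_equal_zero)
  have "(\<Sum>a<n. \<Sum>c<n. cnj (v a) * bmat N p q X a c * v c) =
     H - (\<Sum>a<n. \<Sum>c<n. if a = c then (if a < N then p else q) * (cnj (v a) * v a) else 0)"
    unfolding H_def sum_subtractf[symmetric]
    by (intro sum.cong refl) (auto simp: bmat_def algebra_simps)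
  also have "\<dots> = H - (\<Sum>a<n. (if a < N then p else q) * (cnj (v a) * v a))" by simp
  finally have "Im (\<Sum>a<n. \<Sum>c<n. cnj (v a) * bmat N p q X a c * v c) =
     - (\<Sum>a<n. Im ((if a < N then p else q) * (cnj (v a) * v a)))"
    using H0 by (simp only: minus_complex.sel Im_sum)
  moreover have "\<eta> * (cmod (v a))\<^sup>2 \<le> Im ((if a < N then p else q) * (cnj (v a) * v a))" for a
  proof -
    have "cnj (v a) * v a = complex_of_real ((cmod (v a))\<^sup>2)"
      by (metis complex_norm_square mult.commute of_real_power)
    then have "Im ((if a < N then p else q) * (cnj (v a) * v a)) = Im (if a < N then p else q) * (cmod (v a))\<^sup>2"
      by simp
    then show ?thesis using assms by (simp only:) (rule mult_right_mono, auto)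
  qed
  ultimately show "Im (\<Sum>a<n. \<Sum>c<n. cnj (v a) * bmat N p q X a c * v c) \<le> - \<eta> * (\<Sum>a<n. (cmod (v a))\<^sup>2)"
    by (simp only: sum_distrib_left) (simp only: minus_mult_left[symmetric] sum_negf neg_le_iff_le sum_mono)
qed

lemma sum_lessThan_add:
  fixes f :: "nat \<Rightarrow> 'a::comm_monoid_add"
  shows "(\<Sum>a<N + L. f a) = (\<Sum>i<N. f i) + (\<Sum>j<L. f (N + j))"
  by (induction L) (simp_all add: add.assoc)

lemma bmat_upper_row:
  assumes "i < N"
  shows "(\<Sum>c<N + L. bmat N p q X i c * f c) = (\<Sum>j<L. X i j * f (N + j)) - p * f i"
proof -
  have "(\<Sum>c<N. bmat N p q X i c * f c) = (\<Sum>c<N. if i = c then - p * f c else 0)"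
    using assms by (intro sum.cong) (auto simp: bmat_def hermz_def)
  also have "\<dots> = - p * f i" using assms by simp
  finally show ?thesis using assms by (simp add: sum_lessThan_add bmat_def hermz_def)
qed

lemma bmat_lower_row:
  assumes "j < L"
  shows "(\<Sum>c<N + L. bmat N p q X (N + j) c * f c) = (\<Sum>i<N. cnj (X i j) * f i) - q * f (N + j)"
proof -
  have "(\<Sum>c<L. bmat N p q X (N + j) (N + c) * f (N + c)) = (\<Sum>c<L. if j = c then - q * f (N + c) else 0)"
    using assms by (intro sum.cong) (auto simp: bmat_def hermz_def)
  also have "\<dots> = - q * f (N + j)" using assms by simp
  finally show ?thesis using assms by (simp add: sum_lessThan_add bmat_def hermz_def)
qed

lemma bmat_lower_col:
  assumes "j < L"
  shows "(\<Sum>c<N + L. f c * bmat N p q X c (N + j)) = (\<Sum>i<N. f i * X i j) - q * f (N + j)"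
proof -
  have "(\<Sum>c<L. f (N + c) * bmat N p q X (N + c) (N + j)) = (\<Sum>c<L. if j = c then - q * f (N + c) else 0)"
    using assms by (intro sum.cong) (auto simp: bmat_def hermz_def)
  also have "\<dots> = - q * f (N + j)" using assms by simp
  finally show ?thesis using assms by (simp add: sum_lessThan_add bmat_def hermz_def)
qed

text \<open>Both sides are the trace of \<open>X\<close> times the lower left block of
  \<open>R\<close>: the upper rows of \<open>bmat\<close> times \<open>R\<close> give the left side,
  the lower columns of \<open>R\<close> times \<open>bmat\<close> the right side.\<close>

lemma bmat_block_traces:
  assumes R: "inverse_pair (N + L) (bmat N p q X) R"
  shows "of_nat N + p * (\<Sum>i<N. R i i) = of_nat L + q * (\<Sum>j<L. R (N + j) (N + j))"
proof -
  have "(\<Sum>j<L. X i j * R (N + j) i) - p * R i i = 1" if "i < N" for i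
    using R that bmat_upper_row[OF that, where f = "\<lambda>c. R c i" and L = L and p = p and q = q and X = X] by (simp add: inverse_pair_def)
  then have "(\<Sum>i<N. (\<Sum>j<L. X i j * R (N + j) i) - p * R i i) = of_nat N" by simp
  moreover have "(\<Sum>i<N. R (N + j) i * X i j) - q * R (N + j) (N + j) = 1" if "j < L" for j
    using R that bmat_lower_col[OF that, where f = "R (N + j)" and N = N and p = p and q = q and X = X] by (simp add: inverse_pair_def)
  then have "(\<Sum>j<L. (\<Sum>i<N. R (N + j) i * X i j) - q * R (N + j) (N + j)) = of_nat L" by simp
  moreover have "(\<Sum>i<N. \<Sum>j<L. X i j * R (N + j) i) = (\<Sum>j<L. \<Sum>i<N. R (N + j) i * X i j)"
    by (subst sum.swap) (simp add: mult.commute)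
  ultimately show ?thesis by (simp add: sum_subtractf sum_distrib_left algebra_simps)
qed

text \<open>The lower rows express the lower left block of \<open>R\<close> as the adjoint of
  \<open>X\<close> times the upper left block, divided by \<open>q\<close>; this is inserted into
  the upper rows.\<close>

lemma bmat_schur_complement:
  assumes R: "inverse_pair (N + L) (bmat N p q X) R" and q: "q \<noteq> 0" and i: "i < N" and k: "k < N"
  shows "(\<Sum>l<N. (\<Sum>j<L. X i j * cnj (X l j)) * R l k) - p * q * R i k = q * of_bool (i = k)"
proof -
  have up: "(\<Sum>j<L. X i j * R (N + j) k) - p * R i k = of_bool (i = k)"
    using R i k bmat_upper_row[OF i, where f = "\<lambda>c. R c k" and L = L and p = p and q = q and X = X] by (simp add: inverse_pair_def)
  have lo: "(\<Sum>l<N. cnj (X l j) * R l k) = q * R (N + j) k" if "j < L" for j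
  proof -
    have "(\<Sum>l<N. cnj (X l j) * R l k) - q * R (N + j) k = 0"
      using R that k bmat_lower_row[OF that, where f = "\<lambda>c. R c k" and N = N and p = p and q = q and X = X] by (simp add: inverse_pair_def)
    then show ?thesis by simp
  qed
  have "(\<Sum>l<N. (\<Sum>j<L. X i j * cnj (X l j)) * R l k) = (\<Sum>j<L. X i j * (\<Sum>l<N. cnj (X l j) * R l k))"
    by (simp add: sum_distrib_left sum_distrib_right mult.assoc) (rule sum.swap)
  also have "\<dots> = q * (\<Sum>j<L. X i j * R (N + j) k)"
    unfolding sum_distrib_left by (intro sum.cong refl) (simp add: lo flip: sum_distrib_left)
  finally show ?thesis using up by (simp add: algebra_simps)
qed

section \<open>Spectral distributions and resolvent traces of Hermitian matrices\<close>

lemma order_linear_factors: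
  fixes z :: complex
  shows "Polynomial.order z (\<Prod>a\<leftarrow>as. [:- a, 1:]) = count_list as z"
proof (induction as)
  case (Cons a as)
  have nz: "(\<Prod>a\<leftarrow>as. [:- a, 1:]) \<noteq> (0 :: complex poly)" by (auto simp: prod_list_zero_iff)
  have "Polynomial.order z [:- a, 1:] = (if a = z then 1 else 0)"
    using order_power_n_n[of z 1] by (auto intro: order_0I simp del: One_nat_def)
  moreover have "Polynomial.order z ([:- a, 1:] * (\<Prod>a\<leftarrow>as. [:- a, 1:])) =
      Polynomial.order z [:- a, 1:] + Polynomial.order z (\<Prod>a\<leftarrow>as. [:- a, 1:])"
    by (rule order_mult) (use nz in \<open>simp del: mult_pCons_left\<close>)
  ultimately show ?case using Cons by simp
qed auto

lemma esd_eq_count: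
  assumes B: "B \<in> carrier_mat N N" and c: "char_poly B = (\<Prod>a\<leftarrow>as. [:- a, 1:])"
  shows "esd B x = real (length (filter (\<lambda>a. Re a \<le> x) as)) / real N"
proof -
  have "eigenvalue B z \<longleftrightarrow> z \<in> set as" for z
    unfolding eigenvalue_root_char_poly[OF B] c by (auto simp: poly_prod_list prod_list_zero_iff)
  then have eq: "{z. eigenvalue B z \<and> Re z \<le> x} = set (filter (\<lambda>a. Re a \<le> x) as)" by auto
  have "(\<Sum>z | eigenvalue B z \<and> Re z \<le> x. Polynomial.order z (char_poly B)) =
        (\<Sum>z \<in> set (filter (\<lambda>a. Re a \<le> x) as). count_list (filter (\<lambda>a. Re a \<le> x) as) z)"
    unfolding eq c order_linear_factors
  proof (rule sum.cong)
    fix z assume "z \<in> set (filter (\<lambda>a. Re a \<le> x) as)"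
    then have "Re z \<le> x" by simp
    then show "count_list as z = count_list (filter (\<lambda>a. Re a \<le> x) as) z"
      by (induction as) auto
  qed simp
  also have "\<dots> = length (filter (\<lambda>a. Re a \<le> x) as)" by (rule sum_count_set) auto
  finally show ?thesis using B by (simp add: esd_def)
qed

text \<open>Triangularity of \<open>U\<close> is derived: induction on the column shows that its
  entries below the diagonal vanish, so a single product survives in each diagonal entry of
  \<open>U * T\<close>.\<close>

lemma upper_triangular_inverse_diag:
  fixes T :: "complex mat"
  assumes T: "T \<in> carrier_mat n n" and U: "U \<in> carrier_mat n n" and ut: "upper_triangular T"
    and nz: "\<And>i. i < n \<Longrightarrow> T $$ (i,i) \<noteq> 0" and inv: "U * T = 1\<^sub>m n"
  shows "i < n \<Longrightarrow> U $$ (i,i) = 1 / T $$ (i,i)"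
proof -
  have entry: "(\<Sum>k<n. U $$ (i,k) * T $$ (k,j)) = of_bool (i = j)" if "i < n" "j < n" for i j
  proof -
    have "(U * T) $$ (i,j) = (\<Sum>k<n. U $$ (i,k) * T $$ (k,j))"
      using that T U by (auto simp: scalar_prod_def atLeast0LessThan intro!: sum.cong)
    then show ?thesis using inv that by (cases "i = j") simp_all
  qed
  have red: "(\<Sum>k<n. U $$ (i,k) * T $$ (k,j)) = (\<Sum>k<j. U $$ (i,k) * T $$ (k,j)) + U $$ (i,j) * T $$ (j,j)"
    if "i < n" "j < n" for i j
  proof -
    have "(\<Sum>k<n. U $$ (i,k) * T $$ (k,j)) = (\<Sum>k<Suc j. U $$ (i,k) * T $$ (k,j))"
      using that T ut by (intro sum.mono_neutral_right) (auto simp: upper_triangular_def)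
    then show ?thesis by simp
  qed
  have zero: "\<forall>i<n. j < i \<longrightarrow> U $$ (i,j) = 0" for j
  proof (induction j rule: less_induct)
    case (less j)
    show ?case
    proof (intro allI impI)
      fix i assume i: "i < n" "j < i"
      have "(\<Sum>k<j. U $$ (i,k) * T $$ (k,j)) = 0"
        using less i by (intro sum.neutral) auto
      then have "U $$ (i,j) * T $$ (j,j) = 0" using red[of i j] entry[of i j] i by simp
      then show "U $$ (i,j) = 0" using nz[of j] i by simp
    qed
  qed
  assume i: "i < n"
  have "(\<Sum>k<i. U $$ (i,k) * T $$ (k,i)) = 0" using zero i by (intro sum.neutral) auto
  then show ?thesis using red[OF i i] entry[OF i i] nz[OF i] by (simp add: field_simps)
qed

definition hermitian_mat :: "nat \<Rightarrow> complex mat \<Rightarrow> bool" where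
  "hermitian_mat N B \<longleftrightarrow> B \<in> carrier_mat N N \<and> (\<forall>i<N. \<forall>j<N. B $$ (j,i) = cnj (B $$ (i,j)))"

lemma hermitian_mat_quadratic_form:
  assumes "hermitian_mat N B"
  shows "Im (\<Sum>i<N. \<Sum>j<N. cnj (v i) * B $$ (i,j) * v j) = 0"
proof -
  define H where "H = (\<Sum>i<N. \<Sum>j<N. cnj (v i) * B $$ (i,j) * v j)"
  have "cnj H = (\<Sum>i<N. \<Sum>j<N. v i * B $$ (j,i) * cnj (v j))"
  proof -
    have "cnj (B $$ (i,j)) = B $$ (j,i)" if "i < N" "j < N" for i j
      using assms that unfolding hermitian_mat_def by metis
    then show ?thesis unfolding H_def cnj_sum by (intro sum.cong refl) simp
  qed
  also have "\<dots> = H" unfolding H_def by (subst sum.swap) (simp add: mult.commute mult.left_commute)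
  finally show ?thesis unfolding H_def[symmetric] by (simp add: complex_eq_iff)
qed

lemma hermitian_mat_eigenvalue_real:
  assumes B: "hermitian_mat N B" and e: "eigenvalue B e"
  shows "Im e = 0"
proof -
  have BN: "B \<in> carrier_mat N N" using B by (simp add: hermitian_mat_def)
  obtain v where v: "v \<in> carrier_vec N" "v \<noteq> 0\<^sub>v N" "B *\<^sub>v v = e \<cdot>\<^sub>v v"
    using e BN unfolding eigenvalue_def eigenvector_def by auto
  have row: "(\<Sum>j<N. B $$ (i,j) * v $ j) = e * v $ i" if "i < N" for i
  proof -
    have "(B *\<^sub>v v) $ i = (\<Sum>j<N. B $$ (i,j) * v $ j)"
      using that v(1) BN by (auto simp: scalar_prod_def atLeast0LessThan intro!: sum.cong)
    then show ?thesis using v that by simp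
  qed
  have "(\<Sum>i<N. \<Sum>j<N. cnj (v $ i) * B $$ (i,j) * v $ j) = (\<Sum>i<N. cnj (v $ i) * (\<Sum>j<N. B $$ (i,j) * v $ j))"
    by (simp add: sum_distrib_left mult.assoc)
  also have "\<dots> = (\<Sum>i<N. e * (cnj (v $ i) * v $ i))" by (intro sum.cong refl) (simp add: row)
  also have "\<dots> = e * complex_of_real (\<Sum>i<N. (cmod (v $ i))\<^sup>2)"
    unfolding of_real_sum complex_norm_square sum_distrib_left
    by (intro sum.cong refl) (simp add: mult_ac)
  finally have "Im e * (\<Sum>i<N. (cmod (v $ i))\<^sup>2) = 0"
    using hermitian_mat_quadratic_form[OF B, of "\<lambda>i. v $ i"] by simp
  moreover have "(\<Sum>i<N. (cmod (v $ i))\<^sup>2) \<noteq> 0"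
  proof
    assume "(\<Sum>i<N. (cmod (v $ i))\<^sup>2) = 0"
    then have "\<forall>i<N. v $ i = 0" by (subst (asm) sum_nonneg_eq_0_iff) auto
    then have "v = 0\<^sub>v N" using v(1) by (intro eq_vecI) auto
    with v(2) show False by simp
  qed
  ultimately show ?thesis by simp
qed

text \<open>A Schur form suffices in place of a diagonalization: the trace is invariant under
  similarity, and the inverse of the triangular matrix \<open>T - \<zeta>\<close> has the
  reciprocals on its diagonal. Symmetry serves to make the eigenvalues real.\<close>

lemma hermitian_mat_resolvent_trace:
  assumes B: "hermitian_mat N B"
  obtains es :: "real list" where "length es = N"
    "\<And>x. esd B x = real (length (filter (\<lambda>a. a \<le> x) es)) / real N"
    "\<And>\<zeta> Q. Im \<zeta> \<noteq> 0 \<Longrightarrow>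
       (\<And>i k. i < N \<Longrightarrow> k < N \<Longrightarrow> (\<Sum>l<N. B $$ (i,l) * Q l k) - \<zeta> * Q i k = of_bool (i = k)) \<Longrightarrow>
       (\<Sum>i<N. Q i i) = (\<Sum>i<N. 1 / (complex_of_real (es ! i) - \<zeta>))"
proof -
  have BN: "B \<in> carrier_mat N N" using B by (simp add: hermitian_mat_def)
  obtain as where as: "char_poly B = (\<Prod>a\<leftarrow>as. [:- a, 1:])" "length as = N"
    using char_poly_factorized[OF BN] by auto
  have "eigenvalue B a" if "a \<in> set as" for a
    unfolding eigenvalue_root_char_poly[OF BN] as(1) using that
    by (auto simp: poly_prod_list prod_list_zero_iff)
  then have re: "complex_of_real (Re a) = a" if "a \<in> set as" for a
    using hermitian_mat_eigenvalue_real[OF B] that by (simp add: complex_eq_iff)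
  define es where "es = map Re as"
  obtain T P P' where sd: "schur_decomposition B as = (T, P, P')" by (cases "schur_decomposition B as") auto
  have wit: "similar_mat_wit B T P P'" and ut: "upper_triangular T" and dg: "diag_mat T = as"
    using schur_decomposition[OF BN as(1) sd] by auto
  note sw = similar_mat_witD2[OF BN wit]
  have P: "P \<in> carrier_mat N N" and P': "P' \<in> carrier_mat N N" and T: "T \<in> carrier_mat N N"
    using sw by auto
  have Tii: "T $$ (i,i) = complex_of_real (es ! i)" if "i < N" for i
  proof -
    have "as ! i = T $$ (i,i)" using dg that T by (auto simp: diag_mat_def)
    moreover have "as ! i \<in> set as" using that as(2) by simp
    ultimately show ?thesis using re[of "as ! i"] that as(2) by (simp add: es_def)
  qed
  show ?thesis
  proof
    show "length es = N" by (simp add: es_def as)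
    show "esd B x = real (length (filter (\<lambda>a. a \<le> x) es)) / real N" for x
      by (simp add: esd_eq_count[OF BN as(1)] es_def filter_map comp_def)
    fix \<zeta> :: complex and Q :: "nat \<Rightarrow> nat \<Rightarrow> complex"
    assume \<zeta>: "Im \<zeta> \<noteq> 0"
      and Q: "\<And>i k. i < N \<Longrightarrow> k < N \<Longrightarrow> (\<Sum>l<N. B $$ (i,l) * Q l k) - \<zeta> * Q i k = of_bool (i = k)"
    define Qm where "Qm = mat N N (\<lambda>(i,j). Q i j)"
    have Qm: "Qm \<in> carrier_mat N N" by (simp add: Qm_def)
    define Tz where "Tz = T - \<zeta> \<cdot>\<^sub>m 1\<^sub>m N"
    have Tz: "Tz \<in> carrier_mat N N"
      unfolding Tz_def by (intro minus_carrier_mat smult_carrier_mat one_carrier_mat)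
    define U where "U = P' * (Qm * P)"
    have U: "U \<in> carrier_mat N N" using P P' Qm by (simp add: U_def)

    have BQ: "B * Qm - \<zeta> \<cdot>\<^sub>m Qm = 1\<^sub>m N"
    proof (rule eq_matI)
      fix i j assume ij: "i < dim_row (1\<^sub>m N :: complex mat)" "j < dim_col (1\<^sub>m N :: complex mat)"
      then have "(B * Qm) $$ (i,j) = (\<Sum>l<N. B $$ (i,l) * Q l j)"
        using BN by (auto simp: scalar_prod_def atLeast0LessThan Qm_def intro!: sum.cong)
      then show "(B * Qm - \<zeta> \<cdot>\<^sub>m Qm) $$ (i,j) = 1\<^sub>m N $$ (i,j)"
        using Q[of i j] ij BN by (auto simp: Qm_def)
    qed (use BN Qm in auto)
    have "P' * B = T * P'"
    proof -
      have "P' * B = P' * (P * (T * P'))" unfolding sw(3) assoc_mult_mat[OF P T P'] ..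
      also have "\<dots> = (P' * P) * (T * P')" using P P' T by (intro assoc_mult_mat[symmetric]) auto
      also have "\<dots> = T * P'" unfolding sw(2) using P' T by (intro left_mult_one_mat) auto
      finally show ?thesis .
    qed
    then have "T * (P' * Qm) = P' * (B * Qm)"
      using assoc_mult_mat[OF T P' Qm] assoc_mult_mat[OF P' BN Qm] by simp
    then have TQ: "T * (P' * Qm) - \<zeta> \<cdot>\<^sub>m (P' * Qm) = P'"
    proof -
      assume a: "T * (P' * Qm) = P' * (B * Qm)"
      have "P' * (B * Qm - \<zeta> \<cdot>\<^sub>m Qm) = P' * (B * Qm) - P' * (\<zeta> \<cdot>\<^sub>m Qm)"
        using P' BN Qm by (intro mult_minus_distrib_mat) auto
      also have "P' * (\<zeta> \<cdot>\<^sub>m Qm) = \<zeta> \<cdot>\<^sub>m (P' * Qm)"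
        using P' Qm by (intro mult_smult_distrib) auto
      finally show ?thesis using a BQ P' by simp
    qed
    have U2: "U = (P' * Qm) * P" unfolding U_def by (rule assoc_mult_mat[OF P' Qm P, symmetric])
    define V where "V = P' * Qm"
    have V: "V \<in> carrier_mat N N" using P' Qm by (simp add: V_def)
    have "Tz * V = T * V - \<zeta> \<cdot>\<^sub>m V"
    proof -
      have "Tz * V = T * V - (\<zeta> \<cdot>\<^sub>m 1\<^sub>m N) * V"
        unfolding Tz_def using T V by (intro minus_mult_distrib_mat) auto
      also have "(\<zeta> \<cdot>\<^sub>m 1\<^sub>m N) * V = \<zeta> \<cdot>\<^sub>m V" using V by (simp add: mult_smult_assoc_mat[of _ N N _ N])
      finally show ?thesis .
    qed
    then have "Tz * V = P'" using TQ by (simp add: V_def)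
    then have "Tz * U = 1\<^sub>m N"
      unfolding U2 V_def[symmetric] assoc_mult_mat[OF Tz V P, symmetric] by (simp only: sw(2))
    then have UT: "U * Tz = 1\<^sub>m N" by (rule mat_mult_left_right_inverse[OF Tz U])
    have utz: "upper_triangular Tz" using ut T by (auto simp: upper_triangular_def Tz_def)
    have nz: "Tz $$ (i,i) \<noteq> 0" if "i < N" for i
      using that T \<zeta> Tii[OF that] by (auto simp: Tz_def complex_eq_iff)
    have Uii: "U $$ (i,i) = 1 / (complex_of_real (es ! i) - \<zeta>)" if "i < N" for i
      using upper_triangular_inverse_diag[OF Tz U utz nz UT that] that T Tii[OF that] by (simp add: Tz_def)
    have "(\<Sum>i<N. U $$ (i,i)) = (\<Sum>i<N. \<Sum>k<N. V $$ (i,k) * P $$ (k,i))"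
      unfolding U2 V_def[symmetric] using V P
      by (auto simp: scalar_prod_def atLeast0LessThan intro!: sum.cong)
    also have "\<dots> = (\<Sum>k<N. \<Sum>i<N. P $$ (k,i) * V $$ (i,k))" by (subst sum.swap) (simp add: mult.commute)
    also have "\<dots> = (\<Sum>k<N. (P * V) $$ (k,k))"
      using V P by (auto simp: scalar_prod_def atLeast0LessThan intro!: sum.cong)
    also have "P * V = Qm"
      unfolding V_def assoc_mult_mat[OF P P' Qm, symmetric] sw(1) using Qm by simp
    finally have "(\<Sum>i<N. Qm $$ (i,i)) = (\<Sum>i<N. U $$ (i,i))" ..
    then show "(\<Sum>i<N. Q i i) = (\<Sum>i<N. 1 / (complex_of_real (es ! i) - \<zeta>))"
      using Uii by (simp add: Qm_def)
  qed
qed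

text \<open>Only meaningful for Hermitian matrices of positive dimension, where such a measure exists and is unique.\<close>

definition esd_measure :: "complex mat \<Rightarrow> real measure" where
  "esd_measure B = (SOME \<mu>. real_distribution \<mu> \<and> cdf \<mu> = esd B)"

lemma esd_measure:
  assumes B: "hermitian_mat N B" and N: "N > 0"
  shows real_distribution_esd_measure: "real_distribution (esd_measure B)"
    and cdf_esd_measure: "cdf (esd_measure B) = esd B"
    and stieltjes_esd_measure: "Im \<zeta> \<noteq> 0 \<Longrightarrow>
       (\<And>i k. i < N \<Longrightarrow> k < N \<Longrightarrow> (\<Sum>l<N. B $$ (i,l) * Q l k) - \<zeta> * Q i k = of_bool (i = k)) \<Longrightarrow>
       (\<Sum>i<N. Q i i) = of_nat N * stieltjes (esd_measure B) \<zeta>"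
proof -
  obtain es where es: "length es = N"
    "\<And>x. esd B x = real (length (filter (\<lambda>a. a \<le> x) es)) / real N"
    "\<And>\<zeta> Q. Im \<zeta> \<noteq> 0 \<Longrightarrow>
       (\<And>i k. i < N \<Longrightarrow> k < N \<Longrightarrow> (\<Sum>l<N. B $$ (i,l) * Q l k) - \<zeta> * Q i k = of_bool (i = k)) \<Longrightarrow>
       (\<Sum>i<N. Q i i) = (\<Sum>i<N. 1 / (complex_of_real (es ! i) - \<zeta>))"
    using hermitian_mat_resolvent_trace[OF B] by blast
  \<comment> \<open>The uniform law on indices, pushed forward by the eigenvalue list, respects
    multiplicities.\<close>
  define \<mu> where "\<mu> = distr (measure_pmf (pmf_of_set {..<N})) borel (\<lambda>i. es ! i)"
  have ne: "{..<N} \<noteq> {}" using N by auto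
  have \<mu>: "real_distribution \<mu>"
    unfolding \<mu>_def by (intro real_distribution.intro real_distribution_axioms.intro measure_pmf.prob_space_distr) auto
  have "cdf \<mu> x = esd B x" for x
  proof -
    have "cdf \<mu> x = measure (measure_pmf (pmf_of_set {..<N})) ((\<lambda>i. es ! i) -` {..x})"
      unfolding \<mu>_def cdf_def by (subst measure_distr) auto
    also have "\<dots> = real (card {i. i < N \<and> es ! i \<le> x}) / real N"
      using ne by (subst measure_pmf_of_set) (auto intro!: arg_cong[where f = card])
    finally show ?thesis by (simp add: es length_filter_conv_card)
  qed
  then have cdf\<mu>: "cdf \<mu> = esd B" by auto
  have ex: "real_distribution (esd_measure B) \<and> cdf (esd_measure B) = esd B"
    unfolding esd_measure_def by (rule someI[of _ \<mu>]) (use \<mu> cdf\<mu> in simp)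
  then show 1: "real_distribution (esd_measure B)" and 2: "cdf (esd_measure B) = esd B" by auto
  \<comment> \<open>A distribution function determines its measure, so the value picked by
    \<open>SOME\<close> is the concrete \<open>\<mu>\<close>.\<close>
  have eq: "esd_measure B = \<mu>" by (rule cdf_unique[OF 1 \<mu>]) (simp add: 2 cdf\<mu>)
  assume \<zeta>: "Im \<zeta> \<noteq> 0"
    and Q: "\<And>i k. i < N \<Longrightarrow> k < N \<Longrightarrow> (\<Sum>l<N. B $$ (i,l) * Q l k) - \<zeta> * Q i k = of_bool (i = k)"
  have "stieltjes \<mu> \<zeta> = (\<integral>i. 1 / (complex_of_real (es ! i) - \<zeta>) \<partial>measure_pmf (pmf_of_set {..<N}))"
    unfolding stieltjes_def \<mu>_def by (subst integral_distr) auto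
  also have "\<dots> = (\<Sum>i<N. 1 / (complex_of_real (es ! i) - \<zeta>)) / of_nat N"
    using ne by (subst integral_measure_pmf[of "{..<N}"])
       (auto simp: scaleR_conv_of_real sum_divide_distrib mult.commute)
  finally show "(\<Sum>i<N. Q i i) = of_nat N * stieltjes (esd_measure B) \<zeta>"
    using es(3)[OF \<zeta> Q] N by (simp add: eq)
qed

lemma mat_adjoint_carrier: "X \<in> carrier_mat N L \<Longrightarrow> mat_adjoint X \<in> carrier_mat L N"
  by (auto simp: mat_adjoint_def)

lemma gram_entry:
  fixes X :: "complex mat"
  assumes "X \<in> carrier_mat N L" "i < N" "l < N"
  shows "(X * mat_adjoint X) $$ (i,l) = (\<Sum>j<L. X $$ (i,j) * cnj (X $$ (l,j)))"
  using assms mat_adjoint_carrier[OF assms(1)]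
  by (auto simp: scalar_prod_def atLeast0LessThan mat_adjoint_def mat_of_rows_def intro!: sum.cong)

lemma hermitian_mat_gram:
  assumes "X \<in> carrier_mat N L"
  shows "hermitian_mat N (X * mat_adjoint X)"
  unfolding hermitian_mat_def
  using assms mat_adjoint_carrier[OF assms] by (auto simp: gram_entry[OF assms] mult.commute simp del: index_mult_mat)

text \<open>The upper left block of the inverse of \<^const>\<open>bmat\<close> is \<open>q (X X\<^sup>* - p q)\<inverse>\<close>.\<close>

lemma bmat_trace_stieltjes:
  assumes X: "X \<in> carrier_mat N L" and N: "N > 0" and R: "inverse_pair (N + L) (bmat N p q (\<lambda>i j. X $$ (i,j))) R"
    and q: "q \<noteq> 0" and pq: "Im (p * q) \<noteq> 0"
  shows "(\<Sum>i<N. R i i) = of_nat N * q * stieltjes (esd_measure (X * mat_adjoint X)) (p * q)"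
proof -
  have "(\<Sum>i<N. R i i / q) = of_nat N * stieltjes (esd_measure (X * mat_adjoint X)) (p * q)"
  proof (rule stieltjes_esd_measure[OF hermitian_mat_gram[OF X] N pq, where Q = "\<lambda>i k. R i k / q"])
    fix i k assume ik: "i < N" "k < N"
    have "(\<Sum>l<N. (X * mat_adjoint X) $$ (i,l) * (R l k / q)) = (\<Sum>l<N. (X * mat_adjoint X) $$ (i,l) * R l k) / q"
      by (simp add: sum_divide_distrib)
    also have "(\<Sum>l<N. (X * mat_adjoint X) $$ (i,l) * R l k) = (\<Sum>l<N. (\<Sum>j<L. X $$ (i,j) * cnj (X $$ (l,j))) * R l k)"
      by (intro sum.cong refl) (use ik in \<open>simp add: gram_entry[OF X] del: index_mult_mat\<close>)
    also have "\<dots> = p * q * R i k + q * of_bool (i = k)"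
      using bmat_schur_complement[OF R q ik] by (simp add: algebra_simps)
    finally have "(\<Sum>l<N. (X * mat_adjoint X) $$ (i,l) * (R l k / q)) = (p * q * R i k + q * of_bool (i = k)) / q" .
    then show "(\<Sum>l<N. (X * mat_adjoint X) $$ (i,l) * (R l k / q)) - p * q * (R i k / q) = of_bool (i = k)"
      using q by (simp add: add_divide_distrib)
  qed
  then show ?thesis using q by (simp add: field_simps flip: sum_divide_distrib)
qed

section \<open>Product measures: resampling and the Efron--Stein inequality\<close>

text \<open>A non-integrable function has Bochner integral 0; that case is where
  \<open>c \<ge> 0\<close> enters.\<close>

lemma (in prob_space) norm_integral_le_const:
  fixes g :: "'a \<Rightarrow> 'b::{banach, second_countable_topology}"
  assumes "\<And>x. x \<in> space M \<Longrightarrow> norm (g x) \<le> c" "c \<ge> 0"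
  shows "norm (\<integral>x. g x \<partial>M) \<le> c"
proof (cases "integrable M g")
  case True
  have "norm (\<integral>x. g x \<partial>M) \<le> (\<integral>x. norm (g x) \<partial>M)" by (rule integral_norm_bound)
  also have "\<dots> \<le> (\<integral>x. c \<partial>M)" using True assms by (intro integral_mono) auto
  finally show ?thesis by (simp add: prob_space)
qed (use assms in \<open>simp add: not_integrable_integral_eq\<close>)

lemma (in prob_space) integral_le_const_nonneg:
  fixes g :: "'a \<Rightarrow> real"
  assumes "\<And>x. x \<in> space M \<Longrightarrow> g x \<le> c" "c \<ge> 0"
  shows "(\<integral>x. g x \<partial>M) \<le> c"
proof (cases "integrable M g")
  case True
  then have "(\<integral>x. g x \<partial>M) \<le> (\<integral>x. c \<partial>M)" using assms by (intro integral_mono) auto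
  then show ?thesis by (simp add: prob_space)
qed (use assms in \<open>simp add: not_integrable_integral_eq\<close>)

text \<open>Bias-variance decomposition. In particular the deviation from the mean is the smallest
  one, which allows the mean to be exchanged for any convenient constant.\<close>

lemma (in prob_space) integral_square_deviation:
  fixes g :: "'a \<Rightarrow> real"
  assumes [measurable]: "g \<in> borel_measurable M" and b: "\<And>x. x \<in> space M \<Longrightarrow> \<bar>g x\<bar> \<le> B"
  shows "(\<integral>x. (g x - c)\<^sup>2 \<partial>M) = (\<integral>x. (g x - (\<integral>x. g x \<partial>M))\<^sup>2 \<partial>M) + ((\<integral>x. g x \<partial>M) - c)\<^sup>2"
proof -
  define m where "m = (\<integral>x. g x \<partial>M)"
  have ig: "integrable M g" by (rule integrable_const_bound[of _ B]) (use b in auto)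
  have ig2: "integrable M (\<lambda>x. (g x)\<^sup>2)"
  proof (rule integrable_const_bound[of _ "B\<^sup>2"])
    show "AE x in M. norm ((g x)\<^sup>2) \<le> B\<^sup>2"
    proof (rule AE_I2)
      fix x assume "x \<in> space M"
      then have "\<bar>g x\<bar>\<^sup>2 \<le> B\<^sup>2" using b by (intro power_mono) auto
      then show "norm ((g x)\<^sup>2) \<le> B\<^sup>2" by simp
    qed
  qed simp
  have *: "(\<integral>x. (g x - t)\<^sup>2 \<partial>M) = (\<integral>x. (g x)\<^sup>2 \<partial>M) - 2 * t * m + t\<^sup>2" for t
    using ig ig2 by (simp add: power2_diff m_def prob_space algebra_simps)
  show ?thesis unfolding m_def[symmetric] * by (simp add: power2_eq_square algebra_simps)
qed

context
  fixes D :: "'a measure"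
  assumes D: "prob_space D"
begin

interpretation D: prob_space D by (rule D)
interpretation PD: product_sigma_finite "\<lambda>_. D" by unfold_locales

lemma prob_space_PiM_const: "prob_space (PiM I (\<lambda>_. D))"
  by (rule prob_space_PiM) (rule D)

lemma fun_upd_in_space_PiM:
  "p \<in> I \<Longrightarrow> y \<in> space (PiM I (\<lambda>_. D)) \<Longrightarrow> x \<in> space D \<Longrightarrow> y(p := x) \<in> space (PiM I (\<lambda>_. D))"
  by (auto simp: space_PiM PiE_def extensional_def)

lemma fun_upd_in_space_PiM_insert:
  "y \<in> space (PiM J (\<lambda>_. D)) \<Longrightarrow> x \<in> space D \<Longrightarrow> y(p := x) \<in> space (PiM (insert p J) (\<lambda>_. D))"
  by (auto simp: space_PiM PiE_def extensional_def)

lemma integral_PiM_remove: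
  fixes h :: "('i \<Rightarrow> 'a) \<Rightarrow> 'b::{banach, second_countable_topology}"
  assumes "finite I" "p \<in> I" "integrable (PiM I (\<lambda>_. D)) h"
  shows "(\<integral>y. h y \<partial>PiM I (\<lambda>_. D)) = (\<integral>y. (\<integral>x. h (y(p := x)) \<partial>D) \<partial>PiM (I - {p}) (\<lambda>_. D))"
  using PD.product_integral_insert[of "I - {p}" p h] assms by (simp add: insert_absorb)

text \<open>\<open>h (y(p := x))\<close> does not depend on the old value \<open>y p\<close>, so
  after Fubini any point of \<open>D\<close> may fill that coordinate. A uniform bound on the
  average over one coordinate thus bounds the whole integral, even when \<open>h\<close> is
  unbounded.\<close>

lemma norm_integral_resample_le:
  fixes h :: "('i \<Rightarrow> 'a) \<Rightarrow> 'b::{banach, second_countable_topology}"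
  assumes I: "finite I" "p \<in> I" and h: "integrable (PiM I (\<lambda>_. D)) h" and c: "c \<ge> 0"
    and b: "\<And>y. y \<in> space (PiM I (\<lambda>_. D)) \<Longrightarrow> norm (\<integral>x. h (y(p := x)) \<partial>D) \<le> c"
  shows "norm (\<integral>y. h y \<partial>PiM I (\<lambda>_. D)) \<le> c"
  unfolding integral_PiM_remove[OF I h]
proof (rule prob_space.norm_integral_le_const[OF prob_space_PiM_const _ c])
  fix y assume y: "y \<in> space (PiM (I - {p}) (\<lambda>_. D))"
  obtain z where z: "z \<in> space D" using D.not_empty by auto
  have "y(p := z) \<in> space (PiM I (\<lambda>_. D))"
    using fun_upd_in_space_PiM_insert[OF y z, of p] I by (simp add: insert_absorb)
  from b[OF this] show "norm (\<integral>x. h (y(p := x)) \<partial>D) \<le> c" by simp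
qed

lemma integral_resample_le:
  fixes h :: "('i \<Rightarrow> 'a) \<Rightarrow> real"
  assumes I: "finite I" "p \<in> I" and h: "integrable (PiM I (\<lambda>_. D)) h" and c: "c \<ge> 0"
    and b: "\<And>y. y \<in> space (PiM I (\<lambda>_. D)) \<Longrightarrow> (\<integral>x. h (y(p := x)) \<partial>D) \<le> c"
  shows "(\<integral>y. h y \<partial>PiM I (\<lambda>_. D)) \<le> c"
  unfolding integral_PiM_remove[OF I h]
proof (rule prob_space.integral_le_const_nonneg[OF prob_space_PiM_const _ c])
  fix y assume y: "y \<in> space (PiM (I - {p}) (\<lambda>_. D))"
  obtain z where z: "z \<in> space D" using D.not_empty by auto
  have "y(p := z) \<in> space (PiM I (\<lambda>_. D))"
    using fun_upd_in_space_PiM_insert[OF y z, of p] I by (simp add: insert_absorb)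
  from b[OF this] show "(\<integral>x. h (y(p := x)) \<partial>D) \<le> c" by simp
qed

text \<open>Coordinates are replaced by a fixed point \<open>z\<close> instead of an independent
  copy: the variance in one coordinate is at most the mean square deviation from the value at
  \<open>z\<close>. In the induction step, the variance splits into that of the new coordinate and
  that of the average \<open>\<phi>\<close> over it, to which the hypothesis applies.\<close>

lemma efron_stein:
  fixes f :: "('i \<Rightarrow> 'a) \<Rightarrow> real"
  assumes "finite I" "f \<in> borel_measurable (PiM I (\<lambda>_. D))"
    "\<And>y. y \<in> space (PiM I (\<lambda>_. D)) \<Longrightarrow> \<bar>f y\<bar> \<le> B" and z: "z \<in> space D"
  shows "(\<integral>y. (f y - (\<integral>y. f y \<partial>PiM I (\<lambda>_. D)))\<^sup>2 \<partial>PiM I (\<lambda>_. D)) \<le>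
         (\<Sum>p\<in>I. \<integral>y. (f y - f (y(p := z)))\<^sup>2 \<partial>PiM I (\<lambda>_. D))"
  using assms(1-3)
proof (induction I arbitrary: f rule: finite_induct)
  case empty
  then show ?case
    by (simp add: PiM_empty lebesgue_integral_count_space_finite)
next
  case (insert p J f)
  let ?J = "PiM J (\<lambda>_. D)" and ?I = "PiM (insert p J) (\<lambda>_. D)"
  interpret J: prob_space ?J by (rule prob_space_PiM_const)
  interpret I: prob_space ?I by (rule prob_space_PiM_const)
  have f[measurable]: "f \<in> borel_measurable ?I" by fact
  have fB: "\<bar>f (y(p := x))\<bar> \<le> B" if "y \<in> space ?J" "x \<in> space D" for y x
    using insert.prems(2)[OF fun_upd_in_space_PiM_insert[OF that]] .
  have B0: "B \<ge> 0" using I.not_empty insert.prems(2) by (meson abs_ge_zero all_not_in_conv order_trans)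
  have upd[measurable]: "(\<lambda>w. (fst w)(p := snd w)) \<in> measurable (?J \<Otimes>\<^sub>M D) ?I"
    using measurable_add_dim[of p J "\<lambda>_. D"] by (simp add: split_beta')
  have fupd[measurable]: "(\<lambda>w. f ((fst w)(p := snd w))) \<in> borel_measurable (?J \<Otimes>\<^sub>M D)"
    by measurable
  have fx: "(\<lambda>x. f (y(p := x))) \<in> borel_measurable D" if "y \<in> space ?J" for y
    using measurable_compose[OF measurable_Pair1'[OF that] fupd] by simp
  define \<phi> where "\<phi> y = (\<integral>x. f (y(p := x)) \<partial>D)" for y
  have \<phi>m[measurable]: "\<phi> \<in> borel_measurable ?J"
    unfolding \<phi>_def using fupd by (intro D.borel_measurable_lebesgue_integral) (simp add: split_beta')
  have \<phi>B: "\<bar>\<phi> y\<bar> \<le> B" if "y \<in> space ?J" for y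
    unfolding \<phi>_def using D.norm_integral_le_const[of "\<lambda>x. f (y(p := x))" B] fB[OF that] B0 by simp
  define m where "m = (\<integral>y. f y \<partial>?I)"
  have ins: "(\<integral>y. h y \<partial>?I) = (\<integral>y. (\<integral>x. h (y(p := x)) \<partial>D) \<partial>?J)" if "integrable ?I h" for h :: "_ \<Rightarrow> real"
    using PD.product_integral_insert[of J p h] insert.hyps that by simp
  have intf: "integrable ?I f" by (rule I.integrable_const_bound[of _ B]) (use insert.prems in auto)
  have m: "m = (\<integral>y. \<phi> y \<partial>?J)" unfolding m_def \<phi>_def by (rule ins[OF intf])
  have sq: "norm ((a - b)\<^sup>2) \<le> (2 * B)\<^sup>2" if "\<bar>a\<bar> \<le> B" "\<bar>b\<bar> \<le> B" for a b :: real
  proof -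
    have "(a - b)\<^sup>2 \<le> (2 * B)\<^sup>2"
      using that by (intro power2_le_iff_abs_le[THEN iffD2]) (use B0 in linarith)+
    then show ?thesis by simp
  qed
  have mB: "\<bar>m\<bar> \<le> B"
    unfolding m_def using I.norm_integral_le_const[of f B] insert.prems(2) B0 by simp
  have updI[measurable]: "(\<lambda>y. f (y(q := z))) \<in> borel_measurable ?I" if "q \<in> insert p J" for q
  proof -
    have "(\<lambda>y. y(q := z)) \<in> measurable ?I ?I"
      using that z by (intro measurable_fun_upd[of _ "insert p J"]) auto
    then show ?thesis using f by (rule measurable_compose)
  qed
  have intq: "integrable ?I (\<lambda>y. (f y - f (y(q := z)))\<^sup>2)" if "q \<in> insert p J" for q
  proof (rule I.integrable_const_bound[of _ "(2 * B)\<^sup>2"])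
    show "AE y in ?I. norm ((f y - f (y(q := z)))\<^sup>2) \<le> (2 * B)\<^sup>2"
      by (intro AE_I2 sq insert.prems(2) fun_upd_in_space_PiM[OF that _ z])
  qed (use updI[OF that] in measurable)
  have intm: "integrable ?I (\<lambda>y. (f y - m)\<^sup>2)"
    by (rule I.integrable_const_bound[of _ "(2 * B)\<^sup>2"])
       (intro AE_I2 sq insert.prems(2) mB, measurable)
  have int\<phi>: "integrable ?J (\<lambda>y. (\<phi> y - m)\<^sup>2)"
    by (rule J.integrable_const_bound[of _ "(2 * B)\<^sup>2"])
       (intro AE_I2 sq \<phi>B mB, measurable)
  define A where "A y = (\<integral>x. (f (y(p := x)) - f (y(p := z)))\<^sup>2 \<partial>D)" for y
  have Am: "A \<in> borel_measurable ?J"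
  proof -
    have "(\<lambda>w. f ((fst w)(p := snd w, p := z))) \<in> borel_measurable (?J \<Otimes>\<^sub>M D)"
      using measurable_compose[OF upd updI[of p]] by simp
    then have "(\<lambda>(y, x). (f (y(p := x)) - f (y(p := z)))\<^sup>2) \<in> borel_measurable (?J \<Otimes>\<^sub>M D)"
      using fupd by (simp add: split_beta')
    then show ?thesis unfolding A_def by (rule D.borel_measurable_lebesgue_integral)
  qed
  have intA: "integrable ?J A"
  proof (rule J.integrable_const_bound[of _ "(2 * B)\<^sup>2"])
    show "AE y in ?J. norm (A y) \<le> (2 * B)\<^sup>2"
      unfolding A_def by (intro AE_I2 D.norm_integral_le_const sq fB z) auto
  qed (rule Am)
  have "(\<integral>y. (f y - m)\<^sup>2 \<partial>?I) = (\<integral>y. (\<integral>x. (f (y(p := x)) - m)\<^sup>2 \<partial>D) \<partial>?J)"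
    by (rule ins[OF intm])
  \<comment> \<open>Bias-variance twice in coordinate \<open>p\<close>: around \<open>m\<close> it
    isolates a variance and \<open>(\<phi> y - m)\<^sup>2\<close>, around
    \<open>f (y(p := z))\<close> it bounds that variance by \<open>A y\<close>.\<close>
  also have "\<dots> \<le> (\<integral>y. A y + (\<phi> y - m)\<^sup>2 \<partial>?J)"
  proof (rule integral_mono')
    show "integrable ?J (\<lambda>y. A y + (\<phi> y - m)\<^sup>2)" using intA int\<phi> by simp
    fix y assume y: "y \<in> space ?J"
    show "(\<integral>x. (f (y(p := x)) - m)\<^sup>2 \<partial>D) \<le> A y + (\<phi> y - m)\<^sup>2"
      unfolding A_def
      using D.integral_square_deviation[OF fx[OF y] fB[OF y], of m]
        D.integral_square_deviation[OF fx[OF y] fB[OF y], of "f (y(p := z))"]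
      by (simp add: \<phi>_def)
    show "0 \<le> A y + (\<phi> y - m)\<^sup>2" unfolding A_def by (simp add: integral_nonneg_AE)
  qed
  also have "\<dots> = (\<integral>y. A y \<partial>?J) + (\<integral>y. (\<phi> y - m)\<^sup>2 \<partial>?J)"
    using intA int\<phi> by simp
  also have "(\<integral>y. A y \<partial>?J) = (\<integral>y. (f y - f (y(p := z)))\<^sup>2 \<partial>?I)"
    using ins[OF intq[of p]] by (simp add: A_def)
  also have "(\<integral>y. (\<phi> y - m)\<^sup>2 \<partial>?J) \<le> (\<Sum>q\<in>J. \<integral>y. (\<phi> y - \<phi> (y(q := z)))\<^sup>2 \<partial>?J)"
    unfolding m by (rule insert.IH[OF \<phi>m \<phi>B])
  also have "\<dots> \<le> (\<Sum>q\<in>J. \<integral>y. (f y - f (y(q := z)))\<^sup>2 \<partial>?I)"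
  proof (rule sum_mono)
    fix q assume q: "q \<in> J"
    have pq: "p \<noteq> q" using q insert.hyps by auto
    define G where "G y = (\<integral>x. (f (y(p := x)) - f (y(q := z, p := x)))\<^sup>2 \<partial>D)" for y
    have tw: "y(q := z, p := x) = y(p := x, q := z)" for y x using pq by (auto simp: fun_upd_def)
    have eq: "(\<integral>y. (f y - f (y(q := z)))\<^sup>2 \<partial>?I) = (\<integral>y. G y \<partial>?J)"
      using ins[OF intq[of q]] q unfolding G_def tw by simp
    have Gm: "G \<in> borel_measurable ?J"
    proof -
      have "(\<lambda>w. f ((fst w)(p := snd w, q := z))) \<in> borel_measurable (?J \<Otimes>\<^sub>M D)"
        using measurable_compose[OF upd updI[of q]] q by simp
      then have "(\<lambda>(y, x). (f (y(p := x)) - f (y(p := x, q := z)))\<^sup>2) \<in> borel_measurable (?J \<Otimes>\<^sub>M D)"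
        using fupd by (simp add: split_beta')
      then show ?thesis unfolding G_def tw by (rule D.borel_measurable_lebesgue_integral)
    qed
    have "(\<integral>y. (\<phi> y - \<phi> (y(q := z)))\<^sup>2 \<partial>?J) \<le> (\<integral>y. G y \<partial>?J)"
    proof (rule integral_mono')
      show "integrable ?J G"
      proof (rule J.integrable_const_bound[of _ "(2 * B)\<^sup>2"])
        show "AE y in ?J. norm (G y) \<le> (2 * B)\<^sup>2"
          unfolding G_def by (intro AE_I2 D.norm_integral_le_const sq fB fun_upd_in_space_PiM[OF q _ z]) auto
      qed (rule Gm)
      fix y assume y: "y \<in> space ?J"
      have y': "y(q := z) \<in> space ?J" using fun_upd_in_space_PiM[OF q y z] .
      have i1: "integrable D (\<lambda>x. f (y(p := x)))" "integrable D (\<lambda>x. f (y(q := z, p := x)))"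
        using fx[OF y] fx[OF y'] fB[OF y] fB[OF y'] by (auto intro!: D.integrable_const_bound[of _ B])
      define g where "g x = f (y(p := x)) - f (y(q := z, p := x))" for x
      have gB: "\<bar>g x\<bar> \<le> 2 * B" if "x \<in> space D" for x
        using fB[OF y that] fB[OF y' that] unfolding g_def by linarith
      have gm: "g \<in> borel_measurable D" using fx[OF y] fx[OF y'] unfolding g_def by simp
      have "\<phi> y - \<phi> (y(q := z)) = (\<integral>x. g x \<partial>D)" unfolding \<phi>_def g_def using i1 by simp
      \<comment> \<open>Jensen: averaging over coordinate \<open>p\<close> does not increase the
        mean square increment in coordinate \<open>q\<close>.\<close>
      moreover have "(\<integral>x. g x \<partial>D)\<^sup>2 \<le> (\<integral>x. (g x)\<^sup>2 \<partial>D)"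
        using D.integral_square_deviation[OF gm gB, of 0] by simp
      ultimately show "(\<phi> y - \<phi> (y(q := z)))\<^sup>2 \<le> G y" by (simp add: G_def g_def)
      show "0 \<le> G y" unfolding G_def by simp
    qed
    then show "(\<integral>y. (\<phi> y - \<phi> (y(q := z)))\<^sup>2 \<partial>?J) \<le> (\<integral>y. (f y - f (y(q := z)))\<^sup>2 \<partial>?I)"
      using eq by simp
  qed
  finally show ?case unfolding m_def sum.insert[OF insert.hyps] by linarith
qed

end

section \<open>Changing one entry of the rectangular matrix\<close>

text \<open>Cauchy-Schwarz between a row of \<open>R\<close> and a column of \<open>R'\<close>.
  Cutting the sum at \<open>N\<close> inserts the projection on the upper block, which only shortens
  both vectors.\<close>

lemma inverse_partial_product:
  assumes d: "dissipative n \<eta> T" and d': "dissipative n \<eta> T'" and \<eta>: "\<eta> > 0"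
    and R: "inverse_pair n T R" and R': "inverse_pair n T' R'"
    and ab: "a < n" "b < n" and N: "N \<le> n"
  shows "cmod (\<Sum>k<N. R a k * R' k b) \<le> (1 / \<eta>)\<^sup>2"
proof -
  have sub: "{..<N} \<subseteq> {..<n}" using N by auto
  have "(\<Sum>k<N. (cmod (R a k))\<^sup>2) \<le> (\<Sum>k<n. (cmod (R a k))\<^sup>2)"
    by (rule sum_mono2) (use sub in auto)
  also have "\<dots> \<le> (1 / \<eta>)\<^sup>2" using inverse_row_norm[OF d \<eta> R ab(1)] by (simp add: power_divide)
  finally have 1: "(\<Sum>k<N. (cmod (R a k))\<^sup>2) \<le> (1 / \<eta>)\<^sup>2" .
  have "(\<Sum>k<N. (cmod (R' k b))\<^sup>2) \<le> (\<Sum>k<n. (cmod (R' k b))\<^sup>2)"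
    by (rule sum_mono2) (use sub in auto)
  also have "\<dots> \<le> (1 / \<eta>)\<^sup>2" using inverse_col_norm[OF d' \<eta> R' ab(2)] by (simp add: power_divide)
  finally have 2: "(\<Sum>k<N. (cmod (R' k b))\<^sup>2) \<le> (1 / \<eta>)\<^sup>2" .
  show ?thesis using cauchy_schwarz_bound[OF 1 2] \<eta> by (simp add: power2_eq_square)
qed

lemma norm_two_terms:
  fixes z a b x y :: complex
  assumes "cmod a \<le> A" "cmod b \<le> A" "cmod x \<le> X" "cmod y \<le> X"
  shows "cmod (z * (a * x) + cnj z * (b * y)) \<le> 2 * cmod z * A * X"
proof -
  have A: "A \<ge> 0" using assms(1) norm_ge_zero order_trans by blast
  have "cmod (z * (a * x) + cnj z * (b * y)) \<le> cmod z * (cmod a * cmod x) + cmod z * (cmod b * cmod y)"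
    by (rule order_trans[OF norm_triangle_ineq]) (simp add: norm_mult)
  also have "\<dots> \<le> cmod z * (A * X) + cmod z * (A * X)"
    using A assms by (intro add_mono mult_left_mono mult_mono) auto
  finally show ?thesis by (simp add: mult_ac)
qed

text \<open>\<open>T0\<close> stands for \<open>T\<close> with the noise removed from one position
  and its mirror image; \<open>J\<close> will be the shifted column index \<open>N + j\<close>.
  Bounds are kept explicit in \<open>\<xi>\<close>, because a noise entry is unbounded and only its
  moments are controlled.\<close>

locale entry_perturbation =
  fixes n :: nat and \<eta> :: real and T T0 R R0 :: "nat \<Rightarrow> nat \<Rightarrow> complex" and i J :: nat and \<xi> :: complex
  assumes dT: "dissipative n \<eta> T" and dT0: "dissipative n \<eta> T0" and \<eta>: "\<eta> > 0"
    and R: "inverse_pair n T R" and R0: "inverse_pair n T0 R0"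
    and ij: "i < n" "J < n" "i \<noteq> J"
    and diff: "\<And>c d. c < n \<Longrightarrow> d < n \<Longrightarrow>
      T c d - T0 c d = (if c = i \<and> d = J then \<xi> else 0) + (if c = J \<and> d = i then cnj \<xi> else 0)"
begin

definition "h = 1 / \<eta>"

lemma h_pos: "h > 0" using \<eta> by (simp add: h_def)

lemma two_entry_sum:
  "(\<Sum>c<n. \<Sum>d<n. f c * (T c d - T0 c d) * g d) = \<xi> * (f i * g J) + cnj \<xi> * (f J * g i)"
proof -
  have "(\<Sum>c<n. \<Sum>d<n. f c * (T c d - T0 c d) * g d) =
    (\<Sum>c<n. \<Sum>d<n. (if d = J then if c = i then f c * \<xi> * g d else 0 else 0) +
                     (if d = i then if c = J then f c * cnj \<xi> * g d else 0 else 0))"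
    by (intro sum.cong refl, subst diff) (use ij in auto)
  also have "\<dots> = \<xi> * (f i * g J) + cnj \<xi> * (f J * g i)"
    using ij by (simp add: sum.distrib)
  finally show ?thesis .
qed

lemma entry_diff:
  assumes "a < n" "b < n"
  shows "R a b - R0 a b = - (\<xi> * (R0 a i * R J b) + cnj \<xi> * (R0 a J * R i b))"
proof -
  have "(\<Sum>c<n. \<Sum>d<n. R0 a c * (T0 c d - T c d) * R d b) = - (\<Sum>c<n. \<Sum>d<n. R0 a c * (T c d - T0 c d) * R d b)"
    by (simp add: sum_negf[symmetric] algebra_simps)
  then show ?thesis using resolvent_identity[OF R0 R assms] unfolding two_entry_sum by simp
qed

lemma entry_le: "a < n \<Longrightarrow> b < n \<Longrightarrow> cmod (R a b) \<le> h" "a < n \<Longrightarrow> b < n \<Longrightarrow> cmod (R0 a b) \<le> h"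
  using inverse_entry_norm[OF dT \<eta> R] inverse_entry_norm[OF dT0 \<eta> R0] by (auto simp: h_def)

lemma entry_diff_le:
  assumes "a < n" "b < n"
  shows "cmod (R a b - R0 a b) \<le> 2 * cmod \<xi> * h * h"
  unfolding entry_diff[OF assms] norm_minus_cancel
  using assms ij by (intro norm_two_terms entry_le)

context
  fixes k :: "nat \<Rightarrow> complex" and K :: "nat set" and \<kappa> :: real and u u0 :: "nat \<Rightarrow> complex"
  assumes K: "K \<subseteq> {..<n}"
    and u: "\<And>a. u a = (\<Sum>c\<in>K. R a c * k c)" and u0: "\<And>a. u0 a = (\<Sum>c\<in>K. R0 a c * k c)"
    and u_le: "\<And>a. a < n \<Longrightarrow> cmod (u a) \<le> \<kappa>" "\<And>a. a < n \<Longrightarrow> cmod (u0 a) \<le> \<kappa>"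
begin

lemma image_diff:
  assumes a: "a < n"
  shows "u a - u0 a = - (\<xi> * (R0 a i * u J) + cnj \<xi> * (R0 a J * u i))"
proof -
  have "u a - u0 a = (\<Sum>c\<in>K. (R a c - R0 a c) * k c)"
    by (simp add: u u0 sum_subtractf algebra_simps)
  also have "\<dots> = (\<Sum>c\<in>K. - (\<xi> * (R0 a i * (R J c * k c)) + cnj \<xi> * (R0 a J * (R i c * k c))))"
    using K a by (intro sum.cong refl) (simp add: entry_diff subset_iff algebra_simps)
  also have "\<dots> = - (\<xi> * (R0 a i * u J) + cnj \<xi> * (R0 a J * u i))"
    by (simp add: u sum_negf sum_subtractf sum_distrib_left)
  finally show ?thesis .
qed

lemma image_diff_le: "a < n \<Longrightarrow> cmod (u a - u0 a) \<le> 2 * cmod \<xi> * h * \<kappa>"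
  unfolding image_diff norm_minus_cancel
  using ij by (intro norm_two_terms entry_le u_le) auto

text \<open>The exact identity \<open>image_diff\<close> with \<open>u\<close> replaced by
  \<open>u0\<close> on its right side. By \<open>image_diff_le\<close> the replacement costs a
  second factor \<open>2 * cmod \<xi> * h\<close>, whence the 4.\<close>

lemma image_expansion:
  assumes a: "a < n"
  shows "cmod (u a - (u0 a - \<xi> * (R0 a i * u0 J) - cnj \<xi> * (R0 a J * u0 i))) \<le> 4 * h\<^sup>2 * \<kappa> * (cmod \<xi>)\<^sup>2"
proof -
  have "u a - (u0 a - \<xi> * (R0 a i * u0 J) - cnj \<xi> * (R0 a J * u0 i)) =
     - (\<xi> * (R0 a i * (u J - u0 J)) + cnj \<xi> * (R0 a J * (u i - u0 i)))"
    using image_diff[OF a] by (simp add: algebra_simps)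
  also have "cmod \<dots> \<le> 2 * cmod \<xi> * h * (2 * cmod \<xi> * h * \<kappa>)"
    unfolding norm_minus_cancel using a ij by (intro norm_two_terms entry_le image_diff_le)
  finally show ?thesis by (simp add: power2_eq_square algebra_simps)
qed

lemma product_diff_le:
  assumes "a < n" "b < n" "c < n"
  shows "cmod (R a b * u c - R0 a b * u0 c) \<le> 4 * h\<^sup>2 * \<kappa> * cmod \<xi>"
proof -
  have "R a b * u c - R0 a b * u0 c = (R a b - R0 a b) * u c + R0 a b * (u c - u0 c)"
    by (simp add: algebra_simps)
  also have "cmod \<dots> \<le> (2 * cmod \<xi> * h * h) * \<kappa> + h * (2 * cmod \<xi> * h * \<kappa>)"
    by (rule order_trans[OF norm_triangle_ineq], unfold norm_mult, intro add_mono mult_mono)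
       (use assms h_pos in \<open>auto intro!: entry_diff_le u_le entry_le image_diff_le order_trans[OF norm_ge_zero u_le(1)]\<close>)
  finally show ?thesis by (simp add: power2_eq_square algebra_simps)
qed

end

context
  fixes N :: nat
  assumes N: "N \<le> n"
begin

lemma product_le: "a < n \<Longrightarrow> b < n \<Longrightarrow> cmod (\<Sum>k<N. R0 a k * R k b) \<le> h\<^sup>2"
  "a < n \<Longrightarrow> b < n \<Longrightarrow> cmod (\<Sum>k<N. R a k * R0 k b) \<le> h\<^sup>2"
  "a < n \<Longrightarrow> b < n \<Longrightarrow> cmod (\<Sum>k<N. R a k * R k b) \<le> h\<^sup>2"
  "a < n \<Longrightarrow> b < n \<Longrightarrow> cmod (\<Sum>k<N. R0 a k * R0 k b) \<le> h\<^sup>2"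
  using inverse_partial_product[OF dT0 dT \<eta> R0 R _ _ N] inverse_partial_product[OF dT dT0 \<eta> R R0 _ _ N]
    inverse_partial_product[OF dT dT \<eta> R R _ _ N] inverse_partial_product[OF dT0 dT0 \<eta> R0 R0 _ _ N]
  by (simp_all add: h_def)

text \<open>The first order coefficients are off-diagonal entries of \<open>R0\<close> times the
  projection on the upper block times \<open>R0\<close>. They are kept instead of being bounded by
  \<open>h\<^sup>2\<close>, since their squares, summed over all positions, are only of order
  \<open>N + L\<close> and not \<open>N * L\<close>.\<close>

lemma trace_diff_le:
  "cmod ((\<Sum>k<N. R k k) - (\<Sum>k<N. R0 k k)) \<le>
     cmod \<xi> * (cmod (\<Sum>k<N. R0 J k * R0 k i) + cmod (\<Sum>k<N. R0 i k * R0 k J)) + 4 * h ^ 3 * (cmod \<xi>)\<^sup>2"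
proof -
  have expand: "(\<Sum>k<N. R a k * R0 k b) - (\<Sum>k<N. R0 a k * R0 k b) =
      - (\<xi> * (R0 a i * (\<Sum>k<N. R J k * R0 k b)) + cnj \<xi> * (R0 a J * (\<Sum>k<N. R i k * R0 k b)))" if "a < n" for a b
  proof -
    have "(\<Sum>k<N. R a k * R0 k b) - (\<Sum>k<N. R0 a k * R0 k b) = (\<Sum>k<N. (R a k - R0 a k) * R0 k b)"
      by (simp add: sum_subtractf algebra_simps)
    also have "\<dots> = (\<Sum>k<N. - (\<xi> * (R0 a i * (R J k * R0 k b)) + cnj \<xi> * (R0 a J * (R i k * R0 k b))))"
      using N that by (intro sum.cong refl) (simp add: entry_diff algebra_simps)
    finally show ?thesis by (simp add: sum_negf sum_subtractf sum_distrib_left)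
  qed
  have le: "cmod ((\<Sum>k<N. R a k * R0 k b) - (\<Sum>k<N. R0 a k * R0 k b)) \<le> 2 * cmod \<xi> * h * h\<^sup>2" if "a < n" "b < n" for a b
    unfolding expand[OF that(1)] norm_minus_cancel using that ij
    by (intro norm_two_terms entry_le product_le)
  have "(\<Sum>k<N. R k k) - (\<Sum>k<N. R0 k k) = (\<Sum>k<N. R k k - R0 k k)" by (simp add: sum_subtractf)
  also have "\<dots> = (\<Sum>k<N. - (\<xi> * (R J k * R0 k i) + cnj \<xi> * (R i k * R0 k J)))"
    using N by (intro sum.cong refl) (simp add: entry_diff algebra_simps)
  also have "\<dots> = - (\<xi> * (\<Sum>k<N. R J k * R0 k i) + cnj \<xi> * (\<Sum>k<N. R i k * R0 k J))"
    by (simp add: sum_negf sum_subtractf sum_distrib_left)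
  \<comment> \<open>First order part plus correction; the factors 1 only give the correction the
    shape of \<open>norm_two_terms\<close>.\<close>
  also have "\<dots> = - (\<xi> * (1 * (\<Sum>k<N. R0 J k * R0 k i)) + cnj \<xi> * (1 * (\<Sum>k<N. R0 i k * R0 k J))) -
      (\<xi> * (1 * ((\<Sum>k<N. R J k * R0 k i) - (\<Sum>k<N. R0 J k * R0 k i))) +
       cnj \<xi> * (1 * ((\<Sum>k<N. R i k * R0 k J) - (\<Sum>k<N. R0 i k * R0 k J))))"
    by (simp only: mult_1_left right_diff_distrib) simp
  finally have eq: "(\<Sum>k<N. R k k) - (\<Sum>k<N. R0 k k) =
      - (\<xi> * (1 * (\<Sum>k<N. R0 J k * R0 k i)) + cnj \<xi> * (1 * (\<Sum>k<N. R0 i k * R0 k J))) -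
      (\<xi> * (1 * ((\<Sum>k<N. R J k * R0 k i) - (\<Sum>k<N. R0 J k * R0 k i))) +
       cnj \<xi> * (1 * ((\<Sum>k<N. R i k * R0 k J) - (\<Sum>k<N. R0 i k * R0 k J))))" (is "?d = - ?p - ?q") .
  have p: "cmod ?p \<le> cmod \<xi> * (cmod (\<Sum>k<N. R0 J k * R0 k i) + cmod (\<Sum>k<N. R0 i k * R0 k J))"
    by (rule order_trans[OF norm_triangle_ineq]) (simp add: norm_mult distrib_left)
  have q: "cmod ?q \<le> 2 * cmod \<xi> * 1 * (2 * cmod \<xi> * h * h\<^sup>2)"
    by (intro norm_two_terms le) (use ij in auto)
  have "cmod ?d \<le> cmod ?p + cmod ?q"
    unfolding eq using norm_triangle_ineq4[of "- ?p" ?q] by (simp only: norm_minus_cancel)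
  also have "\<dots> \<le> cmod \<xi> * (cmod (\<Sum>k<N. R0 J k * R0 k i) + cmod (\<Sum>k<N. R0 i k * R0 k J)) +
      2 * cmod \<xi> * 1 * (2 * cmod \<xi> * h * h\<^sup>2)"
    using p q by (rule add_mono)
  finally show ?thesis by (simp add: power2_eq_square power3_eq_cube mult_ac)
qed

text \<open>Moves the first order coefficient from the matrix without the entry back to the actual
  one, so that the coefficients of all positions can be summed at one common point. The mixed
  product of \<open>R0\<close> and \<open>R\<close> is the intermediate term.\<close>

lemma product_entry_diff_le:
  assumes "a < n" "b < n"
  shows "cmod ((\<Sum>k<N. R0 a k * R0 k b) - (\<Sum>k<N. R a k * R k b)) \<le> 4 * h ^ 3 * cmod \<xi>"
proof -
  have 1: "(\<Sum>k<N. R a k * R k b) - (\<Sum>k<N. R0 a k * R k b) =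
      - (\<xi> * (R0 a i * (\<Sum>k<N. R J k * R k b)) + cnj \<xi> * (R0 a J * (\<Sum>k<N. R i k * R k b)))"
  proof -
    have "(\<Sum>k<N. R a k * R k b) - (\<Sum>k<N. R0 a k * R k b) = (\<Sum>k<N. (R a k - R0 a k) * R k b)"
      by (simp add: sum_subtractf algebra_simps)
    also have "\<dots> = (\<Sum>k<N. - (\<xi> * (R0 a i * (R J k * R k b)) + cnj \<xi> * (R0 a J * (R i k * R k b))))"
      using N assms by (intro sum.cong refl) (simp add: entry_diff algebra_simps)
    finally show ?thesis by (simp add: sum_negf sum_subtractf sum_distrib_left)
  qed
  have 2: "(\<Sum>k<N. R0 a k * R k b) - (\<Sum>k<N. R0 a k * R0 k b) =
      - (\<xi> * ((\<Sum>k<N. R0 a k * R0 k i) * R J b) + cnj \<xi> * ((\<Sum>k<N. R0 a k * R0 k J) * R i b))"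
  proof -
    have "(\<Sum>k<N. R0 a k * R k b) - (\<Sum>k<N. R0 a k * R0 k b) = (\<Sum>k<N. R0 a k * (R k b - R0 k b))"
      by (simp add: sum_subtractf algebra_simps)
    also have "\<dots> = (\<Sum>k<N. - (\<xi> * ((R0 a k * R0 k i) * R J b) + cnj \<xi> * ((R0 a k * R0 k J) * R i b)))"
      using N assms by (intro sum.cong refl) (simp add: entry_diff algebra_simps)
    finally show ?thesis by (simp add: sum_negf sum_subtractf sum_distrib_left sum_distrib_right)
  qed
  have "cmod ((\<Sum>k<N. R a k * R k b) - (\<Sum>k<N. R0 a k * R k b)) \<le> 2 * cmod \<xi> * h * h\<^sup>2"
    unfolding 1 norm_minus_cancel using assms ij by (intro norm_two_terms entry_le product_le)
  moreover have "cmod ((\<Sum>k<N. R0 a k * R k b) - (\<Sum>k<N. R0 a k * R0 k b)) \<le> 2 * cmod \<xi> * h\<^sup>2 * h"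
    unfolding 2 norm_minus_cancel using assms ij by (intro norm_two_terms entry_le product_le)
  moreover have "cmod ((\<Sum>k<N. R0 a k * R0 k b) - (\<Sum>k<N. R a k * R k b)) \<le>
     cmod ((\<Sum>k<N. R a k * R k b) - (\<Sum>k<N. R0 a k * R k b)) +
     cmod ((\<Sum>k<N. R0 a k * R k b) - (\<Sum>k<N. R0 a k * R0 k b))"
    using norm_triangle_ineq[of "(\<Sum>k<N. R a k * R k b) - (\<Sum>k<N. R0 a k * R k b)"
        "(\<Sum>k<N. R0 a k * R k b) - (\<Sum>k<N. R0 a k * R0 k b)"]
      norm_minus_commute[of "\<Sum>k<N. R0 a k * R0 k b" "\<Sum>k<N. R a k * R k b"] by simp
  ultimately show ?thesis by (simp add: power2_eq_square power3_eq_cube algebra_simps)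
qed

end

end

section \<open>Measurability of the inverse\<close>

lemma borel_measurable_cnj[measurable (raw)]:
  "f \<in> borel_measurable M \<Longrightarrow> (\<lambda>y. cnj (f y)) \<in> borel_measurable M"
  by (rule borel_measurable_continuous_on[of cnj]) (auto intro: continuous_intros)

lemma measurable_det:
  fixes A :: "'w \<Rightarrow> complex mat"
  assumes "\<And>y. A y \<in> carrier_mat n n"
    and "\<And>i j. i < n \<Longrightarrow> j < n \<Longrightarrow> (\<lambda>y. A y $$ (i,j)) \<in> borel_measurable M"
  shows "(\<lambda>y. det (A y)) \<in> borel_measurable M"
proof -
  have "det (A y) = (\<Sum>p | p permutes {0..<n}. signof p * (\<Prod>i = 0..<n. A y $$ (i, p i)))" for y
    using det_def'[OF assms(1)] by simp
  moreover have "(\<lambda>y. \<Sum>p | p permutes {0..<n}. signof p * (\<Prod>i = 0..<n. A y $$ (i, p i))) \<in> borel_measurable M"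
  proof (intro borel_measurable_sum borel_measurable_times borel_measurable_prod borel_measurable_const)
    fix p i assume p: "p \<in> {p. p permutes {0..<n}}" and i: "i \<in> {0..<n}"
    then have "p i < n" using permutes_in_image[of p "{0..<n}" i] by auto
    then show "(\<lambda>y. A y $$ (i, p i)) \<in> borel_measurable M" using assms(2) i by auto
  qed
  ultimately show ?thesis by simp
qed

lemma measurable_minv:
  fixes T :: "'w \<Rightarrow> nat \<Rightarrow> nat \<Rightarrow> complex"
  assumes "\<And>i j. i < n \<Longrightarrow> j < n \<Longrightarrow> (\<lambda>y. T y i j) \<in> borel_measurable M"
    and ab: "a < n" "b < n"
  shows "(\<lambda>y. minv n (T y) a b) \<in> borel_measurable M"
  unfolding minv_def cofactor_def
proof (intro borel_measurable_divide borel_measurable_times borel_measurable_const)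
  show "(\<lambda>y. det (mat n n (\<lambda>(i, j). T y i j))) \<in> borel_measurable M"
    by (rule measurable_det[of _ n]) (use assms in auto)
  show "(\<lambda>y. det (mat_delete (mat n n (\<lambda>(i, j). T y i j)) b a)) \<in> borel_measurable M"
  proof (rule measurable_det[of _ "n - 1"])
    show "mat_delete (mat n n (\<lambda>(i, j). T y i j)) b a \<in> carrier_mat (n - 1) (n - 1)" for y
      by (rule mat_delete_carrier) simp
    fix i j assume "i < n - 1" "j < n - 1"
    then show "(\<lambda>y. mat_delete (mat n n (\<lambda>(i, j). T y i j)) b a $$ (i, j)) \<in> borel_measurable M"
      using assms by (auto simp: mat_delete_def)
  qed
qed

lemma measurable_minv_bmat:
  fixes X :: "'w \<Rightarrow> nat \<Rightarrow> nat \<Rightarrow> complex"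
  assumes X: "\<And>i j. i < N \<Longrightarrow> j < L \<Longrightarrow> (\<lambda>y. X y i j) \<in> borel_measurable M"
    and ab: "a < N + L" "b < N + L"
  shows "(\<lambda>y. minv (N + L) (bmat N p q (X y)) a b) \<in> borel_measurable M"
proof (rule measurable_minv[OF _ ab])
  fix i j assume ij: "i < N + L" "j < N + L"

  have "(\<lambda>y. hermz N (X y) i j) \<in> borel_measurable M"
    using ij X[of i "j - N"] X[of j "i - N"] unfolding hermz_def
    by (cases "i < N"; cases "j < N") (auto intro!: borel_measurable_cnj)
  then show "(\<lambda>y. bmat N p q (X y) i j) \<in> borel_measurable M"
    unfolding bmat_def by simp
qed

section \<open>The entry law\<close>

lemma square_sum_le: "(a + b)\<^sup>2 \<le> 2 * a\<^sup>2 + 2 * b\<^sup>2" for a b :: real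
  using sum_squares_bound[of a b] by (simp add: power2_sum)

locale entry_law = prob_space D for D :: "complex measure" +
  fixes C3 C4 :: real
  assumes sets_D[measurable_cong]: "sets D = sets borel"
    and integrable_id: "integrable D (\<lambda>x. x)"
    and mean_zero: "(\<integral>x. x \<partial>D) = 0"
    and integrable_powers: "\<And>k. integrable D (\<lambda>x. cmod x ^ k)"
    and second_moment: "(\<integral>x. (cmod x)\<^sup>2 \<partial>D) = 1"
    and third_moment: "(\<integral>x. cmod x ^ 3 \<partial>D) \<le> C3"
    and fourth_moment: "(\<integral>x. cmod x ^ 4 \<partial>D) \<le> C4"
begin

lemma space_D[simp]: "space D = UNIV"
  using sets_eq_imp_space_eq[OF sets_D] by simp

lemma prob_UNIV[simp]: "measure D UNIV = 1"
  using prob_space by simp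

lemma C3_nonneg: "C3 \<ge> 0"
  by (rule order_trans[OF _ third_moment]) simp

lemma C4_nonneg: "C4 \<ge> 0"
  by (rule order_trans[OF _ fourth_moment]) simp

lemma integrable_norm_id: "integrable D cmod"
  using integrable_powers[of 1] by simp

lemma first_moment_le: "(\<integral>x. cmod x \<partial>D) \<le> 1"
proof -
  have "(\<integral>x. cmod x \<partial>D) \<le> (\<integral>x. (1 + (cmod x)\<^sup>2) / 2 \<partial>D)"
  proof (rule integral_mono)
    fix x :: complex
    have "0 \<le> (cmod x - 1)\<^sup>2" by simp
    then show "cmod x \<le> (1 + (cmod x)\<^sup>2) / 2" by (simp add: power2_eq_square algebra_simps)
  qed (use integrable_norm_id integrable_powers[of 2] in auto)
  also have "\<dots> = 1" using integrable_powers[of 2] by (simp add: second_moment prob_space)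
  finally show ?thesis .
qed

lemma integrable_square: "integrable D (\<lambda>x. x * x)"
  by (rule Bochner_Integration.integrable_bound[OF integrable_powers[of 2]])
     (auto simp: norm_mult power2_eq_square)

text \<open>This is 1 for real entries and 0 for circularly symmetric complex ones. No value is
  assumed, so both cases are covered; its contribution is shown to be negligible through
  \<open>Q12_le\<close>.\<close>

definition "pseudo_variance = (\<integral>x. x * x \<partial>D)"

lemma pseudo_variance_le: "cmod pseudo_variance \<le> 1"
proof -
  have "cmod pseudo_variance \<le> (\<integral>x. cmod (x * x) \<partial>D)"
    unfolding pseudo_variance_def by (rule integral_norm_bound)
  also have "\<dots> = 1" using second_moment by (simp add: norm_mult power2_eq_square)
  finally show ?thesis .
qed

text \<open>Here \<open>d\<close> is the change of the trace, \<open>a0\<close> its first order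
  coefficient without the entry and \<open>a x\<close> the coefficient with it. Two uses of
  \<open>square_sum_le\<close>, one for \<open>d\<close> and one for \<open>a0\<close>, give the
  factor \<open>4 = 2 * 2\<close>; unit variance removes the entry, and the rest is of fourth order
  in \<open>\<sigma>\<close>.\<close>

lemma square_increment_le:
  fixes d a :: "complex \<Rightarrow> real"
  assumes dm[measurable]: "d \<in> borel_measurable D" and am[measurable]: "a \<in> borel_measurable D"
    and aB: "\<And>x. \<bar>a x\<bar> \<le> B" and c: "c \<ge> 0" "c' \<ge> 0" "\<sigma> \<ge> 0" "a0 \<ge> 0"
    and d: "\<And>x. 0 \<le> d x" "\<And>x. d x \<le> \<sigma> * cmod x * a0 + c * (\<sigma> * cmod x)\<^sup>2"
    and a: "\<And>x. a0 \<le> a x + c' * (\<sigma> * cmod x)"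
  shows "(\<integral>x. (d x)\<^sup>2 - 4 * \<sigma>\<^sup>2 * (a x)\<^sup>2 \<partial>D) \<le> (4 * c'\<^sup>2 + 2 * c\<^sup>2 * C4) * \<sigma> ^ 4"
proof -
  have ia2: "integrable D (\<lambda>x. (a x)\<^sup>2)"
  proof (rule integrable_const_bound[of _ "B\<^sup>2"])
    have "(a x)\<^sup>2 \<le> B\<^sup>2" for x using aB[of x] by (metis abs_ge_zero power2_abs power_mono)
    then show "AE x in D. norm ((a x)\<^sup>2) \<le> B\<^sup>2" by simp
  qed simp
  have d2: "(d x)\<^sup>2 \<le> 2 * \<sigma>\<^sup>2 * a0\<^sup>2 * (cmod x)\<^sup>2 + 2 * c\<^sup>2 * \<sigma> ^ 4 * cmod x ^ 4" for x
  proof -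
    have "(d x)\<^sup>2 \<le> (\<sigma> * cmod x * a0 + c * (\<sigma> * cmod x)\<^sup>2)\<^sup>2"
      using d by (intro power_mono) auto
    also have "\<dots> \<le> 2 * (\<sigma> * cmod x * a0)\<^sup>2 + 2 * (c * (\<sigma> * cmod x)\<^sup>2)\<^sup>2" by (rule square_sum_le)
    finally show ?thesis by (simp add: power_mult_distrib mult_ac flip: power_mult)
  qed
  have a02: "a0\<^sup>2 \<le> 2 * (a x)\<^sup>2 + 2 * c'\<^sup>2 * \<sigma>\<^sup>2 * (cmod x)\<^sup>2" for x
  proof -
    have "a0\<^sup>2 \<le> (a x + c' * (\<sigma> * cmod x))\<^sup>2" using a[of x] c by (intro power_mono) auto
    also have "\<dots> \<le> 2 * (a x)\<^sup>2 + 2 * (c' * (\<sigma> * cmod x))\<^sup>2" by (rule square_sum_le)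
    finally show ?thesis by (simp add: power_mult_distrib mult_ac)
  qed
  have "a0\<^sup>2 = (\<integral>x. a0\<^sup>2 \<partial>D)" by (simp add: prob_space)
  also have "\<dots> \<le> (\<integral>x. 2 * (a x)\<^sup>2 + 2 * c'\<^sup>2 * \<sigma>\<^sup>2 * (cmod x)\<^sup>2 \<partial>D)"
    using a02 ia2 integrable_powers[of 2] by (intro integral_mono) auto
  also have "\<dots> = 2 * (\<integral>x. (a x)\<^sup>2 \<partial>D) + 2 * c'\<^sup>2 * \<sigma>\<^sup>2"
    using ia2 integrable_powers[of 2] by (simp add: second_moment)
  finally have A: "a0\<^sup>2 \<le> 2 * (\<integral>x. (a x)\<^sup>2 \<partial>D) + 2 * c'\<^sup>2 * \<sigma>\<^sup>2" .
  have im: "integrable D (\<lambda>x. 2 * \<sigma>\<^sup>2 * a0\<^sup>2 * (cmod x)\<^sup>2 + 2 * c\<^sup>2 * \<sigma> ^ 4 * cmod x ^ 4)"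
    using integrable_powers[of 2] integrable_powers[of 4] by simp
  have id2: "integrable D (\<lambda>x. (d x)\<^sup>2)"
    by (rule Bochner_Integration.integrable_bound[OF im])
       (use d2 in \<open>auto intro!: AE_I2 order_trans[OF d2] abs_ge_self\<close>)

  have 1: "(\<integral>x. (d x)\<^sup>2 - 4 * \<sigma>\<^sup>2 * (a x)\<^sup>2 \<partial>D) = (\<integral>x. (d x)\<^sup>2 \<partial>D) - 4 * \<sigma>\<^sup>2 * (\<integral>x. (a x)\<^sup>2 \<partial>D)"
    using id2 ia2 by simp
  have "(\<integral>x. (d x)\<^sup>2 \<partial>D) \<le> (\<integral>x. 2 * \<sigma>\<^sup>2 * a0\<^sup>2 * (cmod x)\<^sup>2 + 2 * c\<^sup>2 * \<sigma> ^ 4 * cmod x ^ 4 \<partial>D)"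
    using d2 id2 im by (intro integral_mono) auto
  also have "\<dots> = 2 * \<sigma>\<^sup>2 * a0\<^sup>2 + 2 * c\<^sup>2 * \<sigma> ^ 4 * (\<integral>x. cmod x ^ 4 \<partial>D)"
    using integrable_powers[of 2] integrable_powers[of 4] by (simp add: second_moment)
  also have "\<dots> \<le> 2 * \<sigma>\<^sup>2 * (2 * (\<integral>x. (a x)\<^sup>2 \<partial>D) + 2 * c'\<^sup>2 * \<sigma>\<^sup>2) + 2 * c\<^sup>2 * \<sigma> ^ 4 * C4"
    using A fourth_moment c by (intro add_mono mult_left_mono) auto
  finally have 2: "(\<integral>x. (d x)\<^sup>2 \<partial>D) \<le> 2 * \<sigma>\<^sup>2 * (2 * (\<integral>x. (a x)\<^sup>2 \<partial>D) + 2 * c'\<^sup>2 * \<sigma>\<^sup>2) + 2 * c\<^sup>2 * \<sigma> ^ 4 * C4" .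
  have "2 * \<sigma>\<^sup>2 * (2 * t + 2 * c'\<^sup>2 * \<sigma>\<^sup>2) + 2 * c\<^sup>2 * \<sigma> ^ 4 * C4 - 4 * \<sigma>\<^sup>2 * t = (4 * c'\<^sup>2 + 2 * c\<^sup>2 * C4) * \<sigma> ^ 4" for t
    by (simp add: algebra_simps power4_eq_xxxx power2_eq_square)
  from this[of "\<integral>x. (a x)\<^sup>2 \<partial>D"] show ?thesis using 1 2 by linarith
qed

text \<open>Substitute for Gaussian integration by parts: the mean of \<open>x * g x\<close> is
  matched by the means of its first order coefficients, weighted with \<open>pseudo_variance\<close>
  and the unit variance. The error is quadratic in \<open>\<sigma>\<close>, where Taylor's remainder
  contributes \<open>C3\<close> and the replacement of \<open>A0\<close>, \<open>B0\<close> by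
  \<open>A x\<close>, \<open>B x\<close> contributes 2.\<close>

lemma first_order_mean:
  fixes g A B :: "complex \<Rightarrow> complex"
  assumes m[measurable]: "g \<in> borel_measurable D" "A \<in> borel_measurable D" "B \<in> borel_measurable D"
    and \<sigma>: "\<sigma> \<ge> 0" and c: "c \<ge> 0"
    and g: "\<And>x. cmod (g x - (g0 - \<sigma> * x * A0 - cnj (\<sigma> * x) * B0)) \<le> c * (\<sigma> * cmod x)\<^sup>2"
    and A: "\<And>x. cmod (A x - A0) \<le> c * (\<sigma> * cmod x)"
    and B: "\<And>x. cmod (B x - B0) \<le> c * (\<sigma> * cmod x)"
  shows "cmod (\<integral>x. x * g x + \<sigma> * pseudo_variance * A x + \<sigma> * B x \<partial>D) \<le> c * \<sigma>\<^sup>2 * (C3 + 2)"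
proof -
  \<comment> \<open>The terms of mean exactly zero: by centring, by definition of
    \<open>pseudo_variance\<close> and by unit variance.\<close>
  define main where "main x = x * g0 - \<sigma> * A0 * (x * x - pseudo_variance) -
    \<sigma> * B0 * (complex_of_real ((cmod x)\<^sup>2) - 1)" for x :: complex
  define rem where "rem x = x * (g x - (g0 - \<sigma> * x * A0 - cnj (\<sigma> * x) * B0)) +
    \<sigma> * pseudo_variance * (A x - A0) + \<sigma> * (B x - B0)" for x :: complex
  have eq: "x * g x + \<sigma> * pseudo_variance * A x + \<sigma> * B x = main x + rem x" for x
    unfolding main_def rem_def complex_norm_square by (simp add: algebra_simps)
  have i2: "integrable D (\<lambda>x. complex_of_real ((cmod x)\<^sup>2))"
    using integrable_powers[of 2] by (intro integrable_of_real) simp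
  have im: "integrable D main"
    unfolding main_def using integrable_id integrable_square i2 by simp
  have main0: "(\<integral>x. main x \<partial>D) = 0"
    unfolding main_def using integrable_id integrable_square i2 mean_zero second_moment
    by (simp add: prob_space pseudo_variance_def[symmetric] integral_complex_of_real del: of_real_power)
  have rem_le: "cmod (rem x) \<le> c * \<sigma>\<^sup>2 * cmod x ^ 3 + 2 * c * \<sigma>\<^sup>2 * cmod x" for x
  proof -
    have "cmod (rem x) \<le> cmod x * cmod (g x - (g0 - \<sigma> * x * A0 - cnj (\<sigma> * x) * B0)) +
        \<sigma> * cmod pseudo_variance * cmod (A x - A0) + \<sigma> * cmod (B x - B0)"
      unfolding rem_def using \<sigma>
      by (intro order_trans[OF norm_triangle_ineq] add_mono) (auto simp: norm_mult)
    also have "\<dots> \<le> cmod x * (c * (\<sigma> * cmod x)\<^sup>2) + \<sigma> * 1 * (c * (\<sigma> * cmod x)) + \<sigma> * (c * (\<sigma> * cmod x))"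
      using \<sigma> c by (intro add_mono mult_mono mult_left_mono g A B pseudo_variance_le) auto
    finally show ?thesis by (simp add: power2_eq_square power3_eq_cube algebra_simps)
  qed
  have ib: "integrable D (\<lambda>x. c * \<sigma>\<^sup>2 * cmod x ^ 3 + 2 * c * \<sigma>\<^sup>2 * cmod x)"
    using integrable_powers[of 3] integrable_norm_id by simp
  have remm: "rem \<in> borel_measurable D" unfolding rem_def by measurable
  have ir: "integrable D rem"
    by (rule Bochner_Integration.integrable_bound[OF ib remm])
       (use rem_le in \<open>auto intro!: AE_I2 order_trans[OF rem_le] abs_ge_self\<close>)
  have "(\<integral>x. x * g x + \<sigma> * pseudo_variance * A x + \<sigma> * B x \<partial>D) = (\<integral>x. rem x \<partial>D)"
    unfolding eq using im ir main0 by simp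
  then have "cmod (\<integral>x. x * g x + \<sigma> * pseudo_variance * A x + \<sigma> * B x \<partial>D) \<le> (\<integral>x. cmod (rem x) \<partial>D)"
    using integral_norm_bound[of D rem] by simp
  also have "\<dots> \<le> (\<integral>x. c * \<sigma>\<^sup>2 * cmod x ^ 3 + 2 * c * \<sigma>\<^sup>2 * cmod x \<partial>D)"
    using rem_le ir ib by (intro integral_mono) auto
  also have "\<dots> = c * \<sigma>\<^sup>2 * (\<integral>x. cmod x ^ 3 \<partial>D) + 2 * c * \<sigma>\<^sup>2 * (\<integral>x. cmod x \<partial>D)"
    using integrable_powers[of 3] integrable_norm_id by simp
  also have "\<dots> \<le> c * \<sigma>\<^sup>2 * C3 + 2 * c * \<sigma>\<^sup>2 * 1"
    using third_moment first_moment_le c by (intro add_mono mult_left_mono) auto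
  finally show ?thesis by (simp add: algebra_simps)
qed

text \<open>Conjugation turns the coefficient of \<open>x\<close> into that of its conjugate, so
  \<open>A\<close> and \<open>B\<close> exchange their roles.\<close>

lemma first_order_mean_cnj:
  fixes g A B :: "complex \<Rightarrow> complex"
  assumes m[measurable]: "g \<in> borel_measurable D" "A \<in> borel_measurable D" "B \<in> borel_measurable D"
    and \<sigma>: "\<sigma> \<ge> 0" and c: "c \<ge> 0"
    and g: "\<And>x. cmod (g x - (g0 - \<sigma> * x * A0 - cnj (\<sigma> * x) * B0)) \<le> c * (\<sigma> * cmod x)\<^sup>2"
    and A: "\<And>x. cmod (A x - A0) \<le> c * (\<sigma> * cmod x)"
    and B: "\<And>x. cmod (B x - B0) \<le> c * (\<sigma> * cmod x)"
  shows "cmod (\<integral>x. cnj x * g x + \<sigma> * cnj pseudo_variance * B x + \<sigma> * A x \<partial>D) \<le> c * \<sigma>\<^sup>2 * (C3 + 2)"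
proof -
  note cn = borel_measurable_cnj[of _ D]
  have "cmod (\<integral>x. x * cnj (g x) + \<sigma> * pseudo_variance * cnj (B x) + \<sigma> * cnj (A x) \<partial>D) \<le> c * \<sigma>\<^sup>2 * (C3 + 2)"
  proof (rule first_order_mean[OF cn[OF m(1)] cn[OF m(3)] cn[OF m(2)] \<sigma> c, where ?g0.0 = "cnj g0" and ?A0.0 = "cnj B0" and ?B0.0 = "cnj A0"])
    fix x :: complex
    have "cnj (g x) - (cnj g0 - \<sigma> * x * cnj B0 - cnj (\<sigma> * x) * cnj A0) =
      cnj (g x - (g0 - \<sigma> * x * A0 - cnj (\<sigma> * x) * B0))" by simp
    then show "cmod (cnj (g x) - (cnj g0 - \<sigma> * x * cnj B0 - cnj (\<sigma> * x) * cnj A0)) \<le> c * (\<sigma> * cmod x)\<^sup>2"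
      using g[of x] by (simp only: complex_mod_cnj)
    show "cmod (cnj (B x) - cnj B0) \<le> c * (\<sigma> * cmod x)" "cmod (cnj (A x) - cnj A0) \<le> c * (\<sigma> * cmod x)"
      using A[of x] B[of x] by (simp_all only: complex_mod_cnj flip: complex_cnj_diff)
  qed
  moreover have "(\<integral>x. x * cnj (g x) + \<sigma> * pseudo_variance * cnj (B x) + \<sigma> * cnj (A x) \<partial>D) =
      (\<integral>x. cnj (cnj x * g x + \<sigma> * cnj pseudo_variance * B x + \<sigma> * A x) \<partial>D)" by simp
  moreover have "\<dots> = cnj (\<integral>x. cnj x * g x + \<sigma> * cnj pseudo_variance * B x + \<sigma> * A x \<partial>D)"
    by (rule Bochner_Integration.integral_cnj)
  ultimately show ?thesis by (simp only: complex_mod_cnj)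
qed

end

section \<open>The resolvent of a deterministic matrix plus noise\<close>

locale info_plus_noise = entry_law D C3 C4 for D C3 C4 +
  fixes N L :: nat and a :: "nat \<Rightarrow> nat \<Rightarrow> complex" and \<sigma> :: real and w :: complex
  assumes \<sigma>: "\<sigma> \<ge> 0" and w: "Im w > 0"
begin

abbreviation "I \<equiv> {..<N} \<times> {..<L}"
abbreviation "P \<equiv> PiM I (\<lambda>_. D)"

definition "h = 1 / Im w"
definition "X y i j = a i j + complex_of_real \<sigma> * y (i, j)"
definition "R y = minv (N + L) (bmat N w w (X y))"
text \<open>
  The traces of the two diagonal blocks of the resolvent \<open>R\<close>, which differ by a deterministic amount
  (\<open>trace_relation\<close>).
\<close>

definition "t y = (\<Sum>i<N. R y i i)"
definition "r y = (\<Sum>j<L. R y (N + j) (N + j))"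

sublocale P: prob_space P by (rule prob_space_PiM_const) (rule prob_space_axioms)

lemma h: "h > 0" using w by (simp add: h_def)

lemma dissipative_T: "dissipative (N + L) (Im w) (bmat N w w Y)"
  by (rule dissipative_bmat) auto

lemma inverse_R: "inverse_pair (N + L) (bmat N w w (X y)) (R y)"
  unfolding R_def by (rule dissipative_inverse_pair[OF dissipative_T w])

lemma R_le: "b < N + L \<Longrightarrow> c < N + L \<Longrightarrow> cmod (R y b c) \<le> h"
  using inverse_entry_norm[OF dissipative_T w inverse_R] by (simp add: h_def)

lemma R_measurable[measurable]:
  assumes "b < N + L" "c < N + L"
  shows "(\<lambda>y. R y b c) \<in> borel_measurable P"
  unfolding R_def
proof (rule measurable_minv_bmat[OF _ assms])
  fix i j assume "i < N" "j < L"
  then have "(\<lambda>y. y (i, j)) \<in> measurable P D" by (intro measurable_component_singleton) auto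
  then have "(\<lambda>y. y (i, j)) \<in> borel_measurable P" by (simp add: measurable_cong_sets[OF refl sets_D])
  then show "(\<lambda>y. X y i j) \<in> borel_measurable P" unfolding X_def by simp
qed

lemma t_measurable[measurable]: "t \<in> borel_measurable P"
  unfolding t_def by (intro borel_measurable_sum R_measurable) auto

lemma r_measurable[measurable]: "r \<in> borel_measurable P"
  unfolding r_def by (intro borel_measurable_sum R_measurable) auto

lemma t_le: "cmod (t y) \<le> real N * h"
  unfolding t_def using R_le by (intro sum_norm_bound[of "{..<N}" _ h, simplified]) auto

lemma r_le: "cmod (r y) \<le> real L * h"
  unfolding r_def using R_le by (intro sum_norm_bound[of "{..<L}" _ h, simplified]) auto

lemma integrable_t: "integrable P t"
  by (rule P.integrable_const_bound[of _ "real N * h"]) (auto simp: t_le)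

lemma integrable_r: "integrable P r"
  by (rule P.integrable_const_bound[of _ "real L * h"]) (auto simp: r_le)

definition "Et = (\<integral>y. t y \<partial>P)"
definition "Er = (\<integral>y. r y \<partial>P)"

lemma trace_relation: "of_nat N + w * t y = of_nat L + w * r y"
  using bmat_block_traces[OF inverse_R[of y]] by (simp add: t_def r_def)

text \<open>One variance bound therefore controls the fluctuations of both block traces.\<close>

lemma deviation_eq: "r y - Er = t y - Et"
proof -
  have w0: "w \<noteq> 0" using w by auto
  have r: "r y = t y + (of_nat N - of_nat L) / w" for y
    using trace_relation[of y] w0 by (simp add: field_simps)
  have "Er = (\<integral>y. t y + (of_nat N - of_nat L) / w \<partial>P)"
    unfolding Er_def by (intro Bochner_Integration.integral_cong refl r)
  also have "\<dots> = Et + (of_nat N - of_nat L) / w"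
    using integrable_t by (simp add: Et_def P.prob_space)
  finally show ?thesis using r[of y] by simp
qed

lemma mean_relation: "of_nat N + w * Et = of_nat L + w * Er"
proof -
  \<comment> \<open>The relation holds at every point, so an arbitrary one, here
    \<open>undefined\<close>, transfers it to the means.\<close>
  have "r undefined = t undefined - Et + Er" using deviation_eq[of undefined] by (simp add: algebra_simps)
  with trace_relation[of undefined] show ?thesis by (simp add: algebra_simps)
qed

text \<open>Adding nonnegative multiples of these means to \<open>w\<close> does not lower the
  imaginary part, so the matrix that defines \<open>E\<close> stays dissipative with the constant
  \<open>Im w\<close>.\<close>

lemma Et_Im: "Im Et \<ge> 0" and Er_Im: "Im Er \<ge> 0"
proof -
  have d: "Im (R y b b) \<ge> 0" if "b < N + L" for y b
    using inverse_diag_Im_nonneg[OF dissipative_T w inverse_R that] .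
  have "Im Et = (\<integral>y. Im (t y) \<partial>P)" unfolding Et_def using integrable_t by simp
  then show "Im Et \<ge> 0" using d by (auto simp: t_def intro!: integral_nonneg_AE sum_nonneg)
  have "Im Er = (\<integral>y. Im (r y) \<partial>P)" unfolding Er_def using integrable_r by simp
  then show "Im Er \<ge> 0" using d by (auto simp: r_def intro!: integral_nonneg_AE sum_nonneg)
qed

lemma Et_le: "cmod Et \<le> real N * h"
  unfolding Et_def by (rule P.norm_integral_le_const) (use t_le h in auto)

lemma entry_perturbation_noise:
  fixes x :: complex
  assumes "i < N" "j < L"
  shows "entry_perturbation (N + L) (Im w) (bmat N w w (X (y((i,j) := x)))) (bmat N w w (X (y((i,j) := 0))))
     (R (y((i,j) := x))) (R (y((i,j) := 0))) i (N + j) (\<sigma> * x)"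
proof
  fix c d assume "c < N + L" "d < N + L"
  show "bmat N w w (X (y((i,j) := x))) c d - bmat N w w (X (y((i,j) := 0))) c d =
    (if c = i \<and> d = N + j then \<sigma> * x else 0) + (if c = N + j \<and> d = i then cnj (\<sigma> * x) else 0)"
    using assms by (auto simp: bmat_def hermz_def X_def)
qed (use assms w dissipative_T inverse_R in auto)



subsection \<open>Concentration of the trace\<close>

text \<open>Up to sign, \<open>Q y b c\<close> is the derivative of \<open>t\<close> in the entry
  \<open>(c, b)\<close> of the inverted block matrix; \<open>q\<close> collects the two entries that
  one noise variable moves.\<close>

definition "Q y b c = (\<Sum>k<N. R y b k * R y k c)"
definition "q p y = (case p of (i,j) \<Rightarrow> cmod (Q y (N + j) i) + cmod (Q y i (N + j)))"

lemma Q_le: "b < N + L \<Longrightarrow> c < N + L \<Longrightarrow> cmod (Q y b c) \<le> h\<^sup>2"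
  unfolding Q_def h_def
  by (rule inverse_partial_product[OF dissipative_T dissipative_T w inverse_R inverse_R]) auto

text \<open>A column of \<open>Q\<close> is \<open>R\<close> applied to a truncated column of
  \<open>R\<close>, so the operator bound and the column bound each contribute
  \<open>h\<^sup>2\<close>.\<close>

lemma Q_col_norm:
  assumes "c < N + L"
  shows "(\<Sum>b<N + L. (cmod (Q y b c))\<^sup>2) \<le> h ^ 4"
proof -
  have "(\<Sum>b<N + L. (cmod (Q y b c))\<^sup>2) = (\<Sum>b<N + L. (cmod (\<Sum>k<N + L. R y b k * (if k < N then R y k c else 0)))\<^sup>2)"
    unfolding Q_def sum_lessThan_add[of _ N L] by simp
  also have "\<dots> \<le> (\<Sum>k<N + L. (cmod (if k < N then R y k c else 0))\<^sup>2) / (Im w)\<^sup>2"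
    by (rule inverse_norm_le[OF dissipative_T w inverse_R])
  also have "\<dots> \<le> (\<Sum>k<N + L. (cmod (R y k c))\<^sup>2) / (Im w)\<^sup>2"
    by (intro divide_right_mono sum_mono) auto
  also have "\<dots> \<le> 1 / (Im w)\<^sup>2 / (Im w)\<^sup>2"
    by (intro divide_right_mono inverse_col_norm[OF dissipative_T w inverse_R assms]) auto
  finally show ?thesis by (simp add: h_def power_divide flip: power_add)
qed

text \<open>There are \<open>N * L\<close> positions, but each of the \<open>N + L\<close> columns
  of \<open>Q\<close> has bounded square norm. This saving keeps the variance of the unnormalised
  trace bounded.\<close>

lemma q_square_sum: "(\<Sum>p\<in>I. (q p y)\<^sup>2) \<le> 2 * real (N + L) * h ^ 4"
proof -
  have "(\<Sum>p\<in>I. (q p y)\<^sup>2) \<le> (\<Sum>(i,j)\<in>I. 2 * (cmod (Q y (N + j) i))\<^sup>2 + 2 * (cmod (Q y i (N + j)))\<^sup>2)"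
    by (intro sum_mono) (auto simp: q_def intro!: square_sum_le)
  also have "\<dots> = 2 * (\<Sum>i<N. \<Sum>j<L. (cmod (Q y (N + j) i))\<^sup>2) + 2 * (\<Sum>i<N. \<Sum>j<L. (cmod (Q y i (N + j)))\<^sup>2)"
    by (simp add: sum.cartesian_product[symmetric] sum.distrib sum_distrib_left)
  also have "(\<Sum>i<N. \<Sum>j<L. (cmod (Q y i (N + j)))\<^sup>2) = (\<Sum>j<L. \<Sum>i<N. (cmod (Q y i (N + j)))\<^sup>2)"
    by (rule sum.swap)
  finally have 1: "(\<Sum>p\<in>I. (q p y)\<^sup>2) \<le> 2 * (\<Sum>i<N. \<Sum>j<L. (cmod (Q y (N + j) i))\<^sup>2) +
      2 * (\<Sum>j<L. \<Sum>i<N. (cmod (Q y i (N + j)))\<^sup>2)" .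
  have "(\<Sum>i<N. \<Sum>j<L. (cmod (Q y (N + j) i))\<^sup>2) \<le> (\<Sum>i<N. h ^ 4)"
  proof (rule sum_mono)
    fix i assume "i \<in> {..<N}"
    then have "(\<Sum>b<N + L. (cmod (Q y b i))\<^sup>2) \<le> h ^ 4" by (intro Q_col_norm) auto
    moreover have "(\<Sum>i'<N. (cmod (Q y i' i))\<^sup>2) \<ge> 0" by (rule sum_nonneg) auto
    ultimately show "(\<Sum>j<L. (cmod (Q y (N + j) i))\<^sup>2) \<le> h ^ 4" unfolding sum_lessThan_add by linarith
  qed
  moreover have "(\<Sum>j<L. \<Sum>i<N. (cmod (Q y i (N + j)))\<^sup>2) \<le> (\<Sum>j<L. h ^ 4)"
  proof (rule sum_mono)
    fix j assume "j \<in> {..<L}"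
    then have "(\<Sum>b<N + L. (cmod (Q y b (N + j)))\<^sup>2) \<le> h ^ 4" by (intro Q_col_norm) auto
    moreover have "(\<Sum>j'<L. (cmod (Q y (N + j') (N + j)))\<^sup>2) \<ge> 0" by (rule sum_nonneg) auto
    ultimately show "(\<Sum>i<N. (cmod (Q y i (N + j)))\<^sup>2) \<le> h ^ 4" unfolding sum_lessThan_add by linarith
  qed
  ultimately show ?thesis using 1 by (simp add: algebra_simps)
qed

lemma q_le: "p \<in> I \<Longrightarrow> \<bar>q p y\<bar> \<le> 2 * h\<^sup>2"
  using Q_le[of "N + snd p" "fst p" y] Q_le[of "fst p" "N + snd p" y] by (auto simp: q_def)

lemma q_measurable: "p \<in> I \<Longrightarrow> q p \<in> borel_measurable P"
  unfolding q_def Q_def by (auto intro!: borel_measurable_add borel_measurable_norm borel_measurable_sum borel_measurable_times R_measurable)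

lemma integrable_q_square:
  assumes p: "p \<in> I"
  shows "integrable P (\<lambda>y. (q p y)\<^sup>2)"
proof (rule P.integrable_const_bound[of _ "(2 * h\<^sup>2)\<^sup>2"])
  have "(q p y)\<^sup>2 \<le> (2 * h\<^sup>2)\<^sup>2" for y
    using q_le[OF p, of y] by (metis abs_ge_zero power2_abs power_mono)
  then show "AE y in P. norm ((q p y)\<^sup>2) \<le> (2 * h\<^sup>2)\<^sup>2" by (auto simp del: power_mult_distrib)
qed (use q_measurable[OF p] in measurable)

lemma fun_upd_zero_measurable:
  assumes "p \<in> I" "f \<in> borel_measurable P"
  shows "(\<lambda>y. f (y(p := 0))) \<in> borel_measurable P"
proof -
  have "(\<lambda>y. y(p := 0)) \<in> measurable P P"
    using assms(1) by (intro measurable_fun_upd[of _ I]) auto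
  then show ?thesis using assms(2) by (rule measurable_compose)
qed

lemma fun_upd_measurable:
  assumes "p \<in> I" "f \<in> borel_measurable P" "y \<in> space P"
  shows "(\<lambda>x. f (y(p := x))) \<in> borel_measurable D"
proof -
  have "(\<lambda>x. y(p := x)) \<in> measurable D P"
    using assms by (intro measurable_fun_upd[of _ I]) auto
  then show ?thesis using assms(2) by (rule measurable_compose)
qed

text \<open>
  With \<open>\<sigma>\<^sup>2\<close> of order \<open>1 / L\<close> and \<open>N / L\<close> bounded, the bound \<open>V\<close> on the variance of the unnormalised
  trace \<open>t\<close> below is of order one, so the variances of \<open>t / N\<close> are summable.
\<close>

definition "Kv = (256 + 32 * C4) * h ^ 6"

lemma Kv_nonneg: "Kv \<ge> 0"
  using h C4_nonneg by (simp add: Kv_def)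

lemma trace_increment_le:
  assumes p: "p \<in> I"
  shows "(\<integral>y. (cmod (t y - t (y(p := 0))))\<^sup>2 \<partial>P) \<le> 4 * \<sigma>\<^sup>2 * (\<integral>y. (q p y)\<^sup>2 \<partial>P) + Kv * \<sigma> ^ 4"
proof -
  obtain i j where pij: "p = (i,j)" and ij: "i < N" "j < L" using p by auto
  define d where "d y = cmod (t y - t (y(p := 0)))" for y
  have dm: "d \<in> borel_measurable P"
    unfolding d_def using fun_upd_zero_measurable[OF p t_measurable] by measurable
  have dB: "d y \<le> 2 * real N * h" for y
    unfolding d_def using norm_triangle_ineq4[of "t y" "t (y(p := 0))"] t_le[of y] t_le[of "y(p := 0)"] by linarith
  have id: "integrable P (\<lambda>y. (d y)\<^sup>2)"
  proof (rule P.integrable_const_bound[of _ "(2 * real N * h)\<^sup>2"])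
    have "(d y)\<^sup>2 \<le> (2 * real N * h)\<^sup>2" for y
      using dB[of y] by (intro power_mono) (auto simp: d_def)
    then show "AE y in P. norm ((d y)\<^sup>2) \<le> (2 * real N * h)\<^sup>2" by (auto simp del: power_mult_distrib)
  qed (use dm in measurable)
  note iq = integrable_q_square[OF p]
  have K0: "Kv * \<sigma> ^ 4 \<ge> 0" using Kv_nonneg by simp
  have "(\<integral>y. (d y)\<^sup>2 - 4 * \<sigma>\<^sup>2 * (q p y)\<^sup>2 \<partial>P) \<le> Kv * \<sigma> ^ 4"
  proof (rule integral_resample_le[OF prob_space_axioms _ p _ K0])
    show "integrable P (\<lambda>y. (d y)\<^sup>2 - 4 * \<sigma>\<^sup>2 * (q p y)\<^sup>2)" using id iq by simp
    fix y assume y: "y \<in> space P"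
    \<comment> \<open>\<open>4 * h ^ 3\<close> is the second order constant of
      \<open>trace_diff_le\<close>; \<open>8 * h ^ 3\<close> is twice the constant of
      \<open>product_entry_diff_le\<close>, as \<open>q\<close> has two terms. \<open>Kv\<close> is
      the resulting factor of \<open>\<sigma> ^ 4\<close>.\<close>
    have "(\<integral>x. (d (y(p := x)))\<^sup>2 - 4 * \<sigma>\<^sup>2 * (q p (y(p := x)))\<^sup>2 \<partial>D) \<le>
        (4 * (8 * h ^ 3)\<^sup>2 + 2 * (4 * h ^ 3)\<^sup>2 * C4) * \<sigma> ^ 4"
    proof (rule square_increment_le[where ?a0.0 = "q p (y(p := 0))" and B = "2 * h\<^sup>2"])
      show "(\<lambda>x. d (y(p := x))) \<in> borel_measurable D" by (rule fun_upd_measurable[OF p dm y])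
      show "(\<lambda>x. q p (y(p := x))) \<in> borel_measurable D" by (rule fun_upd_measurable[OF p q_measurable[OF p] y])
      fix x :: complex
      interpret E: entry_perturbation "N + L" "Im w" "bmat N w w (X (y(p := x)))" "bmat N w w (X (y(p := 0)))"
         "R (y(p := x))" "R (y(p := 0))" i "N + j" "\<sigma> * x"
        unfolding pij by (rule entry_perturbation_noise[OF ij])
      have hE: "E.h = h" by (simp add: E.h_def h_def)
      have \<sigma>x: "cmod (complex_of_real \<sigma> * x) = \<sigma> * cmod x" using \<sigma> by (simp add: norm_mult)
      show "\<bar>q p (y(p := x))\<bar> \<le> 2 * h\<^sup>2" by (rule q_le[OF p])
      show "0 \<le> d (y(p := x))" by (simp add: d_def)
      show "d (y(p := x)) \<le> \<sigma> * cmod x * q p (y(p := 0)) + 4 * h ^ 3 * (\<sigma> * cmod x)\<^sup>2"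
        using E.trace_diff_le[of N] unfolding \<sigma>x hE
        by (simp add: d_def t_def q_def pij Q_def)
      show "q p (y(p := 0)) \<le> q p (y(p := x)) + 8 * h ^ 3 * (\<sigma> * cmod x)"
      proof -
        have "cmod (Q (y(p := 0)) b c) \<le> cmod (Q (y(p := x)) b c) + 4 * h ^ 3 * (\<sigma> * cmod x)"
          if "b < N + L" "c < N + L" for b c
        proof -
          have "cmod (Q (y(p := 0)) b c - Q (y(p := x)) b c) \<le> 4 * h ^ 3 * (\<sigma> * cmod x)"
            using E.product_entry_diff_le[of N b c] that unfolding \<sigma>x hE by (simp add: Q_def)
          then show ?thesis using norm_triangle_ineq2[of "Q (y(p := 0)) b c" "Q (y(p := x)) b c"] by linarith
        qed
        from this[of "N + j" i] this[of i "N + j"] ij show ?thesis by (simp add: q_def pij)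
      qed
    qed (use h \<sigma> in \<open>simp_all add: q_def pij\<close>)
    also have "(4 * (8 * h ^ 3)\<^sup>2 + 2 * (4 * h ^ 3)\<^sup>2 * C4) * \<sigma> ^ 4 = Kv * \<sigma> ^ 4"
      by (simp add: Kv_def power_mult_distrib algebra_simps flip: power_mult)
    finally show "(\<integral>x. (d (y(p := x)))\<^sup>2 - 4 * \<sigma>\<^sup>2 * (q p (y(p := x)))\<^sup>2 \<partial>D) \<le> Kv * \<sigma> ^ 4" .
  qed auto
  moreover have "(\<integral>y. (d y)\<^sup>2 - 4 * \<sigma>\<^sup>2 * (q p y)\<^sup>2 \<partial>P) = (\<integral>y. (d y)\<^sup>2 \<partial>P) - 4 * \<sigma>\<^sup>2 * (\<integral>y. (q p y)\<^sup>2 \<partial>P)"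
    using id iq by simp
  ultimately show ?thesis by (simp add: d_def)
qed

definition "V = 8 * \<sigma>\<^sup>2 * real (N + L) * h ^ 4 + real N * real L * Kv * \<sigma> ^ 4"

text \<open>Efron-Stein is applied to real and imaginary part separately and the increments are
  recombined. Summation over all positions happens under the integral, where
  \<open>q_square_sum\<close> holds pointwise.\<close>

lemma variance_trace: "(\<integral>y. (cmod (t y - Et))\<^sup>2 \<partial>P) \<le> V"
proof -
  have ReIm: "Re Et = (\<integral>y. Re (t y) \<partial>P)" "Im Et = (\<integral>y. Im (t y) \<partial>P)"
    unfolding Et_def using integrable_t by simp_all
  have bd: "\<bar>Re (t y)\<bar> \<le> real N * h" "\<bar>Im (t y)\<bar> \<le> real N * h" for y
    using t_le[of y] abs_Re_le_cmod[of "t y"] abs_Im_le_cmod[of "t y"] by linarith+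
  have sqb: "norm ((u - v)\<^sup>2) \<le> (2 * (real N * h))\<^sup>2" if "\<bar>u\<bar> \<le> real N * h" "\<bar>v\<bar> \<le> real N * h" for u v :: real
  proof -
    have "\<bar>u - v\<bar> \<le> 2 * (real N * h)" using that by linarith
    then show ?thesis by (metis abs_ge_zero norm_power power2_abs power_mono real_norm_def)
  qed
  have bE: "\<bar>Re Et\<bar> \<le> real N * h" "\<bar>Im Et\<bar> \<le> real N * h"
    using Et_le abs_Re_le_cmod[of Et] abs_Im_le_cmod[of Et] by linarith+
  have intR: "integrable P (\<lambda>y. (Re (t y) - Re Et)\<^sup>2)" "integrable P (\<lambda>y. (Im (t y) - Im Et)\<^sup>2)"
    by (rule P.integrable_const_bound[of _ "(2 * (real N * h))\<^sup>2"], intro AE_I2 sqb bd bE, measurable)+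
  have intd: "integrable P (\<lambda>y. (Re (t y) - Re (t (y(p := 0))))\<^sup>2)" "integrable P (\<lambda>y. (Im (t y) - Im (t (y(p := 0))))\<^sup>2)"
    if p: "p \<in> I" for p
    using fun_upd_zero_measurable[OF p t_measurable]
    by (auto intro!: P.integrable_const_bound[of _ "(2 * (real N * h))\<^sup>2"] AE_I2 sqb bd simp del: power_mult_distrib norm_power)
  have "(\<integral>y. (cmod (t y - Et))\<^sup>2 \<partial>P) = (\<integral>y. (Re (t y) - Re Et)\<^sup>2 \<partial>P) + (\<integral>y. (Im (t y) - Im Et)\<^sup>2 \<partial>P)"
    using intR by (simp add: cmod_power2)
  also have "\<dots> \<le> (\<Sum>p\<in>I. \<integral>y. (Re (t y) - Re (t (y(p := 0))))\<^sup>2 \<partial>P) +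
      (\<Sum>p\<in>I. \<integral>y. (Im (t y) - Im (t (y(p := 0))))\<^sup>2 \<partial>P)"
    unfolding ReIm
    by (intro add_mono efron_stein[OF prob_space_axioms, where B = "real N * h"]) (auto intro: bd)
  also have "\<dots> = (\<Sum>p\<in>I. \<integral>y. (cmod (t y - t (y(p := 0))))\<^sup>2 \<partial>P)"
    unfolding sum.distrib[symmetric] using intd by (intro sum.cong refl) (simp add: cmod_power2)
  also have "\<dots> \<le> (\<Sum>p\<in>I. 4 * \<sigma>\<^sup>2 * (\<integral>y. (q p y)\<^sup>2 \<partial>P) + Kv * \<sigma> ^ 4)"
    by (intro sum_mono trace_increment_le)
  also have "\<dots> = 4 * \<sigma>\<^sup>2 * (\<integral>y. (\<Sum>p\<in>I. (q p y)\<^sup>2) \<partial>P) + real N * real L * Kv * \<sigma> ^ 4"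
    using integrable_q_square by (simp add: sum.distrib sum_distrib_left[symmetric] Bochner_Integration.integral_sum)
  also have "\<dots> \<le> 4 * \<sigma>\<^sup>2 * (2 * real (N + L) * h ^ 4) + real N * real L * Kv * \<sigma> ^ 4"
    using h by (intro add_mono mult_left_mono P.integral_le_const_nonneg q_square_sum order_refl) auto
  finally show ?thesis by (simp only: V_def mult_ac)
qed

lemma integrable_deviation_square: "integrable P (\<lambda>y. (cmod (t y - Et))\<^sup>2)"
proof (rule P.integrable_const_bound[of _ "(2 * (real N * h))\<^sup>2"])
  have "cmod (t y - Et) \<le> 2 * (real N * h)" for y
    using norm_triangle_ineq4[of "t y" Et] t_le[of y] Et_le by linarith
  then have "(cmod (t y - Et))\<^sup>2 \<le> (2 * (real N * h))\<^sup>2" for y by (intro power_mono) auto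
  then show "AE y in P. norm ((cmod (t y - Et))\<^sup>2) \<le> (2 * (real N * h))\<^sup>2" by (auto simp del: power_mult_distrib)
qed measurable

lemma nn_variance_trace: "(\<integral>\<^sup>+y. ennreal ((cmod (t y - Et))\<^sup>2) \<partial>P) \<le> ennreal V"
  using variance_trace by (simp add: nn_integral_eq_integral[OF integrable_deviation_square] ennreal_leI)

lemma mean_deviation_le: "(\<integral>y. cmod (t y - Et) \<partial>P) \<le> (1 + V) / 2"
proof -
  have i1: "integrable P (\<lambda>y. cmod (t y - Et))" using integrable_t by simp
  note i2 = integrable_deviation_square
  have "(\<integral>y. cmod (t y - Et) \<partial>P) \<le> (\<integral>y. (1 + (cmod (t y - Et))\<^sup>2) / 2 \<partial>P)"
  proof (rule integral_mono[OF i1])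
    show "integrable P (\<lambda>y. (1 + (cmod (t y - Et))\<^sup>2) / 2)" using i2 by simp
    fix y
    have "0 \<le> (cmod (t y - Et) - 1)\<^sup>2" by simp
    then show "cmod (t y - Et) \<le> (1 + (cmod (t y - Et))\<^sup>2) / 2" by (simp add: power2_eq_square algebra_simps)
  qed
  also have "\<dots> = (1 + (\<integral>y. (cmod (t y - Et))\<^sup>2 \<partial>P)) / 2" using i2 by (simp add: P.prob_space)
  finally show ?thesis using variance_trace by simp
qed

end

subsection \<open>The approximate fixed point equation\<close>

context info_plus_noise
begin

text \<open>Self-energies: to leading order, averaging the Hermitized noise on both sides of the
  resolvent leaves \<open>\<sigma>\<^sup>2\<close> times the trace of the opposite block. Mean
  traces are used, so \<open>E\<close> is deterministic once \<open>a\<close> is frozen; it plays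
  the role of the deterministic equivalent of \<open>R\<close>.\<close>

definition "S1 = complex_of_real (\<sigma>\<^sup>2) * Er"
definition "S2 = complex_of_real (\<sigma>\<^sup>2) * Et"
definition "E = minv (N + L) (bmat N (w + S1) (w + S2) a)"
definition "u y b c = (\<Sum>k<N. R y b k * E k c)"

lemma dissipative_E: "dissipative (N + L) (Im w) (bmat N (w + S1) (w + S2) a)"
  by (rule dissipative_bmat) (use Et_Im Er_Im in \<open>auto simp: S1_def S2_def simp del: of_real_power\<close>)

lemma inverse_E: "inverse_pair (N + L) (bmat N (w + S1) (w + S2) a) E"
  unfolding E_def by (rule dissipative_inverse_pair[OF dissipative_E w])

lemma u_le: "b < N + L \<Longrightarrow> c < N + L \<Longrightarrow> cmod (u y b c) \<le> h\<^sup>2"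
  unfolding u_def h_def
  by (rule inverse_partial_product[OF dissipative_T dissipative_E w inverse_R inverse_E]) auto

lemma u_measurable: "b < N + L \<Longrightarrow> c < N + L \<Longrightarrow> (\<lambda>y. u y b c) \<in> borel_measurable P"
  unfolding u_def by (intro borel_measurable_sum borel_measurable_times R_measurable borel_measurable_const) auto

lemma integrable_entry: "p \<in> I \<Longrightarrow> integrable P (\<lambda>y. cmod (y p))"
proof -
  assume p: "p \<in> I"
  have [measurable]: "(\<lambda>y. y p) \<in> measurable P D" using p by (intro measurable_component_singleton) auto
  interpret PS: product_prob_space "\<lambda>_. D" I
    by unfold_locales
  have "integrable (distr P D (\<lambda>y. y p)) cmod"
    using PS.PiM_component[OF p] integrable_norm_id by simp
  then show ?thesis by (subst (asm) integrable_distr_eq) auto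
qed

lemma entry_measurable:
  assumes "p \<in> I"
  shows "(\<lambda>y. y p) \<in> borel_measurable P"
proof -
  have "(\<lambda>y. y p) \<in> measurable P D" using assms by (intro measurable_component_singleton) auto
  then show ?thesis by (simp add: measurable_cong_sets[OF refl sets_D])
qed

lemma integrable_entry_times:
  assumes p: "p \<in> I" and f: "f \<in> borel_measurable P" "\<And>y. cmod (f y) \<le> B" and g: "\<And>x. cmod (g x) = cmod x"
    "(\<lambda>y. g (y p)) \<in> borel_measurable P"
  shows "integrable P (\<lambda>y. g (y p) * f y :: complex)"
proof (rule Bochner_Integration.integrable_bound[of _ "\<lambda>y. B * cmod (y p)"])
  show "integrable P (\<lambda>y. B * cmod (y p))" using integrable_entry[OF p] by simp
  have B: "B \<ge> 0" using f(2) norm_ge_zero order_trans by blast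
  show "AE y in P. norm (g (y p) * f y) \<le> norm (B * cmod (y p))"
  proof (rule AE_I2)
    fix y
    have "cmod (y p) * cmod (f y) \<le> cmod (y p) * B" using f(2) by (rule mult_left_mono) simp
    then show "norm (g (y p) * f y) \<le> norm (B * cmod (y p))" using B by (simp add: norm_mult g mult.commute)
  qed
qed (use f g in measurable)

text \<open>
  Writing \<open>W\<close> for the Hermitized noise, \<open>R - E = - E (W + diag (S1, S2)) R\<close>. In the trace of this
  identity each noise entry is paired with the first order term of its Taylor expansion; the
  remainders \<open>e1\<close> and \<open>e2\<close> have mean of third order in the entry.
\<close>

definition "e1 i j y = y (i,j) * u y (N + j) i + \<sigma> * pseudo_variance * (R y (N + j) i * u y (N + j) i) +
  \<sigma> * (R y (N + j) (N + j) * u y i i)"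

definition "e2 i j y = cnj (y (i,j)) * u y i (N + j) + \<sigma> * cnj pseudo_variance * (R y i (N + j) * u y i (N + j)) +
  \<sigma> * (R y i i * u y (N + j) (N + j))"

definition "Ke = 4 * h ^ 4 * (C3 + 2)"

lemma Ru_le: "b < N + L \<Longrightarrow> c < N + L \<Longrightarrow> b' < N + L \<Longrightarrow> c' < N + L \<Longrightarrow> cmod (R y b c * u y b' c') \<le> h * h\<^sup>2"
  unfolding norm_mult using h by (intro mult_mono R_le u_le) auto

lemma Ru_measurable:
  "b < N + L \<Longrightarrow> c < N + L \<Longrightarrow> b' < N + L \<Longrightarrow> c' < N + L \<Longrightarrow> (\<lambda>y. R y b c * u y b' c') \<in> borel_measurable P"
  by (intro borel_measurable_times R_measurable u_measurable)

lemma integrable_Ru: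
  "b < N + L \<Longrightarrow> c < N + L \<Longrightarrow> b' < N + L \<Longrightarrow> c' < N + L \<Longrightarrow> integrable P (\<lambda>y. R y b c * u y b' c')"
  by (rule P.integrable_const_bound[of _ "h * h\<^sup>2"]) (auto intro: Ru_le Ru_measurable)

lemma integrable_e:
  assumes "i < N" "j < L"
  shows "integrable P (e1 i j)" "integrable P (e2 i j)"
proof -
  have p: "(i,j) \<in> I" using assms by auto
  show "integrable P (e1 i j)" unfolding e1_def
    by (intro Bochner_Integration.integrable_add integrable_mult_right
        integrable_entry_times[OF p, where g = "\<lambda>x. x" and B = "h\<^sup>2"] u_measurable u_le integrable_Ru entry_measurable[OF p])
       (use assms in auto)
  show "integrable P (e2 i j)" unfolding e2_def
    by (intro Bochner_Integration.integrable_add integrable_mult_right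
        integrable_entry_times[OF p, where g = cnj and B = "h\<^sup>2"] u_measurable u_le integrable_Ru
        borel_measurable_cnj entry_measurable[OF p])
       (use assms in auto)
qed

text \<open>All coordinates but \<open>(i, j)\<close> are frozen. \<open>E\<close> does not depend
  on the sample, so the expansion of \<open>u\<close> in that entry comes from \<open>R\<close>
  alone, with a column of \<open>E\<close> as the fixed vector of
  \<open>image_expansion\<close>.\<close>

lemma mean_e_le:
  assumes ij: "i < N" "j < L"
  shows "cmod (\<integral>y. e1 i j y \<partial>P) \<le> Ke * \<sigma>\<^sup>2" "cmod (\<integral>y. e2 i j y \<partial>P) \<le> Ke * \<sigma>\<^sup>2"
proof -
  have p: "(i,j) \<in> I" using ij by auto
  have n: "i < N + L" "N + j < N + L" using ij by auto
  have K0: "Ke * \<sigma>\<^sup>2 \<ge> 0" using h C3_nonneg by (simp add: Ke_def)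
  have Ke: "4 * h\<^sup>2 * h\<^sup>2 * \<sigma>\<^sup>2 * (C3 + 2) = Ke * \<sigma>\<^sup>2"
    by (simp add: Ke_def algebra_simps flip: power_add)
  have c0: "4 * h\<^sup>2 * h\<^sup>2 \<ge> 0" by simp
  have pert: "cmod (u (y((i,j) := x)) b c - (u (y((i,j) := 0)) b c -
        \<sigma> * x * (R (y((i,j) := 0)) b i * u (y((i,j) := 0)) (N + j) c) -
        cnj (\<sigma> * x) * (R (y((i,j) := 0)) b (N + j) * u (y((i,j) := 0)) i c))) \<le> 4 * h\<^sup>2 * h\<^sup>2 * (\<sigma> * cmod x)\<^sup>2"
     "cmod (R (y((i,j) := x)) b i * u (y((i,j) := x)) (N + j) c -
        R (y((i,j) := 0)) b i * u (y((i,j) := 0)) (N + j) c) \<le> 4 * h\<^sup>2 * h\<^sup>2 * (\<sigma> * cmod x)"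
     "cmod (R (y((i,j) := x)) b (N + j) * u (y((i,j) := x)) i c -
        R (y((i,j) := 0)) b (N + j) * u (y((i,j) := 0)) i c) \<le> 4 * h\<^sup>2 * h\<^sup>2 * (\<sigma> * cmod x)"
    if b: "b < N + L" and c: "c < N + L" for x :: complex and y b c
  proof -
    interpret E: entry_perturbation "N + L" "Im w" "bmat N w w (X (y((i,j) := x)))" "bmat N w w (X (y((i,j) := 0)))"
       "R (y((i,j) := x))" "R (y((i,j) := 0))" i "N + j" "\<sigma> * x"
      by (rule entry_perturbation_noise[OF ij])
    have hE: "E.h = h" by (simp add: E.h_def h_def)
    have \<sigma>x: "cmod (complex_of_real \<sigma> * x) = \<sigma> * cmod x" using \<sigma> by (simp add: norm_mult)
    have K: "{..<N} \<subseteq> {..<N + L}" by auto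
    note prem = K u_def u_def u_le[OF _ c] u_le[OF _ c]
    show "cmod (u (y((i,j) := x)) b c - (u (y((i,j) := 0)) b c -
        \<sigma> * x * (R (y((i,j) := 0)) b i * u (y((i,j) := 0)) (N + j) c) -
        cnj (\<sigma> * x) * (R (y((i,j) := 0)) b (N + j) * u (y((i,j) := 0)) i c))) \<le> 4 * h\<^sup>2 * h\<^sup>2 * (\<sigma> * cmod x)\<^sup>2"
      using E.image_expansion[OF prem b] unfolding \<sigma>x hE .
    show "cmod (R (y((i,j) := x)) b i * u (y((i,j) := x)) (N + j) c -
        R (y((i,j) := 0)) b i * u (y((i,j) := 0)) (N + j) c) \<le> 4 * h\<^sup>2 * h\<^sup>2 * (\<sigma> * cmod x)"
      using E.product_diff_le[OF prem b n(1) n(2)] unfolding \<sigma>x hE .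
    show "cmod (R (y((i,j) := x)) b (N + j) * u (y((i,j) := x)) i c -
        R (y((i,j) := 0)) b (N + j) * u (y((i,j) := 0)) i c) \<le> 4 * h\<^sup>2 * h\<^sup>2 * (\<sigma> * cmod x)"
      using E.product_diff_le[OF prem b n(2) n(1)] unfolding \<sigma>x hE .
  qed
  note meas = fun_upd_measurable[OF p u_measurable] fun_upd_measurable[OF p Ru_measurable]
  show "cmod (\<integral>y. e1 i j y \<partial>P) \<le> Ke * \<sigma>\<^sup>2"
  proof (rule norm_integral_resample_le[OF prob_space_axioms _ p integrable_e(1)[OF ij] K0])
    fix y assume y: "y \<in> space P"
    show "cmod (\<integral>x. e1 i j (y((i,j) := x)) \<partial>D) \<le> Ke * \<sigma>\<^sup>2"
      unfolding e1_def fun_upd_same Ke[symmetric]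
      by (rule first_order_mean[OF _ _ _ \<sigma> c0 pert[OF n(2) n(1)]]) (intro meas n y)+
  qed simp
  show "cmod (\<integral>y. e2 i j y \<partial>P) \<le> Ke * \<sigma>\<^sup>2"
  proof (rule norm_integral_resample_le[OF prob_space_axioms _ p integrable_e(2)[OF ij] K0])
    fix y assume y: "y \<in> space P"
    show "cmod (\<integral>x. e2 i j (y((i,j) := x)) \<partial>D) \<le> Ke * \<sigma>\<^sup>2"
      unfolding e2_def fun_upd_same Ke[symmetric]
      by (rule first_order_mean_cnj[OF _ _ _ \<sigma> c0 pert[OF n(1) n(2)]]) (intro meas n y)+
  qed simp
qed

definition "U1 y = (\<Sum>i<N. u y i i)"
definition "U2 y = (\<Sum>j<L. u y (N + j) (N + j))"
definition "Q1 y = (\<Sum>i<N. \<Sum>j<L. R y (N + j) i * u y (N + j) i)"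
definition "Q2 y = (\<Sum>i<N. \<Sum>j<L. R y i (N + j) * u y i (N + j))"
definition "trE = (\<Sum>k<N. E k k)"

text \<open>An exact identity. The sums of \<open>e1\<close> and \<open>e2\<close> produce
  \<open>r * U1\<close> and \<open>t * U2\<close> with factor \<open>\<sigma>\<^sup>2\<close>;
  against them stand \<open>S1 * U1\<close> and \<open>S2 * U2\<close>, which contain the means.
  Only the centred traces remain, and by \<open>deviation_eq\<close> they are one and the same
  quantity.\<close>

lemma trace_expansion:
  "t y - trE = - (\<sigma> * (\<Sum>i<N. \<Sum>j<L. e1 i j y + e2 i j y)) +
     complex_of_real (\<sigma>\<^sup>2) * (pseudo_variance * Q1 y + cnj pseudo_variance * Q2 y) +
     complex_of_real (\<sigma>\<^sup>2) * (t y - Et) * (U1 y + U2 y)"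
proof -
  define Y where "Y i j = complex_of_real \<sigma> * y (i,j)" for i j
  define \<Delta> where "\<Delta> c d = bmat N (w + S1) (w + S2) a c d - bmat N w w (X y) c d" for c d
  have \<Delta>: "\<Delta> c d = - hermz N Y c d - (if c = d then if c < N then S1 else S2 else 0)" for c d
    by (auto simp: \<Delta>_def bmat_def hermz_def X_def Y_def)
  have "t y - trE = (\<Sum>k<N. R y k k - E k k)" by (simp add: t_def trE_def sum_subtractf)
  also have "\<dots> = (\<Sum>k<N. \<Sum>c<N + L. \<Sum>d<N + L. E k c * \<Delta> c d * R y d k)"
    unfolding \<Delta>_def
    by (intro sum.cong refl resolvent_identity[OF inverse_E inverse_R, symmetric]) auto
  also have "\<dots> = (\<Sum>c<N + L. \<Sum>d<N + L. \<Sum>k<N. E k c * \<Delta> c d * R y d k)"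
    by (subst sum.swap) (intro sum.cong refl sum.swap)
  also have "\<dots> = (\<Sum>c<N + L. \<Sum>d<N + L. \<Delta> c d * u y d c)"
    unfolding u_def sum_distrib_left by (simp add: mult_ac)
  also have "\<dots> = - (\<Sum>c<N + L. \<Sum>d<N + L. hermz N Y c d * u y d c) -
      (\<Sum>c<N + L. (if c < N then S1 else S2) * u y c c)"
  proof -
    have "(\<Sum>d<N + L. \<Delta> c d * u y d c) = - (\<Sum>d<N + L. hermz N Y c d * u y d c) - (if c < N then S1 else S2) * u y c c"
      if "c < N + L" for c
    proof -
      have "(\<Sum>d<N + L. \<Delta> c d * u y d c) = (\<Sum>d<N + L. - (hermz N Y c d * u y d c) -
          (if c = d then (if c < N then S1 else S2) * u y d c else 0))"
        by (intro sum.cong refl) (auto simp: \<Delta> algebra_simps)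
      then show ?thesis using that by (simp add: sum_subtractf sum_negf)
    qed
    then have "(\<Sum>c<N + L. \<Sum>d<N + L. \<Delta> c d * u y d c) =
      (\<Sum>c<N + L. - (\<Sum>d<N + L. hermz N Y c d * u y d c) - (if c < N then S1 else S2) * u y c c)"
      by (intro sum.cong refl) auto
    then show ?thesis by (simp add: sum_subtractf sum_negf)
  qed
  also have "(\<Sum>c<N + L. (if c < N then S1 else S2) * u y c c) = S1 * U1 y + S2 * U2 y"
    by (simp add: sum_lessThan_add U1_def U2_def sum_distrib_left)
  also have "(\<Sum>c<N + L. \<Sum>d<N + L. hermz N Y c d * u y d c) =
      (\<Sum>i<N. \<Sum>j<L. Y i j * u y (N + j) i) + (\<Sum>j<L. \<Sum>i<N. cnj (Y i j) * u y i (N + j))"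
    by (simp add: sum_lessThan_add hermz_def)
  also have "(\<Sum>j<L. \<Sum>i<N. cnj (Y i j) * u y i (N + j)) = (\<Sum>i<N. \<Sum>j<L. cnj (Y i j) * u y i (N + j))"
    by (rule sum.swap)
  finally have 1: "t y - trE = - ((\<Sum>i<N. \<Sum>j<L. Y i j * u y (N + j) i) + (\<Sum>i<N. \<Sum>j<L. cnj (Y i j) * u y i (N + j))) -
      (S1 * U1 y + S2 * U2 y)" .
  have "(\<Sum>i<N. \<Sum>j<L. R y (N + j) (N + j) * u y i i) = (\<Sum>i<N. u y i i * (\<Sum>j<L. R y (N + j) (N + j)))"
    unfolding sum_distrib_left by (simp add: mult.commute)
  also have "\<dots> = r y * U1 y" by (simp add: r_def U1_def sum_distrib_right[symmetric] mult.commute)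
  finally have rU: "(\<Sum>i<N. \<Sum>j<L. R y (N + j) (N + j) * u y i i) = r y * U1 y" .
  have "(\<Sum>i<N. \<Sum>j<L. R y i i * u y (N + j) (N + j)) = (\<Sum>i<N. R y i i * (\<Sum>j<L. u y (N + j) (N + j)))"
    unfolding sum_distrib_left ..
  also have "\<dots> = t y * U2 y" by (simp add: t_def U2_def sum_distrib_right[symmetric])
  finally have tU: "(\<Sum>i<N. \<Sum>j<L. R y i i * u y (N + j) (N + j)) = t y * U2 y" .
  have s1: "(\<Sum>i<N. \<Sum>j<L. e1 i j y) = (\<Sum>i<N. \<Sum>j<L. y (i,j) * u y (N + j) i) + \<sigma> * pseudo_variance * Q1 y + \<sigma> * (r y * U1 y)"
    unfolding e1_def rU[symmetric] Q1_def by (simp add: sum.distrib sum_distrib_left)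
  have s2: "(\<Sum>i<N. \<Sum>j<L. e2 i j y) = (\<Sum>i<N. \<Sum>j<L. cnj (y (i,j)) * u y i (N + j)) + \<sigma> * cnj pseudo_variance * Q2 y + \<sigma> * (t y * U2 y)"
    unfolding e2_def tU[symmetric] Q2_def by (simp add: sum.distrib sum_distrib_left)
  have y1: "(\<Sum>i<N. \<Sum>j<L. Y i j * u y (N + j) i) = \<sigma> * (\<Sum>i<N. \<Sum>j<L. y (i,j) * u y (N + j) i)"
    unfolding Y_def by (simp add: sum_distrib_left mult_ac)
  have y2: "(\<Sum>i<N. \<Sum>j<L. cnj (Y i j) * u y i (N + j)) = \<sigma> * (\<Sum>i<N. \<Sum>j<L. cnj (y (i,j)) * u y i (N + j))"
    unfolding Y_def by (simp add: sum_distrib_left mult_ac)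
  have ss: "(\<Sum>i<N. \<Sum>j<L. e1 i j y + e2 i j y) = (\<Sum>i<N. \<Sum>j<L. e1 i j y) + (\<Sum>i<N. \<Sum>j<L. e2 i j y)"
    by (simp add: sum.distrib)
  have Er_eq: "Er = r y - t y + Et" using deviation_eq[of y] by (simp add: algebra_simps)
  show ?thesis unfolding 1 ss s1 s2 y1 y2 S1_def S2_def Er_eq
    by (simp add: algebra_simps power2_eq_square)
qed

lemma row_sum_le:
  assumes b: "b < N + L"
  shows "(\<Sum>j<L. cmod (R y b (N + j))) \<le> sqrt (real L) * h" "(\<Sum>j<L. cmod (R y (N + j) b)) \<le> sqrt (real L) * h"
proof -
  have *: "(\<Sum>j<L. f j) \<le> sqrt (real L) * h" if "(\<Sum>j<L. (f j)\<^sup>2) \<le> h\<^sup>2" for f :: "nat \<Rightarrow> real"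
  proof -
    have "(\<Sum>j<L. 1 * f j)\<^sup>2 \<le> (\<Sum>j<L. 1\<^sup>2) * (\<Sum>j<L. (f j)\<^sup>2)" by (rule Cauchy_Schwarz_ineq_sum)
    also have "\<dots> \<le> real L * h\<^sup>2" using that by (simp add: mult_left_mono)
    also have "\<dots> = (sqrt (real L) * h)\<^sup>2" by (simp add: power_mult_distrib)
    finally show ?thesis using h by (intro power2_le_imp_le[of "\<Sum>j<L. f j"]) auto
  qed
  have "(\<Sum>c<N + L. (cmod (R y b c))\<^sup>2) \<le> h\<^sup>2"
    using inverse_row_norm[OF dissipative_T w inverse_R b] by (simp add: h_def power_divide)
  moreover have "(\<Sum>c<N. (cmod (R y b c))\<^sup>2) \<ge> 0" by (rule sum_nonneg) auto
  ultimately show "(\<Sum>j<L. cmod (R y b (N + j))) \<le> sqrt (real L) * h"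
    by (intro *) (simp add: sum_lessThan_add)
  have "(\<Sum>c<N + L. (cmod (R y c b))\<^sup>2) \<le> h\<^sup>2"
    using inverse_col_norm[OF dissipative_T w inverse_R b] by (simp add: h_def power_divide)
  moreover have "(\<Sum>c<N. (cmod (R y c b))\<^sup>2) \<ge> 0" by (rule sum_nonneg) auto
  ultimately show "(\<Sum>j<L. cmod (R y (N + j) b)) \<le> sqrt (real L) * h"
    by (intro *) (simp add: sum_lessThan_add)
qed

text \<open>The double sums have \<open>N * L\<close> terms, but Cauchy-Schwarz along a row or
  column of length \<open>L\<close> gains \<open>sqrt L\<close>. This makes the pseudo-variance
  terms negligible after division by \<open>N\<close>.\<close>

lemma Q12_le: "cmod (Q1 y) \<le> real N * sqrt (real L) * h ^ 3" "cmod (Q2 y) \<le> real N * sqrt (real L) * h ^ 3"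
proof -
  have "cmod (Q1 y) \<le> (\<Sum>i<N. \<Sum>j<L. cmod (R y (N + j) i) * h\<^sup>2)"
    unfolding Q1_def
    by (intro order_trans[OF norm_sum] sum_mono) (auto simp: norm_mult intro!: mult_left_mono u_le)
  also have "\<dots> = (\<Sum>i<N. (\<Sum>j<L. cmod (R y (N + j) i)) * h\<^sup>2)" by (simp only: sum_distrib_right)
  also have "\<dots> \<le> (\<Sum>i<N. sqrt (real L) * h * h\<^sup>2)"
    by (intro sum_mono mult_right_mono row_sum_le) auto
  finally show "cmod (Q1 y) \<le> real N * sqrt (real L) * h ^ 3" by (simp add: power3_eq_cube power2_eq_square mult_ac)
  have "cmod (Q2 y) \<le> (\<Sum>i<N. \<Sum>j<L. cmod (R y i (N + j)) * h\<^sup>2)"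
    unfolding Q2_def
    by (intro order_trans[OF norm_sum] sum_mono) (auto simp: norm_mult intro!: mult_left_mono u_le)
  also have "\<dots> = (\<Sum>i<N. (\<Sum>j<L. cmod (R y i (N + j))) * h\<^sup>2)" by (simp only: sum_distrib_right)
  also have "\<dots> \<le> (\<Sum>i<N. sqrt (real L) * h * h\<^sup>2)"
    by (intro sum_mono mult_right_mono row_sum_le) auto
  finally show "cmod (Q2 y) \<le> real N * sqrt (real L) * h ^ 3" by (simp add: power3_eq_cube power2_eq_square mult_ac)
qed

lemma U_le: "cmod (U1 y + U2 y) \<le> real (N + L) * h\<^sup>2"
proof -
  have "U1 y + U2 y = (\<Sum>c<N + L. u y c c)" by (simp add: U1_def U2_def sum_lessThan_add)
  moreover have "cmod (\<Sum>c<N + L. u y c c) \<le> (\<Sum>c<N + L. h\<^sup>2)"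
    by (intro order_trans[OF norm_sum] sum_mono u_le) auto
  ultimately show ?thesis by simp
qed

text \<open>With \<open>\<sigma>\<^sup>2\<close> of order \<open>1 / L\<close>, \<open>err / N\<close> is of order \<open>1 / sqrt L\<close>.\<close>

definition "err = 2 * real N * real L * Ke * \<sigma> ^ 3 + 2 * \<sigma>\<^sup>2 * (real N * sqrt (real L) * h ^ 3) +
  \<sigma>\<^sup>2 * (real (N + L) * h\<^sup>2) * ((1 + V) / 2)"

text \<open>The three summands of \<open>err\<close> are, in order, the Taylor remainders in
  \<open>e1\<close> and \<open>e2\<close>, the pseudo-variance terms, and the fluctuation of the
  trace against \<open>U1 + U2\<close>.\<close>

lemma mean_trace_approx: "cmod (Et - trE) \<le> err"
proof -
  define rest where "rest y = complex_of_real (\<sigma>\<^sup>2) * (pseudo_variance * Q1 y + cnj pseudo_variance * Q2 y) +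
     complex_of_real (\<sigma>\<^sup>2) * (t y - Et) * (U1 y + U2 y)" for y
  have Qm: "Q1 \<in> borel_measurable P" "Q2 \<in> borel_measurable P" "U1 \<in> borel_measurable P" "U2 \<in> borel_measurable P"
    unfolding Q1_def Q2_def U1_def U2_def by (intro borel_measurable_sum Ru_measurable u_measurable; auto)+
  have restm: "rest \<in> borel_measurable P" unfolding rest_def using Qm by measurable
  have rest_le: "cmod (rest y) \<le> 2 * \<sigma>\<^sup>2 * (real N * sqrt (real L) * h ^ 3) + \<sigma>\<^sup>2 * (real (N + L) * h\<^sup>2) * cmod (t y - Et)" for y
  proof -
    have "cmod (rest y) \<le> \<sigma>\<^sup>2 * (cmod pseudo_variance * cmod (Q1 y) + cmod pseudo_variance * cmod (Q2 y)) +
        \<sigma>\<^sup>2 * cmod (t y - Et) * cmod (U1 y + U2 y)"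
      unfolding rest_def
      by (intro order_trans[OF norm_triangle_ineq] add_mono)
         (auto simp: norm_mult norm_power intro!: mult_left_mono order_trans[OF norm_triangle_ineq])
    also have "\<dots> \<le> \<sigma>\<^sup>2 * (1 * (real N * sqrt (real L) * h ^ 3) + 1 * (real N * sqrt (real L) * h ^ 3)) +
        \<sigma>\<^sup>2 * cmod (t y - Et) * (real (N + L) * h\<^sup>2)"
      by (intro add_mono mult_left_mono mult_mono pseudo_variance_le Q12_le U_le) auto
    finally show ?thesis by (simp only: mult_ac) (simp add: mult_ac)
  qed
  have ib: "integrable P (\<lambda>y. 2 * \<sigma>\<^sup>2 * (real N * sqrt (real L) * h ^ 3) + \<sigma>\<^sup>2 * (real (N + L) * h\<^sup>2) * cmod (t y - Et))"
    using integrable_t by simp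
  have ir: "integrable P rest"
    by (rule Bochner_Integration.integrable_bound[OF ib restm])
       (auto intro!: AE_I2 order_trans[OF rest_le] abs_ge_self simp del: of_nat_add)
  have ie: "integrable P (\<lambda>y. e1 i j y + e2 i j y)" if "i < N" "j < L" for i j
    using integrable_e[OF that] by simp
  have isum: "integrable P (\<lambda>y. \<Sum>i<N. \<Sum>j<L. e1 i j y + e2 i j y)"
    by (intro Bochner_Integration.integrable_sum ie) auto
  have is_eq: "(\<integral>y. (\<Sum>i<N. \<Sum>j<L. e1 i j y + e2 i j y) \<partial>P) = (\<Sum>i<N. \<Sum>j<L. (\<integral>y. e1 i j y \<partial>P) + (\<integral>y. e2 i j y \<partial>P))"
  proof -
    have "(\<integral>y. (\<Sum>i<N. \<Sum>j<L. e1 i j y + e2 i j y) \<partial>P) = (\<Sum>i<N. \<integral>y. (\<Sum>j<L. e1 i j y + e2 i j y) \<partial>P)"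
      by (intro Bochner_Integration.integral_sum Bochner_Integration.integrable_sum ie) auto
    also have "\<dots> = (\<Sum>i<N. \<Sum>j<L. \<integral>y. e1 i j y + e2 i j y \<partial>P)"
      by (intro sum.cong refl Bochner_Integration.integral_sum ie) auto
    also have "\<dots> = (\<Sum>i<N. \<Sum>j<L. (\<integral>y. e1 i j y \<partial>P) + (\<integral>y. e2 i j y \<partial>P))"
      by (intro sum.cong refl Bochner_Integration.integral_add integrable_e) auto
    finally show ?thesis .
  qed
  have "Et - trE = (\<integral>y. t y - trE \<partial>P)" using integrable_t by (simp add: Et_def P.prob_space)
  also have "\<dots> = (\<integral>y. - (\<sigma> * (\<Sum>i<N. \<Sum>j<L. e1 i j y + e2 i j y)) + rest y \<partial>P)"
    unfolding trace_expansion rest_def by (intro Bochner_Integration.integral_cong refl) (simp only: add.assoc)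
  also have "\<dots> = - (\<sigma> * (\<Sum>i<N. \<Sum>j<L. (\<integral>y. e1 i j y \<partial>P) + (\<integral>y. e2 i j y \<partial>P))) + (\<integral>y. rest y \<partial>P)"
    using ir isum by (simp only: is_eq Bochner_Integration.integral_add Bochner_Integration.integrable_minus integrable_mult_right integral_minus integral_mult_right_zero)
  finally have eq: "Et - trE = - (\<sigma> * (\<Sum>i<N. \<Sum>j<L. (\<integral>y. e1 i j y \<partial>P) + (\<integral>y. e2 i j y \<partial>P))) + (\<integral>y. rest y \<partial>P)" .
  have "cmod (\<integral>y. rest y \<partial>P) \<le> (\<integral>y. cmod (rest y) \<partial>P)" by (rule integral_norm_bound)
  also have "\<dots> \<le> (\<integral>y. 2 * \<sigma>\<^sup>2 * (real N * sqrt (real L) * h ^ 3) + \<sigma>\<^sup>2 * (real (N + L) * h\<^sup>2) * cmod (t y - Et) \<partial>P)"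
    using ir ib rest_le by (intro integral_mono) auto
  also have "\<dots> = 2 * \<sigma>\<^sup>2 * (real N * sqrt (real L) * h ^ 3) + \<sigma>\<^sup>2 * (real (N + L) * h\<^sup>2) * (\<integral>y. cmod (t y - Et) \<partial>P)"
    using integrable_t by (simp add: P.prob_space)
  also have "\<dots> \<le> 2 * \<sigma>\<^sup>2 * (real N * sqrt (real L) * h ^ 3) + \<sigma>\<^sup>2 * (real (N + L) * h\<^sup>2) * ((1 + V) / 2)"
    by (intro add_mono order_refl mult_left_mono mean_deviation_le) auto
  finally have A: "cmod (\<integral>y. rest y \<partial>P) \<le> 2 * \<sigma>\<^sup>2 * (real N * sqrt (real L) * h ^ 3) + \<sigma>\<^sup>2 * (real (N + L) * h\<^sup>2) * ((1 + V) / 2)" .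
  have "cmod (\<Sum>i<N. \<Sum>j<L. (\<integral>y. e1 i j y \<partial>P) + (\<integral>y. e2 i j y \<partial>P)) \<le> (\<Sum>i<N. \<Sum>j<L. Ke * \<sigma>\<^sup>2 + Ke * \<sigma>\<^sup>2)"
    by (intro order_trans[OF norm_sum] sum_mono order_trans[OF norm_triangle_ineq] add_mono mean_e_le) auto
  then have "\<sigma> * cmod (\<Sum>i<N. \<Sum>j<L. (\<integral>y. e1 i j y \<partial>P) + (\<integral>y. e2 i j y \<partial>P)) \<le> \<sigma> * (real N * (real L * (2 * (Ke * \<sigma>\<^sup>2))))"
    using \<sigma> by (intro mult_left_mono) auto
  also have "\<dots> = 2 * real N * real L * Ke * \<sigma> ^ 3" by (simp add: power3_eq_cube power2_eq_square)
  finally have B: "cmod (\<sigma> * (\<Sum>i<N. \<Sum>j<L. (\<integral>y. e1 i j y \<partial>P) + (\<integral>y. e2 i j y \<partial>P))) \<le> 2 * real N * real L * Ke * \<sigma> ^ 3"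
    using \<sigma> by (simp add: norm_mult)
  show ?thesis unfolding eq err_def
    by (rule order_trans[OF norm_triangle_ineq], unfold norm_minus_cancel add.assoc, rule add_mono[OF B A])
qed

end

section \<open>Stieltjes transforms\<close>

lemma norm_resolvent_le:
  assumes "Im z > 0"
  shows "cmod (1 / (complex_of_real x - z)) \<le> 1 / Im z"
proof -
  have "Im z \<le> cmod (complex_of_real x - z)"
    using abs_Im_le_cmod[of "complex_of_real x - z"] assms by simp
  then show ?thesis using assms by (simp add: norm_divide frac_le)
qed

lemma resolvent_nonzero: "Im z > 0 \<Longrightarrow> complex_of_real x - z \<noteq> 0"
  by (auto simp: complex_eq_iff)

definition stieltjes_power :: "real measure \<Rightarrow> nat \<Rightarrow> complex \<Rightarrow> complex" where
  "stieltjes_power \<mu> k z = (LINT x|\<mu>. (1 / (complex_of_real x - z)) ^ k)"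

lemma stieltjes_power_1: "stieltjes_power \<mu> 1 z = stieltjes \<mu> z"
  by (simp add: stieltjes_power_def stieltjes_def)

lemma
  assumes \<mu>: "real_distribution \<mu>" and z: "Im z > 0"
  shows integrable_resolvent_power: "integrable \<mu> (\<lambda>x. (1 / (complex_of_real x - z)) ^ k)"
    and integrable_resolvent: "integrable \<mu> (\<lambda>x. 1 / (complex_of_real x - z))"
proof -
  interpret real_distribution \<mu> by fact
  show *: "integrable \<mu> (\<lambda>x. (1 / (complex_of_real x - z)) ^ k)" for k
  proof (rule integrable_const_bound[of _ "(1 / Im z) ^ k"])
    have "cmod (1 / (complex_of_real x - z)) ^ k \<le> (1 / Im z) ^ k" for x
      using norm_resolvent_le[OF z] by (intro power_mono) auto
    then show "AE x in \<mu>. norm ((1 / (complex_of_real x - z)) ^ k) \<le> (1 / Im z) ^ k"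
      by (simp add: norm_power)
  qed measurable
  show "integrable \<mu> (\<lambda>x. 1 / (complex_of_real x - z))" using *[of 1] by simp
qed

lemma stieltjes_norm_le:
  assumes \<mu>: "real_distribution \<mu>" and z: "Im z > 0"
  shows "cmod (stieltjes \<mu> z) \<le> 1 / Im z"
proof -
  interpret real_distribution \<mu> by fact
  show ?thesis unfolding stieltjes_def
    by (rule norm_integral_le_const) (use norm_resolvent_le[OF z] z in auto)
qed

lemma stieltjes_lipschitz:
  assumes \<mu>: "real_distribution \<mu>" and z: "Im z \<ge> b" "Im z' \<ge> b" "b > 0"
  shows "cmod (stieltjes \<mu> z - stieltjes \<mu> z') \<le> cmod (z - z') / b\<^sup>2"
proof -
  interpret real_distribution \<mu> by fact
  have zp: "Im z > 0" "Im z' > 0" using z by auto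
  have "stieltjes \<mu> z - stieltjes \<mu> z' = (LINT x|\<mu>. 1 / (complex_of_real x - z) - 1 / (complex_of_real x - z'))"
    unfolding stieltjes_def using integrable_resolvent[OF \<mu> zp(1)] integrable_resolvent[OF \<mu> zp(2)] by simp
  also have "\<dots> = (LINT x|\<mu>. (z - z') * (1 / (complex_of_real x - z) * (1 / (complex_of_real x - z'))))"
    using resolvent_nonzero[OF zp(1)] resolvent_nonzero[OF zp(2)]
    by (intro Bochner_Integration.integral_cong refl) (simp add: field_simps)
  also have "cmod \<dots> \<le> cmod (z - z') / b\<^sup>2"
  proof (rule norm_integral_le_const)
    fix x
    have "cmod (1 / (complex_of_real x - z)) \<le> 1 / b" "cmod (1 / (complex_of_real x - z')) \<le> 1 / b"
      using norm_resolvent_le[OF zp(1), of x] norm_resolvent_le[OF zp(2), of x] z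
      by (auto elim!: order_trans intro!: divide_left_mono mult_pos_pos)
    then have "cmod (z - z') * (cmod (1 / (complex_of_real x - z)) * cmod (1 / (complex_of_real x - z'))) \<le> cmod (z - z') * (1 / b * (1 / b))"
      by (intro mult_mono mult_left_mono) (use z in auto)
    moreover have "cmod (z - z') * (1 / b * (1 / b)) = cmod (z - z') / b\<^sup>2" by (simp add: power2_eq_square)
    ultimately show "cmod ((z - z') * (1 / (complex_of_real x - z) * (1 / (complex_of_real x - z')))) \<le> cmod (z - z') / b\<^sup>2"
      by (simp only: norm_mult)
  qed (use z in auto)
  finally show ?thesis .
qed

lemma stieltjes_weak_conv:
  assumes "\<And>n. real_distribution (\<mu>n n)" "real_distribution \<mu>" "weak_conv_m \<mu>n \<mu>" and z: "Im z > 0"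
  shows "(\<lambda>n. stieltjes (\<mu>n n) z) \<longlonglongrightarrow> stieltjes \<mu> z"
  unfolding stieltjes_def
  by (rule weak_conv_imp_integral_bdd_continuous_conv[OF assms(1-3), where B = "1 / Im z"])
     (use resolvent_nonzero[OF z] norm_resolvent_le[OF z] in \<open>auto intro!: continuous_intros\<close>)

lemma stieltjes_has_field_derivative:
  assumes \<mu>: "real_distribution \<mu>" and z: "Im z > 0"
  shows "(stieltjes \<mu> has_field_derivative stieltjes_power \<mu> 2 z) (at z)"
proof -
  interpret real_distribution \<mu> by fact
  \<comment> \<open>Shifts shorter than half the height keep \<open>z + k\<close> above
    \<open>b\<close>, so both resolvents obey the bound \<open>1 / b\<close>.\<close>
  define b where "b = Im z / 2"
  have b: "b > 0" using z by (simp add: b_def)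
  have bound: "cmod ((stieltjes \<mu> (z + k) - stieltjes \<mu> z) / k - stieltjes_power \<mu> 2 z) \<le> cmod k * (1 / b ^ 3)"
    if k: "k \<noteq> 0" "cmod k < b" for k
  proof -
    have zk: "Im (z + k) \<ge> b" using k abs_Im_le_cmod[of k] by (simp add: b_def)
    have zk0: "Im (z + k) > 0" using zk b by simp
    have "(stieltjes \<mu> (z + k) - stieltjes \<mu> z) / k - stieltjes_power \<mu> 2 z =
       (LINT x|\<mu>. (1 / (complex_of_real x - (z + k)) - 1 / (complex_of_real x - z)) / k - (1 / (complex_of_real x - z))\<^sup>2)"
      unfolding stieltjes_def stieltjes_power_def
      using integrable_resolvent[OF \<mu> z] integrable_resolvent[OF \<mu> zk0] integrable_resolvent_power[OF \<mu> z, of 2]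
      by simp
    also have "\<dots> = (LINT x|\<mu>. k * (1 / (complex_of_real x - (z + k)) * (1 / (complex_of_real x - z))\<^sup>2))"
    proof (intro Bochner_Integration.integral_cong refl)
      fix x
      define p where "p = complex_of_real x - z"
      have p: "p \<noteq> 0" "p - k \<noteq> 0"
        using resolvent_nonzero[OF z, of x] resolvent_nonzero[OF zk0, of x] by (auto simp: p_def algebra_simps)
      have "(1 / (p - k) - 1 / p) / k - (1 / p)\<^sup>2 = k * (1 / (p - k) * (1 / p)\<^sup>2)"
        using p k(1) by (simp add: divide_simps power2_eq_square)
      then show "(1 / (complex_of_real x - (z + k)) - 1 / (complex_of_real x - z)) / k - (1 / (complex_of_real x - z))\<^sup>2 =
         k * (1 / (complex_of_real x - (z + k)) * (1 / (complex_of_real x - z))\<^sup>2)"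
        by (simp add: p_def diff_diff_eq)
    qed
    also have "cmod \<dots> \<le> cmod k * (1 / b ^ 3)"
    proof (rule norm_integral_le_const)
      fix x
      have 1: "cmod (1 / (complex_of_real x - (z + k))) \<le> 1 / b"
        by (rule order_trans[OF norm_resolvent_le[OF zk0]]) (use zk b in \<open>auto intro!: divide_left_mono mult_pos_pos\<close>)
      have 2: "cmod (1 / (complex_of_real x - z)) \<le> 1 / b"
        by (rule order_trans[OF norm_resolvent_le[OF z]]) (use z in \<open>simp add: b_def divide_right_mono\<close>)
      have "cmod (k * (1 / (complex_of_real x - (z + k)) * (1 / (complex_of_real x - z))\<^sup>2)) =
         cmod k * (cmod (1 / (complex_of_real x - (z + k))) * (cmod (1 / (complex_of_real x - z)))\<^sup>2)"
        by (simp only: norm_mult norm_power)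
      also have "\<dots> \<le> cmod k * (1 / b * (1 / b)\<^sup>2)"
        using 1 2 b by (intro mult_left_mono mult_mono power_mono) auto
      finally show "cmod (k * (1 / (complex_of_real x - (z + k)) * (1 / (complex_of_real x - z))\<^sup>2)) \<le> cmod k * (1 / b ^ 3)"
        by (simp add: power2_eq_square power3_eq_cube)
    qed (use b in auto)
    finally show ?thesis .
  qed
  have "((\<lambda>k. (stieltjes \<mu> (z + k) - stieltjes \<mu> z) / k - stieltjes_power \<mu> 2 z) \<longlongrightarrow> 0) (at 0)"
  proof (rule Lim_null_comparison)
    show "\<forall>\<^sub>F k in at 0. norm ((stieltjes \<mu> (z + k) - stieltjes \<mu> z) / k - stieltjes_power \<mu> 2 z) \<le> cmod k * (1 / b ^ 3)"
      using bound b by (auto simp: eventually_at dist_norm intro!: exI[of _ b])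
    show "((\<lambda>k. cmod k * (1 / b ^ 3)) \<longlongrightarrow> 0) (at 0)"
      using b by (auto intro!: tendsto_eq_intros)
  qed
  then show ?thesis by (simp add: DERIV_def LIM_zero_iff)
qed

lemma stieltjes_holomorphic:
  assumes "real_distribution \<mu>"
  shows "stieltjes \<mu> holomorphic_on {z. Im z > 0}"
  using stieltjes_has_field_derivative[OF assms]
  by (auto simp: holomorphic_on_def field_differentiable_def intro: has_field_derivative_at_within)

text \<open>The squares of \<open>diag_point v\<close> for \<open>v = v0 + 1 / (k + 1)\<close>. They
  accumulate inside the half plane, at height \<open>2 * v0\<^sup>2\<close>, as the identity theorem
  requires, and are countable, so that null sets may be united over them.\<close>

definition imag_points :: "real \<Rightarrow> complex set" where
  "imag_points v0 = range (\<lambda>k. \<i> * complex_of_real (2 * (v0 + 1 / real (Suc k))\<^sup>2))"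

lemma imag_points_Im_pos:
  assumes "z \<in> imag_points v0" "v0 > 0"
  shows "Im z > 0"
proof -
  obtain k where k: "z = \<i> * complex_of_real (2 * (v0 + 1 / real (Suc k))\<^sup>2)"
    using assms(1) by (auto simp: imag_points_def)
  have "v0 + 1 / real (Suc k) > 0" using assms(2) by (intro add_pos_pos) auto
  then show ?thesis unfolding k Im_i_times Re_complex_of_real by simp
qed

lemma identity_upper_half_plane:
  assumes hol: "f holomorphic_on {z. Im z > 0}" and v0: "v0 > 0"
    and zero: "\<And>z. z \<in> imag_points v0 \<Longrightarrow> f z = 0" and z: "Im z > 0"
  shows "f z = 0"
proof (rule analytic_continuation[OF hol, where U = "imag_points v0" and \<xi> = "\<i> * complex_of_real (2 * v0\<^sup>2)"])
  show "open {z. Im z > 0}" by (rule open_halfspace_Im_gt)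
  show "connected {z. Im z > 0}" by (intro convex_connected convex_halfspace_Im_gt)
  show "imag_points v0 \<subseteq> {z. Im z > 0}"
    using v0 by (auto intro: imag_points_Im_pos)
  show "\<i> * complex_of_real (2 * v0\<^sup>2) \<in> {z. Im z > 0}" using v0 by simp
  define g where "g k = \<i> * complex_of_real (2 * (v0 + 1 / real (Suc k))\<^sup>2)" for k
  have lim: "g \<longlonglongrightarrow> \<i> * complex_of_real (2 * (v0 + 0)\<^sup>2)"
    unfolding g_def by (intro tendsto_intros LIMSEQ_inverse_real_of_nat[unfolded inverse_eq_divide])
  have "g k \<noteq> \<i> * complex_of_real (2 * v0\<^sup>2)" for k
  proof -
    have "v0\<^sup>2 < (v0 + 1 / real (Suc k))\<^sup>2" using v0 by (intro power_strict_mono) auto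
    then show ?thesis by (auto simp: g_def complex_eq_iff)
  qed
  then show "\<i> * complex_of_real (2 * v0\<^sup>2) islimpt imag_points v0"
    unfolding islimpt_sequential using lim
    by (intro exI[of _ g]) (auto simp: imag_points_def g_def)
  show "z \<in> {z. Im z > 0}" using z by simp
qed (use zero in auto)

section \<open>Uniqueness of Stieltjes transforms\<close>

lemma resolvent_power_difference:
  fixes p q :: complex
  assumes "cmod p \<le> B" "cmod q \<le> B"
  shows "cmod (p ^ k - q ^ k) \<le> cmod (p - q) * (real k * B ^ (k - 1))"
proof -
  have B: "B \<ge> 0" using assms(1) norm_ge_zero order_trans by blast
  have "p ^ k - q ^ k = (p - q) * (\<Sum>i<k. p ^ i * q ^ (k - Suc i))" 
    by (subst power_diff_sumr2) (simp add: mult_ac)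
  also have "cmod \<dots> = cmod (p - q) * cmod (\<Sum>i<k. p ^ i * q ^ (k - Suc i))" by (rule norm_mult)
  also have "\<dots> \<le> cmod (p - q) * (\<Sum>i<k. B ^ (k - 1))"
  proof (intro mult_left_mono order_trans[OF norm_sum] sum_mono)
    fix i assume "i \<in> {..<k}"
    then have "k - 1 = i + (k - Suc i)" by auto
    then have "B ^ (k - 1) = B ^ i * B ^ (k - Suc i)" by (metis power_add)
    then show "cmod (p ^ i * q ^ (k - Suc i)) \<le> B ^ (k - 1)"
      using assms B by (auto simp: norm_mult norm_power intro!: mult_mono power_mono)
  qed auto
  finally show ?thesis by simp
qed

text \<open>The derivative along a sequence, to suit dominated convergence. The shifts point
  upwards, so the imaginary part only grows and \<open>1 / Im z\<close> bounds all resolvents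
  involved.\<close>

lemma stieltjes_power_difference_quotient:
  assumes \<mu>: "real_distribution \<mu>" and z: "Im z > 0"
  shows "(\<lambda>n. (stieltjes_power \<mu> k (z + \<i> / of_nat (Suc n)) - stieltjes_power \<mu> k z) / (\<i> / of_nat (Suc n)))
    \<longlonglongrightarrow> of_nat k * stieltjes_power \<mu> (Suc k) z"
proof -
  interpret real_distribution \<mu> by fact
  define e where "e n = \<i> / complex_of_nat (Suc n)" for n
  have e0: "e n \<noteq> 0" for n by (simp add: e_def del: of_nat_Suc)
  have Ime: "Im (e n) > 0" for n
  proof -
    have "e n = \<i> * complex_of_real (1 / real (Suc n))" by (simp add: e_def)
    then have "Im (e n) = 1 / real (Suc n)" by (simp only: Im_i_times Re_complex_of_real)
    then show ?thesis by simp
  qed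
  have zn: "Im (z + e n) > 0" for n using z Ime[of n] by simp
  define p where "p x = 1 / (complex_of_real x - z)" for x
  define pn where "pn n x = 1 / (complex_of_real x - (z + e n))" for n x
  have p_le: "cmod (p x) \<le> 1 / Im z" for x unfolding p_def by (rule norm_resolvent_le[OF z])
  have pn_le: "cmod (pn n x) \<le> 1 / Im z" for n x
    unfolding pn_def
    by (rule order_trans[OF norm_resolvent_le[OF zn]]) (use z Ime[of n] in \<open>auto intro!: divide_left_mono mult_pos_pos add_pos_pos\<close>)
  have diff: "pn n x - p x = e n * (pn n x * p x)" for n x
    using resolvent_nonzero[OF z, of x] resolvent_nonzero[OF zn, of x n]
    by (simp add: pn_def p_def divide_simps)
  have e_lim: "e \<longlonglongrightarrow> 0"
  proof -
    have "(\<lambda>n. \<i> * complex_of_real (1 / real (Suc n))) \<longlonglongrightarrow> \<i> * complex_of_real 0"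
      by (intro tendsto_intros LIMSEQ_inverse_real_of_nat[unfolded inverse_eq_divide])
    then show ?thesis by (simp add: e_def[abs_def])
  qed
  have pn_lim: "(\<lambda>n. pn n x) \<longlonglongrightarrow> p x" for x
  proof -
    have "(\<lambda>n. 1 / (complex_of_real x - (z + e n))) \<longlonglongrightarrow> 1 / (complex_of_real x - (z + 0))"
      by (intro tendsto_intros e_lim) (use resolvent_nonzero[OF z] in auto)
    then show ?thesis by (simp add: pn_def p_def)
  qed
  have quot: "(pn n x ^ k - p x ^ k) / e n = pn n x * p x * (\<Sum>i<k. pn n x ^ i * p x ^ (k - Suc i))" for n x
  proof -
    have "pn n x ^ k - p x ^ k = (pn n x - p x) * (\<Sum>i<k. pn n x ^ i * p x ^ (k - Suc i))"
      by (subst power_diff_sumr2) (simp add: mult_ac)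
    then show ?thesis unfolding diff using e0[of n] by simp
  qed
  define C where "C = 1 / Im z * (1 / Im z) * (real k * (1 / Im z) ^ (k - 1))"
  have lim: "(\<lambda>n. LINT x|\<mu>. (pn n x ^ k - p x ^ k) / e n) \<longlonglongrightarrow> (LINT x|\<mu>. of_nat k * p x ^ Suc k)"
  proof (rule integral_dominated_convergence[where w = "\<lambda>_. C"])
    show "(\<lambda>x. of_nat k * p x ^ Suc k) \<in> borel_measurable \<mu>" unfolding p_def by measurable
    show "(\<lambda>x. (pn n x ^ k - p x ^ k) / e n) \<in> borel_measurable \<mu>" for n unfolding p_def pn_def by measurable
    show "AE x in \<mu>. (\<lambda>n. (pn n x ^ k - p x ^ k) / e n) \<longlonglongrightarrow> of_nat k * p x ^ Suc k"
    proof (rule AE_I2)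
      fix x
      have "(\<lambda>n. pn n x * p x * (\<Sum>i<k. pn n x ^ i * p x ^ (k - Suc i))) \<longlonglongrightarrow>
          p x * p x * (\<Sum>i<k. p x ^ i * p x ^ (k - Suc i))"
        by (intro tendsto_intros pn_lim)
      also have "(\<Sum>i<k. p x ^ i * p x ^ (k - Suc i)) = (\<Sum>i<k. p x ^ (k - 1))"
        by (intro sum.cong refl) (simp flip: power_add)
      also have "p x * p x * (\<Sum>i<k. p x ^ (k - 1)) = of_nat k * p x ^ Suc k"
        by (cases k) (simp_all add: algebra_simps)
      finally show "(\<lambda>n. (pn n x ^ k - p x ^ k) / e n) \<longlonglongrightarrow> of_nat k * p x ^ Suc k"
        unfolding quot .
    qed
    show "AE x in \<mu>. norm ((pn n x ^ k - p x ^ k) / e n) \<le> C" for n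
    proof (rule AE_I2)
      fix x
      have "cmod (pn n x ^ k - p x ^ k) \<le> cmod (pn n x - p x) * (real k * (1 / Im z) ^ (k - 1))"
        by (rule resolvent_power_difference[OF pn_le p_le])
      also have "\<dots> = cmod (e n) * (cmod (pn n x) * cmod (p x) * (real k * (1 / Im z) ^ (k - 1)))"
        unfolding diff norm_mult by (simp only: mult.assoc)
      also have "\<dots> \<le> cmod (e n) * C"
        unfolding C_def using z by (intro mult_left_mono mult_right_mono mult_mono pn_le p_le) auto
      finally show "norm ((pn n x ^ k - p x ^ k) / e n) \<le> C"
        using e0[of n] by (simp add: norm_divide pos_divide_le_eq mult.commute)
    qed
  qed simp
  have quotient: "(LINT x|\<mu>. (pn n x ^ k - p x ^ k) / e n) = (stieltjes_power \<mu> k (z + e n) - stieltjes_power \<mu> k z) / e n" for n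
    unfolding stieltjes_power_def pn_def p_def
    using integrable_resolvent_power[OF \<mu> z, of k] integrable_resolvent_power[OF \<mu> zn[of n], of k] by simp
  have limit: "(LINT x|\<mu>. of_nat k * p x ^ Suc k) = of_nat k * stieltjes_power \<mu> (Suc k) z"
    unfolding stieltjes_power_def p_def by (rule integral_mult_right_zero)
  show ?thesis using lim unfolding quotient limit unfolding e_def .
qed

text \<open>Difference quotients pass the equality on to derivatives, hence to all powers of the resolvent.\<close>

lemma stieltjes_power_eq:
  assumes \<mu>: "real_distribution \<mu>" and \<nu>: "real_distribution \<nu>"
    and eq: "\<And>z. Im z > 0 \<Longrightarrow> stieltjes \<mu> z = stieltjes \<nu> z"
  shows "Im z > 0 \<Longrightarrow> stieltjes_power \<mu> (Suc k) z = stieltjes_power \<nu> (Suc k) z"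
proof (induction k arbitrary: z)
  case 0
  then show ?case using eq stieltjes_power_1 by simp
next
  case (Suc k)
  have Ime: "Im (z + \<i> / of_nat (Suc n)) > 0" for n
  proof -
    have "Im (\<i> / complex_of_nat (Suc n)) = 1 / real (Suc n)"
      by (metis Im_divide_of_nat imaginary_unit.sel(2))
    moreover have "1 / real (Suc n) > 0" by simp
    ultimately show ?thesis using Suc.prems by (simp only: plus_complex.sel)
  qed
  have "of_nat (Suc k) * stieltjes_power \<mu> (Suc (Suc k)) z = of_nat (Suc k) * stieltjes_power \<nu> (Suc (Suc k)) z"
  proof (rule LIMSEQ_unique)
    show "(\<lambda>n. (stieltjes_power \<mu> (Suc k) (z + \<i> / of_nat (Suc n)) - stieltjes_power \<mu> (Suc k) z) / (\<i> / of_nat (Suc n)))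
      \<longlonglongrightarrow> of_nat (Suc k) * stieltjes_power \<mu> (Suc (Suc k)) z"
      by (rule stieltjes_power_difference_quotient[OF \<mu> Suc.prems])
    show "(\<lambda>n. (stieltjes_power \<mu> (Suc k) (z + \<i> / of_nat (Suc n)) - stieltjes_power \<mu> (Suc k) z) / (\<i> / of_nat (Suc n)))
      \<longlonglongrightarrow> of_nat (Suc k) * stieltjes_power \<nu> (Suc (Suc k)) z"
      unfolding Suc.IH[OF Ime] Suc.IH[OF Suc.prems]
      by (rule stieltjes_power_difference_quotient[OF \<nu> Suc.prems])
  qed
  then show ?case by (simp del: of_nat_Suc)
qed

text \<open>With \<open>s = y / (n + 1)\<close>, both the base \<open>p\<close> and
  \<open>iexp s\<close> lie in the closed unit disc and are within \<open>s\<^sup>2\<close> of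
  \<open>1 + \<i> s\<close>. Raising to the power \<open>n + 1\<close> multiplies the difference by
  at most \<open>n + 1\<close>, which leaves an error of order \<open>1 / (n + 1)\<close>.\<close>

lemma exp_limit_resolvent_power:
  fixes y :: real
  shows "(\<lambda>n. (1 / (1 - \<i> * complex_of_real (y / real (Suc n)))) ^ Suc n) \<longlonglongrightarrow> iexp y"
proof -
  have bound: "cmod ((1 / (1 - \<i> * complex_of_real (y / real (Suc n)))) ^ Suc n - iexp y) \<le> 2 * y\<^sup>2 / real (Suc n)" for n
  proof -
    define s where "s = y / real (Suc n)"
    define p where "p = 1 / (1 - \<i> * complex_of_real s)"
    have ge1: "cmod (1 - \<i> * complex_of_real s) \<ge> 1"
      using abs_Re_le_cmod[of "1 - \<i> * complex_of_real s"] by simp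
    then have nz: "1 - \<i> * complex_of_real s \<noteq> 0" by (metis norm_zero not_one_le_zero)
    have p1: "cmod p \<le> 1" unfolding p_def using ge1 by (simp add: norm_divide divide_simps)
    have "cmod (p - (1 + \<i> * complex_of_real s)) \<le> s\<^sup>2"
    proof -
      have "p - (1 + \<i> * complex_of_real s) = - (p * complex_of_real (s\<^sup>2))"
        unfolding p_def using nz by (simp add: divide_simps) (simp add: algebra_simps power2_eq_square)
      then have "cmod (p - (1 + \<i> * complex_of_real s)) = cmod p * s\<^sup>2"
        by (simp only: norm_minus_cancel norm_mult norm_of_real abs_power2)
      also have "\<dots> \<le> 1 * s\<^sup>2" using p1 by (intro mult_right_mono) auto
      finally show ?thesis by simp
    qed
    moreover have "cmod (iexp s - (1 + \<i> * complex_of_real s)) \<le> s\<^sup>2"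
    proof -
      have "cmod (iexp s - (1 + \<i> * complex_of_real s)) \<le> s\<^sup>2 / 2"
        using iexp_approx1[of s 1] by (simp add: power2_eq_square)
      also have "\<dots> \<le> s\<^sup>2" by simp
      finally show ?thesis .
    qed
    ultimately have d: "cmod (p - iexp s) \<le> 2 * s\<^sup>2"
      using norm_triangle_ineq4[of "p - (1 + \<i> * complex_of_real s)" "iexp s - (1 + \<i> * complex_of_real s)"] by simp
    have "iexp y = iexp s ^ Suc n"
      unfolding exp_of_nat_mult[symmetric] by (simp add: s_def del: of_nat_Suc)
    then have "cmod (p ^ Suc n - iexp y) = cmod (p ^ Suc n - iexp s ^ Suc n)" by simp
    also have "\<dots> \<le> real (Suc n) * cmod (p - iexp s)" by (rule norm_power_diff[OF p1]) simp
    also have "\<dots> \<le> real (Suc n) * (2 * s\<^sup>2)" using d by (rule mult_left_mono) simp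
    also have "\<dots> = 2 * y\<^sup>2 / real (Suc n)" by (simp add: s_def power2_eq_square field_simps del: of_nat_Suc)
    finally show ?thesis by (simp only: p_def s_def)
  qed
  have lim0: "(\<lambda>n. 2 * y\<^sup>2 / real (Suc n)) \<longlonglongrightarrow> 0"
    using tendsto_mult_right[OF LIMSEQ_inverse_real_of_nat, of "2 * y\<^sup>2"] by (simp add: inverse_eq_divide)
  show ?thesis
    by (rule LIM_zero_cancel[OF Lim_null_comparison[OF _ lim0]]) (intro always_eventually allI bound)
qed

text \<open>
  Powers of the resolvent determine the characteristic function through
  \<open>exp (i y) = lim (1 - i y / n)\<^sup>-\<^sup>n\<close>.
\<close>

lemma char_eq_limit:
  assumes \<mu>: "real_distribution \<mu>"
  shows "(\<lambda>n. LINT x|\<mu>. (1 / (1 - \<i> * complex_of_real (t * x / real (Suc n)))) ^ Suc n) \<longlonglongrightarrow> char \<mu> t"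
proof -
  interpret real_distribution \<mu> by fact
  show ?thesis unfolding char_def
  proof (rule integral_dominated_convergence[where w = "\<lambda>_. 1"])
    show "AE x in \<mu>. norm ((1 / (1 - \<i> * complex_of_real (t * x / real (Suc n)))) ^ Suc n) \<le> 1" for n
    proof (rule AE_I2)
      fix x
      have "cmod (1 - \<i> * complex_of_real (t * x / real (Suc n))) \<ge> 1"
        using abs_Re_le_cmod[of "1 - \<i> * complex_of_real (t * x / real (Suc n))"] by simp
      then have "cmod (1 / (1 - \<i> * complex_of_real (t * x / real (Suc n)))) \<le> 1"
        by (simp add: norm_divide divide_simps)
      then show "norm ((1 / (1 - \<i> * complex_of_real (t * x / real (Suc n)))) ^ Suc n) \<le> 1"
        unfolding norm_power by (rule power_le_one[OF norm_ge_zero])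
    qed
    show "AE x in \<mu>. (\<lambda>n. (1 / (1 - \<i> * complex_of_real (t * x / real (Suc n)))) ^ Suc n) \<longlonglongrightarrow> iexp (t * x)"
      by (intro AE_I2 exp_limit_resolvent_power)
  qed (simp, measurable)
qed

lemma stieltjes_unique:
  assumes \<mu>: "real_distribution \<mu>" and \<nu>: "real_distribution \<nu>"
    and eq: "\<And>z. Im z > 0 \<Longrightarrow> stieltjes \<mu> z = stieltjes \<nu> z"
  shows "\<mu> = \<nu>"
proof (rule Levy_uniqueness[OF \<mu> \<nu>], rule ext)
  \<comment> \<open>The base is a multiple of the resolvent at \<open>- \<i> (n + 1) / t\<close>, a
    point of the upper half plane exactly when \<open>t\<close> is negative.\<close>
  have neg: "char \<mu> t = char \<nu> t" if t: "t < 0" for t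
  proof -
    have rep: "(LINT x|\<mu>. (1 / (1 - \<i> * complex_of_real (t * x / real (Suc n)))) ^ Suc n) =
        (\<i> * complex_of_real (real (Suc n) / t)) ^ Suc n * stieltjes_power \<mu> (Suc n) (- \<i> * complex_of_real (real (Suc n) / t))" for n and \<mu> :: "real measure"
    proof -
      have "1 / (1 - \<i> * complex_of_real (t * x / real (Suc n))) =
        (\<i> * complex_of_real (real (Suc n) / t)) * (1 / (complex_of_real x - - \<i> * complex_of_real (real (Suc n) / t)))" for x
      proof -
        have gen: "1 / D = c * (1 / F)" if "c * D = F" "D \<noteq> 0" "F \<noteq> 0" for c D F :: complex
          using that by (auto simp: divide_simps)
        define m where "m = complex_of_real (real (Suc n))"
        define T where "T = complex_of_real t"
        have m: "m \<noteq> 0" "T \<noteq> 0" using t by (simp_all add: m_def T_def del: of_nat_Suc)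
        have nz: "complex_of_real x + \<i> * (m / T) \<noteq> 0"
          using t by (simp add: complex_eq_iff m_def T_def del: of_nat_Suc flip: of_real_divide)
        have nz2: "1 - \<i> * (T * complex_of_real x / m) \<noteq> 0"
          by (simp add: complex_eq_iff m_def T_def del: of_nat_Suc flip: of_real_divide of_real_mult)
        have "(\<i> * (m / T)) * (1 - \<i> * (T * complex_of_real x / m)) = complex_of_real x + \<i> * (m / T)"
          using m by (simp add: field_simps)
        then have "1 / (1 - \<i> * (T * complex_of_real x / m)) = \<i> * (m / T) * (1 / (complex_of_real x + \<i> * (m / T)))"
          using nz nz2 gen by blast
        then show ?thesis by (simp add: m_def T_def del: of_nat_Suc)
      qed
      then show ?thesis unfolding stieltjes_power_def by (simp only: power_mult_distrib integral_mult_right_zero)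
    qed
    have pos: "Im (- \<i> * complex_of_real (real (Suc n) / t)) > 0" for n
      using t by (simp add: divide_pos_neg del: of_nat_Suc)
    have pe: "stieltjes_power \<mu> (Suc k) z = stieltjes_power \<nu> (Suc k) z" if "Im z > 0" for k z
      by (rule stieltjes_power_eq[OF \<mu> \<nu> _ that]) (rule eq)
    have same: "(LINT x|\<mu>. (1 / (1 - \<i> * complex_of_real (t * x / real (Suc n)))) ^ Suc n) =
        (LINT x|\<nu>. (1 / (1 - \<i> * complex_of_real (t * x / real (Suc n)))) ^ Suc n)" for n
      unfolding rep pe[OF pos] by (rule refl)
    show ?thesis
      by (rule LIMSEQ_unique[OF char_eq_limit[OF \<mu>, of t, unfolded same] char_eq_limit[OF \<nu>, of t]])
  qed
  \<comment> \<open>Positive arguments follow from negative ones by conjugation.\<close>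
  have conj: "char \<mu> t = cnj (char \<mu> (- t))" for t and \<mu> :: "real measure"
    unfolding char_def Bochner_Integration.integral_cnj[symmetric] by (simp add: exp_cnj)
  show "char \<mu> t = char \<nu> t" for t
  proof (cases "t < 0")
    case False
    show ?thesis
    proof (cases "t = 0")
      case True
      then show ?thesis using real_distribution.char_zero[OF \<mu>] real_distribution.char_zero[OF \<nu>] by simp
    next
      case nz: False
      then show ?thesis unfolding conj[of _ t] using neg[of "- t"] False by simp
    qed
  qed (rule neg)
qed

lemma stieltjes_unique_imag_points:
  assumes \<mu>: "real_distribution \<mu>" and \<nu>: "real_distribution \<nu>" and v0: "v0 > 0"
    and eq: "\<And>z. z \<in> imag_points v0 \<Longrightarrow> stieltjes \<mu> z = stieltjes \<nu> z"
  shows "\<mu> = \<nu>"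
proof (rule stieltjes_unique[OF \<mu> \<nu>])
  fix z :: complex assume z: "Im z > 0"
  have "(\<lambda>z. stieltjes \<mu> z - stieltjes \<nu> z) holomorphic_on {z. Im z > 0}"
    by (intro holomorphic_on_diff stieltjes_holomorphic \<mu> \<nu>)
  from identity_upper_half_plane[OF this v0 _ z] show "stieltjes \<mu> z = stieltjes \<nu> z" using eq by simp
qed

section \<open>Tightness and convergence from Stieltjes transforms\<close>

text \<open>At \<open>z = \<i> y\<close> the real part of \<open>1 + z / (x - z)\<close> is
  \<open>x\<^sup>2 / (x\<^sup>2 + y\<^sup>2)\<close>, nonnegative everywhere and at least 1/2 for
  \<open>\<bar>x\<bar> \<ge> y\<close>; so twice its mean dominates the mass of the tail. The
  interval is half-open to match the form of \<open>tight\<close>.\<close>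

lemma (in real_distribution) tail_le_stieltjes:
  assumes y: "y > 0"
  shows "1 - measure M {- y - 1<..y} \<le> 2 * cmod (\<i> * complex_of_real y * stieltjes M (\<i> * complex_of_real y) + 1)"
proof -
  define z where "z = \<i> * complex_of_real y"
  have z: "Im z > 0" using y by (simp add: z_def)
  define g where "g x = 1 + z * (1 / (complex_of_real x - z))" for x
  have ir: "integrable M (\<lambda>x. z * (1 / (complex_of_real x - z)))"
    by (intro integrable_mult_right integrable_resolvent[OF real_distribution_axioms z])
  have ig: "integrable M g"
    unfolding g_def by (intro Bochner_Integration.integrable_add ir) simp
  have Re_g: "Re (g x) = x\<^sup>2 / (x\<^sup>2 + y\<^sup>2)" for x
  proof -
    have nz: "complex_of_real x - z \<noteq> 0" by (rule resolvent_nonzero[OF z])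
    have pos: "x\<^sup>2 + y\<^sup>2 > 0" using y by (simp add: add_nonneg_pos)
    have "g x = complex_of_real x / (complex_of_real x - z)" using nz by (simp add: g_def field_simps)
    then show ?thesis using pos by (simp add: Re_divide z_def power2_eq_square)
  qed
  have "indicator (- {- y - 1<..y}) x \<le> 2 * Re (g x)" for x
  proof (cases "x \<in> {- y - 1<..y}")
    case False
    then have "y \<le> \<bar>x\<bar>" using y by auto
    then have "y\<^sup>2 \<le> x\<^sup>2" using y by (metis abs_le_square_iff abs_of_pos)
    moreover have "x\<^sup>2 + y\<^sup>2 > 0" using y by (simp add: add_nonneg_pos)
    ultimately show ?thesis using False unfolding Re_g by (simp add: field_simps)
  next
    case True
    then show ?thesis unfolding Re_g by simp
  qed
  then have "(\<integral>x. indicator (- {- y - 1<..y}) x \<partial>M) \<le> (\<integral>x. 2 * Re (g x) \<partial>M)"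
    using ig by (intro integral_mono) (auto simp: integrable_indicator_iff emeasure_eq_measure)
  also have "\<dots> = 2 * Re (\<integral>x. g x \<partial>M)" using ig by simp
  also have "(\<integral>x. g x \<partial>M) = 1 + z * stieltjes M z"
    unfolding g_def stieltjes_def integral_mult_right_zero[symmetric]
    by (subst Bochner_Integration.integral_add[OF _ ir]) (simp_all add: prob_space del: space_eq_univ)
  also have "2 * Re (1 + z * stieltjes M z) \<le> 2 * cmod (z * stieltjes M z + 1)"
    using complex_Re_le_cmod[of "z * stieltjes M z + 1"] by simp
  also have "(\<integral>x. indicator (- {- y - 1<..y}) x \<partial>M) = 1 - measure M {- y - 1<..y}"
    using prob_compl[of "{- y - 1<..y}"] by (simp add: Compl_eq_Diff_UNIV)
  finally show ?thesis by (simp add: z_def)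
qed

lemma (in real_distribution) exists_interval_mass:
  assumes "\<epsilon> > 0"
  shows "\<exists>T>0. \<forall>T'\<ge>T. measure M {- T'<..T'} > 1 - \<epsilon>"
proof -
  have "\<forall>\<^sub>F x in at_top. cdf M x > 1 - \<epsilon> / 2"
    using cdf_lim_at_top_prob assms by (intro order_tendstoD(1)) auto
  then obtain b where b: "\<And>x. x \<ge> b \<Longrightarrow> cdf M x > 1 - \<epsilon> / 2" by (auto simp: eventually_at_top_linorder)
  have "\<forall>\<^sub>F x in at_bot. cdf M x < \<epsilon> / 2"
    using cdf_lim_at_bot assms by (intro order_tendstoD(2)) auto
  then obtain a where a: "\<And>x. x \<le> a \<Longrightarrow> cdf M x < \<epsilon> / 2" by (auto simp: eventually_at_bot_linorder)
  show ?thesis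
  proof (intro exI[of _ "max 1 (max b (- a))"] conjI allI impI)
    fix T' assume T': "max 1 (max b (- a)) \<le> T'"
    then have "cdf M T' - cdf M (- T') > 1 - \<epsilon>" using b[of T'] a[of "- T'"] by simp
    moreover have "cdf M T' - cdf M (- T') = measure M {- T'<..T'}" using T' by (intro cdf_diff_eq) auto
    ultimately show "measure M {- T'<..T'} > 1 - \<epsilon>" by simp
  qed auto
qed

text \<open>One sufficiently high point makes the tails small for all but finitely many
  \<open>n\<close>. The remaining measures have intervals of their own, and \<open>S\<close> covers
  all of them.\<close>

lemma tight_of_stieltjes:
  fixes \<nu> :: "nat \<Rightarrow> real measure" and y :: "nat \<Rightarrow> real"
  assumes \<nu>: "\<And>n. real_distribution (\<nu> n)" and y: "\<And>m. y m > 0"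
    and lim: "\<And>m. (\<lambda>n. stieltjes (\<nu> n) (\<i> * complex_of_real (y m))) \<longlonglongrightarrow> l m"
    and l: "(\<lambda>m. \<i> * complex_of_real (y m) * l m) \<longlonglongrightarrow> - 1"
  shows "tight \<nu>"
  unfolding tight_def
proof (intro conjI allI impI \<nu>)
  fix \<epsilon> :: real assume \<epsilon>: "\<epsilon> > 0"
  have "(\<lambda>m. cmod (\<i> * complex_of_real (y m) * l m + 1)) \<longlonglongrightarrow> cmod (- 1 + 1)"
    by (intro tendsto_intros l)
  then have "\<forall>\<^sub>F m in sequentially. cmod (\<i> * complex_of_real (y m) * l m + 1) < \<epsilon> / 2"
    using \<epsilon> by (intro order_tendstoD(2)) auto
  then obtain m where m: "cmod (\<i> * complex_of_real (y m) * l m + 1) < \<epsilon> / 2"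
    by (auto simp: eventually_sequentially)
  have "(\<lambda>n. cmod (\<i> * complex_of_real (y m) * stieltjes (\<nu> n) (\<i> * complex_of_real (y m)) + 1))
     \<longlonglongrightarrow> cmod (\<i> * complex_of_real (y m) * l m + 1)"
    by (intro tendsto_intros lim)
  then have "\<forall>\<^sub>F n in sequentially. cmod (\<i> * complex_of_real (y m) * stieltjes (\<nu> n) (\<i> * complex_of_real (y m)) + 1) < \<epsilon> / 2"
    using m by (intro order_tendstoD(2)) auto
  then obtain n0 where n0: "\<And>n. n \<ge> n0 \<Longrightarrow>
      cmod (\<i> * complex_of_real (y m) * stieltjes (\<nu> n) (\<i> * complex_of_real (y m)) + 1) < \<epsilon> / 2"
    by (auto simp: eventually_sequentially)
  have "\<forall>n. \<exists>T>0. \<forall>T'\<ge>T. measure (\<nu> n) {- T'<..T'} > 1 - \<epsilon>"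
    using real_distribution.exists_interval_mass[OF \<nu> \<epsilon>] by blast
  then obtain T where T: "\<And>n. T n > 0" "\<And>n T'. T' \<ge> T n \<Longrightarrow> measure (\<nu> n) {- T'<..T'} > 1 - \<epsilon>" by metis
  define S where "S = Max (insert (y m + 1) (T ` {..<n0}))"
  have S: "S \<ge> y m + 1" "\<And>n. n < n0 \<Longrightarrow> S \<ge> T n" unfolding S_def by (auto intro: Max_ge)
  show "\<exists>a b. a < b \<and> (\<forall>n. 1 - \<epsilon> < measure (\<nu> n) {a<..b})"
  proof (rule exI[of _ "- S"], rule exI[of _ S], intro conjI allI)
    show "- S < S" using S(1) y[of m] by simp
    fix n
    show "1 - \<epsilon> < measure (\<nu> n) {- S<..S}"
    proof (cases "n < n0")
      case True
      then show ?thesis using T(2) S(2) by blast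
    next
      case False
      interpret real_distribution "\<nu> n" by (rule \<nu>)
      have "1 - \<epsilon> < measure (\<nu> n) {- y m - 1<..y m}"
        using tail_le_stieltjes[OF y[of m]] n0[of n] False by simp
      also have "\<dots> \<le> measure (\<nu> n) {- S<..S}"
        using S(1) by (intro finite_measure_mono) auto
      finally show ?thesis .
    qed
  qed
qed

text \<open>The limits \<open>l\<close> are not known in advance to come from a measure; a weakly
  convergent subsequence supplies one.\<close>

lemma tight_stieltjes_limit_exists:
  assumes t: "tight \<nu>" and S: "\<And>z. z \<in> S \<Longrightarrow> Im z > 0"
    and lim: "\<And>z. z \<in> S \<Longrightarrow> (\<lambda>n. stieltjes (\<nu> n) z) \<longlonglongrightarrow> l z"
  shows "\<exists>\<mu>. real_distribution \<mu> \<and> (\<forall>z\<in>S. stieltjes \<mu> z = l z)"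
proof -
  have \<nu>: "real_distribution (\<nu> n)" for n using t by (simp add: tight_def)
  obtain r \<mu> where r: "strict_mono (r :: nat \<Rightarrow> nat)" "real_distribution \<mu>" "weak_conv_m (\<nu> \<circ> id \<circ> r) \<mu>"
    using tight_imp_convergent_subsubsequence[OF t strict_mono_id] by blast
  have "stieltjes \<mu> z = l z" if z: "z \<in> S" for z
  proof (rule LIMSEQ_unique)
    show "(\<lambda>n. stieltjes ((\<nu> \<circ> id \<circ> r) n) z) \<longlonglongrightarrow> stieltjes \<mu> z"
      by (rule stieltjes_weak_conv[OF _ r(2,3) S[OF z]]) (simp add: \<nu>)
    show "(\<lambda>n. stieltjes ((\<nu> \<circ> id \<circ> r) n) z) \<longlonglongrightarrow> l z"
      using LIMSEQ_subseq_LIMSEQ[OF lim[OF z] r(1)] by (simp add: o_def)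
  qed
  then show ?thesis using r(2) by blast
qed

text \<open>Every subsequential limit has the Stieltjes transform of \<open>\<mu>\<close> on
  \<open>imag_points v0\<close>, hence equals \<open>\<mu>\<close>.\<close>

lemma weak_conv_of_stieltjes:
  assumes t: "tight \<nu>" and \<mu>: "real_distribution \<mu>" and v0: "v0 > 0"
    and lim: "\<And>z. z \<in> imag_points v0 \<Longrightarrow> (\<lambda>n. stieltjes (\<nu> n) z) \<longlonglongrightarrow> stieltjes \<mu> z"
  shows "weak_conv_m \<nu> \<mu>"
proof (rule tight_subseq_weak_converge[OF _ \<mu> t])
  show \<nu>: "real_distribution (\<nu> n)" for n using t by (simp add: tight_def)
  fix s :: "nat \<Rightarrow> nat" and \<rho> assume s: "strict_mono s" and \<rho>: "real_distribution \<rho>" and c: "weak_conv_m (\<nu> \<circ> s) \<rho>"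
  have "stieltjes \<rho> z = stieltjes \<mu> z" if z: "z \<in> imag_points v0" for z
  proof (rule LIMSEQ_unique)
    show "(\<lambda>n. stieltjes ((\<nu> \<circ> s) n) z) \<longlonglongrightarrow> stieltjes \<rho> z"
      by (rule stieltjes_weak_conv[OF _ \<rho> c imag_points_Im_pos[OF z v0]]) (simp add: \<nu>)
    show "(\<lambda>n. stieltjes ((\<nu> \<circ> s) n) z) \<longlonglongrightarrow> stieltjes \<mu> z"
      using LIMSEQ_subseq_LIMSEQ[OF lim[OF z] s] by (simp add: o_def)
  qed
  then have "\<rho> = \<mu>" by (rule stieltjes_unique_imag_points[OF \<rho> \<mu> v0])
  then show "weak_conv_m (\<nu> \<circ> s) \<mu>" using c by simp
qed

text \<open>Pointwise \<open>\<zeta> / (x - \<zeta>)\<close> tends to -1. The cone condition bounds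
  it by \<open>C\<close>, which permits dominated convergence without any moment of
  \<open>\<mu>\<close>.\<close>

lemma stieltjes_asymptotic:
  assumes \<mu>: "real_distribution \<mu>" and pos: "\<And>n. Im (\<zeta> n) > 0"
    and cone: "\<And>n. cmod (\<zeta> n) \<le> C * Im (\<zeta> n)" and inf: "filterlim (\<lambda>n. Im (\<zeta> n)) at_top sequentially"
  shows "(\<lambda>n. \<zeta> n * stieltjes \<mu> (\<zeta> n)) \<longlonglongrightarrow> - 1"
proof -
  interpret real_distribution \<mu> by fact
  have "(\<lambda>n. \<integral>x. \<zeta> n * (1 / (complex_of_real x - \<zeta> n)) \<partial>\<mu>) \<longlonglongrightarrow> (\<integral>x. - 1 \<partial>\<mu>)"
  proof (rule integral_dominated_convergence[where w = "\<lambda>_. C"])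
    show "AE x in \<mu>. norm (\<zeta> n * (1 / (complex_of_real x - \<zeta> n))) \<le> C" for n
    proof (rule AE_I2)
      fix x
      have "norm (\<zeta> n * (1 / (complex_of_real x - \<zeta> n))) \<le> (C * Im (\<zeta> n)) * (1 / Im (\<zeta> n))"
        unfolding norm_mult using norm_resolvent_le[OF pos[of n], of x] cone[of n] pos[of n]
        by (intro mult_mono) (auto intro: order_trans[OF norm_ge_zero])
      then show "norm (\<zeta> n * (1 / (complex_of_real x - \<zeta> n))) \<le> C" using pos[of n] by simp
    qed
    show "AE x in \<mu>. (\<lambda>n. \<zeta> n * (1 / (complex_of_real x - \<zeta> n))) \<longlonglongrightarrow> - 1"
    proof (rule AE_I2)
      fix x
      have eq: "\<zeta> n * (1 / (complex_of_real x - \<zeta> n)) = - 1 + complex_of_real x * (1 / (complex_of_real x - \<zeta> n))" for n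
        using resolvent_nonzero[OF pos[of n], of x] by (simp add: field_simps)
      have "(\<lambda>n. complex_of_real x * (1 / (complex_of_real x - \<zeta> n))) \<longlonglongrightarrow> 0"
      proof (rule Lim_null_comparison)
        show "\<forall>\<^sub>F n in sequentially. norm (complex_of_real x * (1 / (complex_of_real x - \<zeta> n))) \<le> \<bar>x\<bar> * inverse (Im (\<zeta> n))"
        proof (intro always_eventually allI)
          fix n
          show "norm (complex_of_real x * (1 / (complex_of_real x - \<zeta> n))) \<le> \<bar>x\<bar> * inverse (Im (\<zeta> n))"
            unfolding norm_mult norm_of_real using norm_resolvent_le[OF pos[of n], of x]
            by (intro mult_left_mono) (auto simp: inverse_eq_divide)
        qed
        show "(\<lambda>n. \<bar>x\<bar> * inverse (Im (\<zeta> n))) \<longlonglongrightarrow> 0"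
          using tendsto_mult_left[OF tendsto_inverse_0_at_top[OF inf], of "\<bar>x\<bar>"] by simp
      qed
      then have "(\<lambda>n. - 1 + complex_of_real x * (1 / (complex_of_real x - \<zeta> n))) \<longlonglongrightarrow> - 1 + 0"
        by (intro tendsto_intros)
      then show "(\<lambda>n. \<zeta> n * (1 / (complex_of_real x - \<zeta> n))) \<longlonglongrightarrow> - 1" unfolding eq by simp
    qed
  qed (simp, measurable)
  moreover have "(\<integral>x. \<zeta> n * (1 / (complex_of_real x - \<zeta> n)) \<partial>\<mu>) = \<zeta> n * stieltjes \<mu> (\<zeta> n)" for n
    unfolding stieltjes_def by (rule integral_mult_right_zero)
  moreover have "(\<integral>x. - 1 \<partial>\<mu>) = (- 1 :: complex)" by (simp add: prob_space del: space_eq_univ)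
  ultimately show ?thesis by simp
qed

text \<open>On the half plane above \<open>b\<close> all Stieltjes transforms share the Lipschitz
  constant \<open>1 / b\<^sup>2\<close>, so the moving point may be frozen at its limit.\<close>

lemma stieltjes_weak_conv_moving:
  assumes \<mu>n: "\<And>n. real_distribution (\<mu>n n)" and \<mu>: "real_distribution \<mu>" and wc: "weak_conv_m \<mu>n \<mu>"
    and \<zeta>: "\<zeta>n \<longlonglongrightarrow> \<zeta>" and pos: "Im \<zeta> > 0"
  shows "(\<lambda>n. stieltjes (\<mu>n n) (\<zeta>n n)) \<longlonglongrightarrow> stieltjes \<mu> \<zeta>"
proof -
  define b where "b = Im \<zeta> / 2"
  have b: "b > 0" using pos by (simp add: b_def)
  have "(\<lambda>n. Im (\<zeta>n n)) \<longlonglongrightarrow> Im \<zeta>" by (intro tendsto_intros \<zeta>)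
  then have ev: "\<forall>\<^sub>F n in sequentially. Im (\<zeta>n n) > b" using pos by (intro order_tendstoD(1)) (auto simp: b_def)
  have "(\<lambda>n. stieltjes (\<mu>n n) (\<zeta>n n) - stieltjes (\<mu>n n) \<zeta>) \<longlonglongrightarrow> 0"
  proof (rule Lim_null_comparison)
    show "\<forall>\<^sub>F n in sequentially. norm (stieltjes (\<mu>n n) (\<zeta>n n) - stieltjes (\<mu>n n) \<zeta>) \<le> cmod (\<zeta>n n - \<zeta>) / b\<^sup>2"
      using ev by eventually_elim (rule stieltjes_lipschitz[OF \<mu>n _ _ b], use pos b in \<open>auto simp: b_def\<close>)
    have "(\<lambda>n. cmod (\<zeta>n n - \<zeta>) / b\<^sup>2) \<longlonglongrightarrow> cmod (\<zeta> - \<zeta>) / b\<^sup>2"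
      by (intro tendsto_intros \<zeta>) (use b in auto)
    then show "(\<lambda>n. cmod (\<zeta>n n - \<zeta>) / b\<^sup>2) \<longlonglongrightarrow> 0" by simp
  qed
  from tendsto_add[OF this stieltjes_weak_conv[OF \<mu>n \<mu> wc pos]] show ?thesis by simp
qed

section \<open>The fixed point equation\<close>

text \<open>
  The limit \<open>e\<close> of the normalised trace of the upper block solves \<open>e = (w + K e) m\<^sub>A(\<zeta>)\<close> with
  \<open>\<zeta> = (w + K e + d / w) (w + K e)\<close>, \<open>K = s c\<close> and \<open>d = s (c - 1)\<close>. In terms of
  \<open>m = e / w\<close>, \<open>z = w\<^sup>2\<close> and \<open>\<delta> = 1 + K m\<close> this reads \<open>m = \<delta> m\<^sub>A(z \<delta>\<^sup>2 + d \<delta>)\<close>.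
\<close>

definition zeta_map :: "real \<Rightarrow> real \<Rightarrow> complex \<Rightarrow> complex \<Rightarrow> complex" where
  "zeta_map K d w e = (w + K * e + d / w) * (w + K * e)"

definition fixed_point_map :: "real \<Rightarrow> real \<Rightarrow> real measure \<Rightarrow> complex \<Rightarrow> complex \<Rightarrow> complex" where
  "fixed_point_map K d \<mu> w e = (w + K * e) * stieltjes \<mu> (zeta_map K d w e)"

text \<open>The square of this point lies on the imaginary axis, and its imaginary part is \<open>v\<close>.\<close>

definition diag_point :: "real \<Rightarrow> complex" where
  "diag_point v = complex_of_real v * (1 + \<i>)"

lemma diag_point_square: "diag_point v * diag_point v = \<i> * complex_of_real (2 * v\<^sup>2)"
  by (simp add: diag_point_def complex_eq_iff power2_eq_square)

lemma diag_point_bounds: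
  assumes "v \<ge> 0"
  shows "v \<le> cmod (diag_point v)" "cmod (diag_point v) \<le> 2 * v"
proof -
  show "v \<le> cmod (diag_point v)" using complex_Re_le_cmod[of "diag_point v"] by (simp add: diag_point_def)
  have "cmod (1 + \<i>) \<le> 2" by (rule order_trans[OF norm_triangle_ineq]) simp
  then show "cmod (diag_point v) \<le> 2 * v" using assms by (simp add: diag_point_def norm_mult mult_left_mono mult.commute)
qed

text \<open>\<open>v \<ge> 6 * b + 5\<close> collects what the estimates ask for:
  \<open>6 * b * v \<le> v\<^sup>2\<close> keeps \<open>\<zeta>\<close> high,
  \<open>3 / v \<le> 1\<close> preserves the unit disc, and
  \<open>16 * b / v\<^sup>2 \<le> 1 / 2\<close> gives a contraction.\<close>

context
  fixes K d b v :: real and w :: complex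
  assumes K: "0 \<le> K" "K \<le> b" and d: "\<bar>d\<bar> \<le> b" and v: "v \<ge> 6 * b + 5"
  defines "w \<equiv> diag_point v"
begin

lemma b_nonneg: "b \<ge> 0" using K by simp

lemma v_pos: "v > 0" using v b_nonneg by simp

lemma w_bounds: "v \<le> cmod w" "cmod w \<le> 2 * v"
  using diag_point_bounds[of v] v_pos by (auto simp: w_def)

lemma w_nonzero: "w \<noteq> 0" using w_bounds(1) v_pos by auto

lemma quotient_le: "cmod (complex_of_real d / w) \<le> b"
proof -
  have "cmod (complex_of_real d / w) \<le> b / 1"
    unfolding norm_divide norm_of_real using d w_bounds v b_nonneg by (intro frac_le) auto
  then show ?thesis by simp
qed

lemma Ke_le: "cmod e \<le> 1 \<Longrightarrow> cmod (complex_of_real K * e) \<le> b"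
  using K mult_mono[of K b "cmod e" 1] by (simp add: norm_mult)

lemma factor_le:
  fixes e :: complex
  assumes "cmod e \<le> 1"
  shows "cmod (w + K * e) \<le> 3 * v"
  using norm_triangle_ineq[of w "K * e"] Ke_le[OF assms] w_bounds v b_nonneg by linarith

lemma zeta_Im:
  fixes e :: complex
  assumes e: "cmod e \<le> 1"
  shows "v\<^sup>2 \<le> Im (zeta_map K d w e)"
proof -
  define p where "p = 2 * (K * e) * w + (K * e) * (K * e + d / w)"
  \<comment> \<open>The leading term \<open>w\<^sup>2\<close> is purely imaginary of height
    \<open>2 * v\<^sup>2\<close>, and \<open>d\<close> is real. The remainder \<open>p\<close> has
    modulus at most \<open>v\<^sup>2\<close>, so at least half of the height survives.\<close>
  have z: "zeta_map K d w e = \<i> * complex_of_real (2 * v\<^sup>2) + complex_of_real d + p"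
    unfolding zeta_map_def p_def diag_point_square[symmetric, of v, folded w_def]
    using w_nonzero by (simp add: field_simps)
  have "cmod p \<le> cmod (2 * (K * e) * w) + cmod ((K * e) * (K * e + d / w))"
    unfolding p_def by (rule norm_triangle_ineq)
  also have "\<dots> \<le> 2 * b * (2 * v) + b * (b + b)"
    unfolding norm_mult[of _ w] norm_mult[of 2] norm_mult[of _ "K * e + d / w"]
    using Ke_le[OF e] w_bounds quotient_le b_nonneg
    by (intro add_mono mult_mono order_trans[OF norm_triangle_ineq]) auto
  also have "\<dots> \<le> v * v"
  proof -
    have "6 * b * v \<le> v * v" using v v_pos by (intro mult_right_mono) auto
    then have 1: "6 * (b * v) \<le> v * v" by simp
    have "b * (6 * b) \<le> b * v" using v b_nonneg by (intro mult_left_mono) auto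
    then have 2: "6 * (b * b) \<le> b * v" by simp
    have 3: "0 \<le> b * b" by simp
    have "2 * b * (2 * v) + b * (b + b) = 4 * (b * v) + 2 * (b * b)" by (simp add: algebra_simps)
    then show ?thesis using 1 2 3 by linarith
  qed
  finally have "cmod p \<le> v\<^sup>2" by (simp add: power2_eq_square)
  moreover have "Im (zeta_map K d w e) = 2 * v\<^sup>2 + Im p" unfolding z by simp
  ultimately show ?thesis using abs_Im_le_cmod[of p] by linarith
qed

lemma zeta_norm_le:
  fixes e :: complex
  assumes e: "cmod e \<le> 1"
  shows "cmod (zeta_map K d w e) \<le> 12 * v\<^sup>2"
proof -
  have "cmod (w + K * e + d / w) \<le> 4 * v"
    using norm_triangle_ineq[of "w + K * e" "d / w"] factor_le[OF e] quotient_le v b_nonneg by linarith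
  then have "cmod (w + K * e + d / w) * cmod (w + K * e) \<le> (4 * v) * (3 * v)"
    using factor_le[OF e] v_pos by (intro mult_mono) auto
  then show ?thesis unfolding zeta_map_def norm_mult by (simp add: power2_eq_square)
qed

lemma zeta_lipschitz:
  fixes e e' :: complex
  assumes e: "cmod e \<le> 1" "cmod e' \<le> 1"
  shows "cmod (zeta_map K d w e - zeta_map K d w e') \<le> 5 * b * v * cmod (e - e')"
proof -
  have "zeta_map K d w e - zeta_map K d w e' = K * (e - e') * (2 * w + K * e + K * e' + d / w)"
    unfolding zeta_map_def using w_nonzero by (simp add: field_simps)
  then have "cmod (zeta_map K d w e - zeta_map K d w e') = K * cmod (e - e') * cmod (2 * w + K * e + K * e' + d / w)"
    using K by (simp only: norm_mult norm_of_real abs_of_nonneg)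
  also have "\<dots> \<le> b * cmod (e - e') * (5 * v)"
  proof -
    have "cmod (2 * w + K * e + K * e' + d / w) \<le> cmod (2 * w) + cmod (K * e) + cmod (K * e') + cmod (d / w)"
      by (intro order_trans[OF norm_triangle_ineq] add_mono order_refl)
    also have "cmod (2 * w) = 2 * cmod w" by (simp add: norm_mult)
    also have "2 * cmod w + cmod (K * e) + cmod (K * e') + cmod (d / w) \<le> 2 * (2 * v) + b + b + b"
      using Ke_le[OF e(1)] Ke_le[OF e(2)] quotient_le w_bounds by (intro add_mono) auto
    also have "\<dots> \<le> 5 * v" using v b_nonneg by simp
    finally show ?thesis using K by (intro mult_mono) auto
  qed
  finally show ?thesis by (simp add: mult_ac)
qed

lemma fixed_point_map_le:
  assumes \<mu>: "real_distribution \<mu>" and e: "cmod e \<le> 1"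
  shows "cmod (fixed_point_map K d \<mu> w e) \<le> 1"
proof -
  have "cmod (stieltjes \<mu> (zeta_map K d w e)) \<le> 1 / Im (zeta_map K d w e)"
    by (rule stieltjes_norm_le[OF \<mu>]) (use zeta_Im[OF e] v_pos in \<open>auto intro: less_le_trans[rotated]\<close>)
  also have "\<dots> \<le> 1 / v\<^sup>2" using zeta_Im[OF e] v_pos by (intro divide_left_mono) (auto intro!: mult_pos_pos intro: less_le_trans[rotated])
  finally have "cmod (w + K * e) * cmod (stieltjes \<mu> (zeta_map K d w e)) \<le> (3 * v) * (1 / v\<^sup>2)"
    using factor_le[OF e] v_pos by (intro mult_mono) auto
  also have "\<dots> \<le> 1" using v b_nonneg v_pos by (simp add: power2_eq_square)
  finally show ?thesis by (simp add: fixed_point_map_def norm_mult)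
qed

lemma fixed_point_map_contraction:
  assumes \<mu>: "real_distribution \<mu>" and e: "cmod e \<le> 1" "cmod e' \<le> 1"
  shows "cmod (fixed_point_map K d \<mu> w e - fixed_point_map K d \<mu> w e') \<le> 1 / 2 * cmod (e - e')"
proof -
  define m m' where "m = stieltjes \<mu> (zeta_map K d w e)" and "m' = stieltjes \<mu> (zeta_map K d w e')"
  have pos: "Im (zeta_map K d w e) > 0"
    using zeta_Im[OF e(1)] v_pos by (auto intro: less_le_trans[rotated])
  have "cmod m \<le> 1 / Im (zeta_map K d w e)" unfolding m_def by (rule stieltjes_norm_le[OF \<mu> pos])
  also have "\<dots> \<le> 1 / v\<^sup>2" using zeta_Im[OF e(1)] v_pos pos by (intro divide_left_mono) auto
  finally have m: "cmod m \<le> 1 / v\<^sup>2" .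
  have "cmod (m - m') \<le> cmod (zeta_map K d w e - zeta_map K d w e') / (v\<^sup>2)\<^sup>2"
    unfolding m_def m'_def by (rule stieltjes_lipschitz[OF \<mu> zeta_Im[OF e(1)] zeta_Im[OF e(2)]]) (use v_pos in simp)
  also have "\<dots> \<le> (5 * b * v * cmod (e - e')) / (v\<^sup>2)\<^sup>2"
    by (intro divide_right_mono zeta_lipschitz e) auto
  finally have mm: "cmod (m - m') \<le> (5 * b * v * cmod (e - e')) / (v\<^sup>2)\<^sup>2" .
  have "fixed_point_map K d \<mu> w e - fixed_point_map K d \<mu> w e' = K * (e - e') * m + (w + K * e') * (m - m')"
    by (simp add: fixed_point_map_def m_def m'_def algebra_simps)
  then have "cmod (fixed_point_map K d \<mu> w e - fixed_point_map K d \<mu> w e') \<le>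
      cmod (complex_of_real K) * cmod (e - e') * cmod m + cmod (w + K * e') * cmod (m - m')"
    by (simp only: norm_mult[symmetric] norm_triangle_ineq)
  also have "\<dots> \<le> b * cmod (e - e') * (1 / v\<^sup>2) + (3 * v) * ((5 * b * v * cmod (e - e')) / (v\<^sup>2)\<^sup>2)"
    using m mm factor_le[OF e(2)] K v_pos by (intro add_mono mult_mono) auto
  \<comment> \<open>One unit comes from the changed prefactor, and \<open>3 * 5\<close> from the
    changed argument.\<close>
  also have "\<dots> = 16 * b / v\<^sup>2 * cmod (e - e')"
    using v_pos by (simp add: power2_eq_square field_simps)
  also have "\<dots> \<le> 1 / 2 * cmod (e - e')"
  proof (rule mult_right_mono)
    have "(6 * b + 5) * (6 * b + 5) \<le> v * v" using v b_nonneg by (intro mult_mono) auto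
    moreover have "32 * b \<le> (6 * b + 5) * (6 * b + 5)" using b_nonneg by (simp add: algebra_simps)
    ultimately show "16 * b / v\<^sup>2 \<le> 1 / 2" using v_pos by (simp add: power2_eq_square field_simps)
  qed simp
  finally show ?thesis .
qed

lemma fixed_point_exists:
  assumes \<mu>: "real_distribution \<mu>"
  shows "\<exists>\<tau>. cmod \<tau> \<le> 1 \<and> \<tau> = fixed_point_map K d \<mu> w \<tau>"
proof -
  have "\<exists>!x\<in>cball 0 1. fixed_point_map K d \<mu> w x = x"
  proof (rule Banach_fix[where c = "1 / 2"])
    show "fixed_point_map K d \<mu> w ` cball 0 1 \<subseteq> cball 0 1"
      using fixed_point_map_le[OF \<mu>] by (auto simp: dist_norm)
    show "dist (fixed_point_map K d \<mu> w x) (fixed_point_map K d \<mu> w y) \<le> 1 / 2 * dist x y"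
      if "x \<in> cball 0 1" "y \<in> cball 0 1" for x y
      using fixed_point_map_contraction[OF \<mu>, of x y] that by (auto simp: dist_norm)
  qed (simp_all add: complete_eq_closed)
  then obtain \<tau> where "\<tau> \<in> cball 0 1" "fixed_point_map K d \<mu> w \<tau> = \<tau>" by blast
  then show ?thesis by (intro exI[of _ \<tau>]) (simp add: dist_norm)
qed

end

text \<open>The \<open>n\<close>-th map is compared at \<open>e n\<close> and at the limiting fixed
  point \<open>\<tau>\<close>: its contraction absorbs half of the distance. What is left is the
  residual \<open>r\<close> of the approximate equation and the change \<open>s\<close> of the maps
  at the single point \<open>\<tau>\<close>.\<close>

lemma fixed_point_convergence:
  fixes K d b v :: real and \<tau> :: complex and e :: "nat \<Rightarrow> complex"
  assumes K: "0 \<le> K" "K \<le> b" and d: "\<bar>d\<bar> \<le> b" and v: "v \<ge> 6 * b + 5"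
    and Kn: "Kn \<longlonglongrightarrow> K" "dn \<longlonglongrightarrow> d"
    and ev: "\<forall>\<^sub>F n in sequentially. 0 \<le> Kn n \<and> Kn n \<le> b \<and> \<bar>dn n\<bar> \<le> b \<and> cmod (e n) \<le> 1"
    and \<mu>n: "\<And>n. real_distribution (\<mu>n n)" and \<mu>: "real_distribution \<mu>" and wc: "weak_conv_m \<mu>n \<mu>"
    and approx: "(\<lambda>n. e n - fixed_point_map (Kn n) (dn n) (\<mu>n n) (diag_point v) (e n)) \<longlonglongrightarrow> 0"
    and \<tau>: "cmod \<tau> \<le> 1" "\<tau> = fixed_point_map K d \<mu> (diag_point v) \<tau>"
  shows "e \<longlonglongrightarrow> \<tau>"
proof -
  define w where "w = diag_point v"
  have w0: "w \<noteq> 0" using w_nonzero[OF K d v] by (simp add: w_def)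
  define r where "r n = e n - fixed_point_map (Kn n) (dn n) (\<mu>n n) w (e n)" for n
  define s where "s n = fixed_point_map (Kn n) (dn n) (\<mu>n n) w \<tau> - fixed_point_map K d \<mu> w \<tau>" for n
  have v0: "v > 0" using K v by simp
  have zpos: "Im (zeta_map K d w \<tau>) > 0"
    using zeta_Im[OF K d v \<tau>(1)] v0 by (auto simp: w_def intro: less_le_trans[rotated])
  have zlim: "(\<lambda>n. zeta_map (Kn n) (dn n) w \<tau>) \<longlonglongrightarrow> zeta_map K d w \<tau>"
    unfolding zeta_map_def by (intro tendsto_intros Kn w0)
  have "(\<lambda>n. fixed_point_map (Kn n) (dn n) (\<mu>n n) w \<tau>) \<longlonglongrightarrow> fixed_point_map K d \<mu> w \<tau>"
    unfolding fixed_point_map_def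
    by (intro tendsto_mult tendsto_add tendsto_const tendsto_of_real Kn
        stieltjes_weak_conv_moving[OF \<mu>n \<mu> wc zlim zpos])
  then have s: "s \<longlonglongrightarrow> 0" unfolding s_def by (simp add: LIM_zero_iff)
  have r: "r \<longlonglongrightarrow> 0" using approx by (simp add: r_def[abs_def] w_def)
  have "(\<lambda>n. e n - \<tau>) \<longlonglongrightarrow> 0"
  proof (rule Lim_null_comparison)
    show "\<forall>\<^sub>F n in sequentially. norm (e n - \<tau>) \<le> 2 * (cmod (r n) + cmod (s n))"
      using ev
    proof eventually_elim
      case (elim n)
      have "e n - \<tau> = r n + (fixed_point_map (Kn n) (dn n) (\<mu>n n) w (e n) - fixed_point_map (Kn n) (dn n) (\<mu>n n) w \<tau>) + s n"
        using \<tau>(2) by (simp add: r_def s_def w_def)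
      then have "cmod (e n - \<tau>) \<le> cmod (r n) +
          cmod (fixed_point_map (Kn n) (dn n) (\<mu>n n) w (e n) - fixed_point_map (Kn n) (dn n) (\<mu>n n) w \<tau>) + cmod (s n)"
        by (simp only:) (intro order_trans[OF norm_triangle_ineq] add_mono order_refl)
      moreover have "cmod (fixed_point_map (Kn n) (dn n) (\<mu>n n) w (e n) - fixed_point_map (Kn n) (dn n) (\<mu>n n) w \<tau>) \<le> 1 / 2 * cmod (e n - \<tau>)"
        unfolding w_def by (rule fixed_point_map_contraction[where b = b]) (use elim v \<mu>n \<tau> in auto)
      ultimately show ?case by simp
    qed
    have "(\<lambda>n. 2 * (cmod (r n) + cmod (s n))) \<longlonglongrightarrow> 2 * (cmod 0 + cmod 0)"
      by (intro tendsto_intros r s)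
    then show "(\<lambda>n. 2 * (cmod (r n) + cmod (s n))) \<longlonglongrightarrow> 0" by simp
  qed
  then show ?thesis by (simp add: LIM_zero_iff)
qed

text \<open>In terms of \<open>z = w\<^sup>2\<close> and \<open>m = \<tau> / w\<close> the product
  \<open>w * \<tau>\<close> is \<open>z * m\<close>, so the limit -1 says that no mass escapes. The
  equation writes it as \<open>\<zeta> * stieltjes \<mu> \<zeta>\<close> divided by a factor tending
  to 1, and \<open>zeta_norm_le\<close> with \<open>zeta_Im\<close> keeps \<open>\<zeta>\<close> in
  a cone with constant 12.\<close>

lemma fixed_point_asymptotic:
  fixes K d b :: real and v :: "nat \<Rightarrow> real" and \<tau> :: "nat \<Rightarrow> complex"
  assumes K: "0 \<le> K" "K \<le> b" and d: "\<bar>d\<bar> \<le> b" and v: "\<And>m. v m \<ge> 6 * b + 5"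
    and v_inf: "filterlim v at_top sequentially" and \<mu>: "real_distribution \<mu>"
    and \<tau>: "\<And>m. cmod (\<tau> m) \<le> 1" "\<And>m. \<tau> m = fixed_point_map K d \<mu> (diag_point (v m)) (\<tau> m)"
  shows "(\<lambda>m. diag_point (v m) * \<tau> m) \<longlonglongrightarrow> - 1"
proof -
  define w where "w m = diag_point (v m)" for m
  define \<zeta> where "\<zeta> m = zeta_map K d (w m) (\<tau> m)" for m
  have v0: "v m > 0" for m using K v[of m] by simp
  have w0: "w m \<noteq> 0" for m using w_nonzero[OF K d v[of m]] by (simp add: w_def)
  have Im_ge: "(v m)\<^sup>2 \<le> Im (\<zeta> m)" for m
    unfolding \<zeta>_def w_def by (rule zeta_Im[OF K d v \<tau>(1)])
  have pos: "Im (\<zeta> m) > 0" for m using Im_ge[of m] v0[of m] by (auto intro: less_le_trans[rotated])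
  have cone: "cmod (\<zeta> m) \<le> 12 * Im (\<zeta> m)" for m
    using zeta_norm_le[OF K d v[of m] \<tau>(1)[of m]] Im_ge[of m] unfolding \<zeta>_def w_def by linarith
  have v_le: "v m \<le> (v m)\<^sup>2" for m using v[of m] K by (simp add: power2_eq_square)
  have inf: "filterlim (\<lambda>m. Im (\<zeta> m)) at_top sequentially"
    by (rule filterlim_at_top_mono[OF v_inf]) (use v_le Im_ge in \<open>auto intro!: always_eventually order_trans[OF v_le]\<close>)
  have lim: "(\<lambda>m. \<zeta> m * stieltjes \<mu> (\<zeta> m)) \<longlonglongrightarrow> - 1"
    by (rule stieltjes_asymptotic[OF \<mu> pos cone inf])
  have iw: "(\<lambda>m. 1 / w m) \<longlonglongrightarrow> 0"
  proof (rule Lim_null_comparison)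
    show "\<forall>\<^sub>F m in sequentially. norm (1 / w m) \<le> inverse (v m)"
    proof (intro always_eventually allI)
      fix m
      have "1 / cmod (w m) \<le> 1 / v m" using w_bounds(1)[OF K d v[of m]] v0[of m] w0[of m] 
        by (intro divide_left_mono) (auto simp: w_def)
      then show "norm (1 / w m) \<le> inverse (v m)" by (simp add: norm_divide inverse_eq_divide)
    qed
    show "(\<lambda>m. inverse (v m)) \<longlonglongrightarrow> 0" by (rule tendsto_inverse_0_at_top[OF v_inf])
  qed
  have tw: "(\<lambda>m. \<tau> m * (1 / w m)) \<longlonglongrightarrow> 0"
  proof (rule Lim_null_comparison)
    show "\<forall>\<^sub>F m in sequentially. norm (\<tau> m * (1 / w m)) \<le> norm (1 / w m)"
      using \<tau>(1) by (intro always_eventually allI) (simp only: norm_mult, intro mult_left_le_one_le, auto)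
    show "(\<lambda>m. norm (1 / w m)) \<longlonglongrightarrow> 0" using tendsto_norm[OF iw] by simp
  qed
  have q: "(\<lambda>m. 1 / (1 + K * (\<tau> m * (1 / w m)) + d * ((1 / w m) * (1 / w m)))) \<longlonglongrightarrow> 1 / (1 + complex_of_real K * 0 + complex_of_real d * (0 * 0))"
    by (intro tendsto_intros tw iw) auto
  have nz: "w m + K * \<tau> m + d / w m \<noteq> 0" for m
  proof
    assume "w m + K * \<tau> m + d / w m = 0"
    then have "\<zeta> m = 0" by (simp add: \<zeta>_def zeta_map_def)
    then show False using pos[of m] by simp
  qed
  have "w m * \<tau> m = 1 / (1 + K * (\<tau> m * (1 / w m)) + d * ((1 / w m) * (1 / w m))) * (\<zeta> m * stieltjes \<mu> (\<zeta> m))" for m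
  proof -
    define A where "A = w m + K * \<tau> m + d / w m"
    define S where "S = stieltjes \<mu> (\<zeta> m)"
    define F where "F = w m + K * \<tau> m"
    have A: "A \<noteq> 0" unfolding A_def by (rule nz)
    have t: "\<tau> m = F * S"
      using \<tau>(2)[of m] unfolding fixed_point_map_def S_def F_def \<zeta>_def w_def .
    have z: "\<zeta> m = A * F" unfolding \<zeta>_def zeta_map_def A_def F_def ..
    have "1 + K * (\<tau> m * (1 / w m)) + d * ((1 / w m) * (1 / w m)) = A / w m"
      unfolding A_def using w0[of m] by (simp add: field_simps)
    then have "1 / (1 + K * (\<tau> m * (1 / w m)) + d * ((1 / w m) * (1 / w m))) * (\<zeta> m * S) = w m / A * (A * F * S)"
      by (simp add: z)
    also have "\<dots> = w m * (F * S)" using A by simp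
    finally show ?thesis using t by (simp add: S_def)
  qed
  then show ?thesis using tendsto_mult[OF q lim] by (simp add: w_def[symmetric])
qed

section \<open>Algebraicity\<close>

interpretation of_real_poly_hom: map_poly_inj_idom_hom complex_of_real ..
interpretation of_real_poly_poly_hom: map_poly_inj_idom_hom "map_poly complex_of_real" ..

lemma bivar_eval_add: "bivar_eval (p + q) m z = bivar_eval p m z + bivar_eval q m z"
  by (simp add: bivar_eval_def of_real_poly_poly_hom.hom_add)

lemma bivar_eval_mult: "bivar_eval (p * q) m z = bivar_eval p m z * bivar_eval q m z"
  by (simp add: bivar_eval_def of_real_poly_poly_hom.hom_mult)

lemma bivar_eval_1: "bivar_eval 1 m z = 1"
  by (simp add: bivar_eval_def)

lemma bivar_eval_0: "bivar_eval 0 m z = 0"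
  by (simp add: bivar_eval_def)

lemma bivar_eval_power: "bivar_eval (p ^ k) m z = bivar_eval p m z ^ k"
  by (induction k) (simp_all add: bivar_eval_1 bivar_eval_mult)

lemma bivar_eval_sum: "bivar_eval (\<Sum>i\<in>A. f i) m z = (\<Sum>i\<in>A. bivar_eval (f i) m z)"
  by (induction A rule: infinite_finite_induct) (simp_all add: bivar_eval_0 bivar_eval_add)

lemma bivar_eval_const: "bivar_eval [:c:] m z = poly (map_poly complex_of_real c) z"
  by (simp add: bivar_eval_def of_real_poly_hom.map_poly_pCons_hom)

lemma bivar_eval_var: "bivar_eval [:0, 1:] m z = m"
  by (simp add: bivar_eval_def)

lemma bivar_eval_altdef:
  "bivar_eval L m z = (\<Sum>i\<le>degree L. poly (map_poly complex_of_real (coeff L i)) z * m ^ i)"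
proof -
  have "L = (\<Sum>i\<le>degree L. [:coeff L i:] * [:0, 1:] ^ i)"
    by (subst poly_as_sum_of_monoms[symmetric])
       (simp add: monom_altdef)
  then have "bivar_eval L m z = bivar_eval (\<Sum>i\<le>degree L. [:coeff L i:] * [:0, 1:] ^ i) m z" by simp
  then show ?thesis
    by (simp only: bivar_eval_sum bivar_eval_mult bivar_eval_power bivar_eval_const bivar_eval_var)
qed

text \<open>Each admissible number \<open>m\<close>, read as a constant polynomial in
  \<open>z\<close>, is a root of \<open>L\<close>. Infinitely many remain outside \<open>E\<close>,
  which leaves room for the pole of a substitution.\<close>

lemma bivar_eval_eq_zeroD:
  assumes fin: "finite E" and zero: "\<And>m z. m \<notin> E \<Longrightarrow> bivar_eval L m z = 0"
  shows "L = 0"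
proof (rule ccontr)
  assume "L \<noteq> 0"
  define Q where "Q = map_poly (map_poly complex_of_real) L"
  have Q0: "Q \<noteq> 0" using \<open>L \<noteq> 0\<close> by (simp add: Q_def)
  have "poly Q [:m:] = 0" if "m \<notin> E" for m
  proof -
    have "poly (poly Q [:m:]) z = 0" for z using zero[OF that, of z] by (simp add: bivar_eval_def Q_def)
    then show ?thesis by (intro poly_all_0_iff_0[THEN iffD1]) auto
  qed
  then have "(\<lambda>m. [:m:]) ` (- E) \<subseteq> {x. poly Q x = 0}" by auto
  then have "finite ((\<lambda>m::complex. [:m:]) ` (- E))" using poly_roots_finite[OF Q0] finite_subset by blast
  then have "finite (- E)" by (rule finite_imageD) (auto simp: inj_on_def)
  then show False using fin infinite_UNIV_char_0[where 'a = complex] by (metis Compl_partition finite_Un)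
qed

text \<open>
  The substitution \<open>(m, z) \<mapsto> (m / \<delta>, z \<delta>\<^sup>2 + d \<delta>)\<close> is birational, so clearing denominators leaves a
  nonzero polynomial.
\<close>

lemma algebraic_substitution:
  fixes K d :: real and L :: "real poly poly"
  assumes L: "L \<noteq> 0"
  shows "\<exists>P. P \<noteq> 0 \<and> (\<forall>(m :: complex) (z :: complex). 1 + K * m \<noteq> 0 \<longrightarrow>
    bivar_eval L (m / (1 + K * m)) (z * (1 + K * m)\<^sup>2 + d * (1 + K * m)) = 0 \<longrightarrow> bivar_eval P m z = 0)"
proof -
  define \<Delta> :: "real poly poly" where "\<Delta> = 1 + [:[:K:]:] * [:0, 1:]"
  define Z :: "real poly poly" where "Z = [:[:0, 1:]:] * \<Delta> ^ 2 + [:[:d:]:] * \<Delta>"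
  define c where "c i = (\<Sum>k\<le>degree (coeff L i). [:[:coeff (coeff L i) k:]:] * Z ^ k)" for i
  \<comment> \<open>Substitution into \<open>L\<close>, multiplied by the power of
    \<open>\<Delta>\<close> that clears the denominators of \<open>m / \<Delta>\<close>.\<close>
  define P where "P = (\<Sum>i\<le>degree L. c i * [:0, 1:] ^ i * \<Delta> ^ (degree L - i))"
  have ev\<Delta>: "bivar_eval \<Delta> m z = 1 + K * m" for m z :: complex
    unfolding \<Delta>_def bivar_eval_add bivar_eval_mult bivar_eval_1 bivar_eval_const bivar_eval_var
    by (simp add: of_real_hom.map_poly_pCons_hom)
  have evZ: "bivar_eval Z m z = z * (1 + K * m)\<^sup>2 + d * (1 + K * m)" for m z :: complex
    unfolding Z_def bivar_eval_add bivar_eval_mult bivar_eval_power ev\<Delta> bivar_eval_const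
    by (simp add: of_real_hom.map_poly_pCons_hom)
  have evc: "bivar_eval (c i) m z = poly (map_poly complex_of_real (coeff L i)) (z * (1 + K * m)\<^sup>2 + d * (1 + K * m))" for i and m z :: complex
    unfolding c_def bivar_eval_sum bivar_eval_mult bivar_eval_power evZ bivar_eval_const
    by (simp add: poly_altdef)
  have evP: "bivar_eval P m z = (1 + K * m) ^ degree L *
      bivar_eval L (m / (1 + K * m)) (z * (1 + K * m)\<^sup>2 + d * (1 + K * m))" if nz: "1 + K * m \<noteq> 0" for m z :: complex
  proof -
    have "bivar_eval P m z = (\<Sum>i\<le>degree L. poly (map_poly complex_of_real (coeff L i)) (z * (1 + K * m)\<^sup>2 + d * (1 + K * m)) * m ^ i * (1 + K * m) ^ (degree L - i))"
      unfolding P_def bivar_eval_sum bivar_eval_mult bivar_eval_power evc ev\<Delta> bivar_eval_var ..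
    also have "\<dots> = (\<Sum>i\<le>degree L. (1 + K * m) ^ degree L *
        (poly (map_poly complex_of_real (coeff L i)) (z * (1 + K * m)\<^sup>2 + d * (1 + K * m)) * (m / (1 + K * m)) ^ i))"
      by (intro sum.cong refl) (use nz in \<open>simp add: power_divide power_diff\<close>)
    finally show ?thesis unfolding bivar_eval_altdef sum_distrib_left .
  qed
  have "P \<noteq> 0"
  proof
    assume P0: "P = 0"
    have "L = 0"
    proof (rule bivar_eval_eq_zeroD)
      show "finite (if K = 0 then {} else {complex_of_real (1 / K)})" by simp
      fix m' z' :: complex assume m': "m' \<notin> (if K = 0 then {} else {complex_of_real (1 / K)})"
      have nz: "1 - K * m' \<noteq> 0"
      proof
        assume "1 - K * m' = 0"
        then have "K * m' = 1" by simp
        moreover from this have K0: "K \<noteq> 0" by auto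
        ultimately have "m' = complex_of_real (1 / K)" by (simp add: field_simps)
        with m' K0 show False by simp
      qed
      \<comment> \<open>The inverse substitution, defined except at \<open>m' = 1 / K\<close>, the
        excluded point. It shows that \<open>P = 0\<close> would force \<open>L = 0\<close>.\<close>
      define m where "m = m' / (1 - K * m')"
      have \<delta>: "1 + K * m = 1 / (1 - K * m')" unfolding m_def using nz by (simp add: field_simps)
      then have \<delta>0: "1 + K * m \<noteq> 0" using nz by simp
      define z where "z = (z' - d * (1 + K * m)) / (1 + K * m)\<^sup>2"
      have "z * (1 + K * m)\<^sup>2 + d * (1 + K * m) = z'" unfolding z_def using \<delta>0 by simp
      moreover have "m / (1 + K * m) = m'"
      proof -
        have "m / (1 + K * m) = m * (1 - K * m')" unfolding \<delta> by simp
        then show ?thesis unfolding m_def using nz by simp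
      qed
      ultimately show "bivar_eval L m' z' = 0"
        using evP[OF \<delta>0, of z] \<delta>0 by (simp add: P0 bivar_eval_0)
    qed
    with L show False by simp
  qed
  then show ?thesis using evP by (intro exI[of _ P]) auto
qed

lemma algebraic_of_imag_points:
  assumes \<mu>: "real_distribution \<mu>" and v0: "v0 > 0" and P: "P \<noteq> 0"
    and zero: "\<And>z. z \<in> imag_points v0 \<Longrightarrow> bivar_eval P (stieltjes \<mu> z) z = 0"
  shows "algebraic_distribution \<mu>"
  unfolding algebraic_distribution_def
proof (intro exI[of _ P] conjI allI impI P)
  fix z :: complex assume z: "Im z > 0"
  have "(\<lambda>z. bivar_eval P (stieltjes \<mu> z) z) holomorphic_on {z. Im z > 0}"
    unfolding bivar_eval_altdef
    by (intro holomorphic_intros stieltjes_holomorphic[OF \<mu>])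
  from identity_upper_half_plane[OF this v0 zero z] show "bivar_eval P (stieltjes \<mu> z) z = 0" by simp
qed

section \<open>Almost sure convergence\<close>

text \<open>The second moments are summable, so almost surely the squares themselves form a
  convergent series. No relation between the variables is involved.\<close>

lemma (in prob_space) AE_tendsto_zero_of_second_moments:
  fixes Z :: "nat \<Rightarrow> 'a \<Rightarrow> complex"
  assumes meas: "\<And>n. n \<ge> n0 \<Longrightarrow> Z n \<in> borel_measurable M"
    and bound: "\<And>n. n \<ge> n0 \<Longrightarrow> (\<integral>\<^sup>+\<omega>. ennreal ((cmod (Z n \<omega>))\<^sup>2) \<partial>M) \<le> ennreal (C / (real n)\<^sup>2)" and C: "C \<ge> 0"
  shows "AE \<omega> in M. (\<lambda>n. Z n \<omega>) \<longlonglongrightarrow> 0"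
proof -
  define f where "f n \<omega> = (if n \<ge> n0 then (cmod (Z n \<omega>))\<^sup>2 else 0)" for n \<omega>
  have fm[measurable]: "f n \<in> borel_measurable M" for n
    using meas[of n] unfolding f_def by (cases "n \<ge> n0") auto
  have summ: "summable (\<lambda>n. C / (real n)\<^sup>2)"
    using summable_mult[OF inverse_power_summable[of 2], of C] by (simp add: divide_inverse)
  have "(\<integral>\<^sup>+\<omega>. (\<Sum>n. ennreal (f n \<omega>)) \<partial>M) = (\<Sum>n. \<integral>\<^sup>+\<omega>. ennreal (f n \<omega>) \<partial>M)"
    by (rule nn_integral_suminf) measurable
  also have "\<dots> \<le> (\<Sum>n. ennreal (C / (real n)\<^sup>2))"
  proof (intro suminf_le)
    show "(\<integral>\<^sup>+\<omega>. ennreal (f n \<omega>) \<partial>M) \<le> ennreal (C / (real n)\<^sup>2)" for n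
      using bound[of n] by (cases "n \<ge> n0") (simp_all add: f_def)
  qed auto
  also have "\<dots> = ennreal (\<Sum>n. C / (real n)\<^sup>2)"
    by (rule suminf_ennreal2[OF _ summ]) (use C in auto)
  also have "\<dots> < \<infinity>" by simp
  finally have "AE \<omega> in M. (\<Sum>n. ennreal (f n \<omega>)) \<noteq> \<infinity>"
    by (intro nn_integral_noteq_infinite) auto
  then show ?thesis
  proof eventually_elim
    case (elim \<omega>)
    then have "summable (\<lambda>n. f n \<omega>)" by (intro summable_suminf_not_top) (auto simp: f_def)
    then have "(\<lambda>n. f n \<omega>) \<longlonglongrightarrow> 0" by (rule summable_LIMSEQ_zero)
    then have "(\<lambda>n. sqrt (f n \<omega>)) \<longlonglongrightarrow> sqrt 0" by (rule tendsto_real_sqrt)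
    moreover have "\<forall>\<^sub>F n in sequentially. sqrt (f n \<omega>) = cmod (Z n \<omega>)"
      using eventually_ge_at_top[of n0] by eventually_elim (simp add: f_def)
    ultimately have "(\<lambda>n. cmod (Z n \<omega>)) \<longlonglongrightarrow> 0" by (simp add: tendsto_cong)
    then show ?case by (rule tendsto_norm_zero_cancel)
  qed
qed

lemma t_jointly_measurable:
  assumes ipn: "info_plus_noise D C3 C4 \<sigma> w"
  shows "(\<lambda>p. info_plus_noise.t N L (\<lambda>i j. fst p (i, j)) \<sigma> w (snd p)) \<in>
    borel_measurable (PiM ({..<N} \<times> {..<L}) (\<lambda>_. borel) \<Otimes>\<^sub>M PiM ({..<N} \<times> {..<L}) (\<lambda>_. borel))"
  unfolding info_plus_noise.t_def[OF ipn] info_plus_noise.R_def[OF ipn]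
proof (intro borel_measurable_sum measurable_minv_bmat)
  fix i j assume "i < N" "j < L"
  then have ij: "(i, j) \<in> {..<N} \<times> {..<L}" by auto
  show "(\<lambda>p. info_plus_noise.X (\<lambda>i j. fst p (i, j)) \<sigma> (snd p) i j) \<in>
    borel_measurable (PiM ({..<N} \<times> {..<L}) (\<lambda>_. borel) \<Otimes>\<^sub>M PiM ({..<N} \<times> {..<L}) (\<lambda>_. borel))"
    unfolding info_plus_noise.X_def[OF ipn]
    by (intro borel_measurable_add borel_measurable_times borel_measurable_const
        measurable_compose[OF measurable_fst measurable_component_singleton[OF ij]]
        measurable_compose[OF measurable_snd measurable_component_singleton[OF ij]])
qed auto

lemma (in prob_space)
  fixes \<alpha> y :: "'a \<Rightarrow> nat \<times> nat \<Rightarrow> complex" and N L :: nat and \<sigma> :: real and w :: complex and D :: "complex measure"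
  defines "B \<equiv> PiM ({..<N} \<times> {..<L}) (\<lambda>_. borel)"
  defines "tr \<equiv> \<lambda>a. info_plus_noise.t N L (\<lambda>i j. a (i, j)) \<sigma> w"
  defines "mean \<equiv> \<lambda>a. info_plus_noise.Et D N L (\<lambda>i j. a (i, j)) \<sigma> w"
  assumes ipn: "info_plus_noise D C3 C4 \<sigma> w"
    and \<alpha>: "\<alpha> \<in> measurable M B" and y: "y \<in> measurable M B"
    and law: "distr M (B \<Otimes>\<^sub>M B) (\<lambda>\<omega>. (\<alpha> \<omega>, y \<omega>)) = distr M B \<alpha> \<Otimes>\<^sub>M PiM ({..<N} \<times> {..<L}) (\<lambda>_. D)"
  shows conditional_deviation_measurable: "(\<lambda>\<omega>. tr (\<alpha> \<omega>) (y \<omega>) - mean (\<alpha> \<omega>)) \<in> borel_measurable M"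
    and conditional_variance_le: "(\<integral>\<^sup>+\<omega>. ennreal ((cmod (tr (\<alpha> \<omega>) (y \<omega>) - mean (\<alpha> \<omega>)))\<^sup>2) \<partial>M) \<le>
      ennreal (info_plus_noise.V C4 N L \<sigma> w)"
proof -
  interpret I: info_plus_noise D C3 C4 N L a \<sigma> w for a by (rule ipn)
  define P where "P = PiM ({..<N} \<times> {..<L}) (\<lambda>_. D)"
  interpret P: prob_space P unfolding P_def by (rule I.P.prob_space_axioms)
  have setsP: "sets P = sets B" unfolding P_def B_def by (intro sets_PiM_cong refl I.sets_D)
  note [measurable_cong] = setsP
  have tm: "(\<lambda>p. tr (fst p) (snd p)) \<in> borel_measurable (B \<Otimes>\<^sub>M B)"
    unfolding tr_def B_def by (rule t_jointly_measurable[OF ipn])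
  have tmP: "(\<lambda>p. tr (fst p) (snd p)) \<in> borel_measurable (B \<Otimes>\<^sub>M P)"
    using tm by (simp add: measurable_cong_sets[OF sets_pair_measure_cong[OF refl setsP] refl])
  have mean: "mean a = (\<integral>y. tr a y \<partial>P)" for a
    unfolding mean_def tr_def P_def by (rule I.Et_def)
  have mm: "mean \<in> borel_measurable B"
    unfolding mean using tmP by (intro P.borel_measurable_lebesgue_integral) (simp add: split_beta')
  define g where "g p = tr (fst p) (snd p) - mean (fst p)" for p
  have gm: "g \<in> borel_measurable (B \<Otimes>\<^sub>M B)"
    unfolding g_def using tm measurable_compose[OF measurable_fst mm] by (rule borel_measurable_diff)
  have pm: "(\<lambda>\<omega>. (\<alpha> \<omega>, y \<omega>)) \<in> measurable M (B \<Otimes>\<^sub>M B)" using \<alpha> y by (rule measurable_Pair)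
  show "(\<lambda>\<omega>. tr (\<alpha> \<omega>) (y \<omega>) - mean (\<alpha> \<omega>)) \<in> borel_measurable M"
    using measurable_compose[OF pm gm] by (simp add: g_def)
  have hm: "(\<lambda>p. ennreal ((cmod (g p))\<^sup>2)) \<in> borel_measurable (B \<Otimes>\<^sub>M B)"
    using gm by measurable
  have setsA: "sets (distr M B \<alpha> \<Otimes>\<^sub>M P) = sets (B \<Otimes>\<^sub>M B)"
    by (intro sets_pair_measure_cong setsP) simp
  have hm': "(\<lambda>p. ennreal ((cmod (g p))\<^sup>2)) \<in> borel_measurable (distr M B \<alpha> \<Otimes>\<^sub>M P)"
    using hm by (simp add: measurable_cong_sets[OF setsA refl])
  have "(\<integral>\<^sup>+\<omega>. ennreal ((cmod (tr (\<alpha> \<omega>) (y \<omega>) - mean (\<alpha> \<omega>)))\<^sup>2) \<partial>M) =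
      (\<integral>\<^sup>+p. ennreal ((cmod (g p))\<^sup>2) \<partial>distr M (B \<Otimes>\<^sub>M B) (\<lambda>\<omega>. (\<alpha> \<omega>, y \<omega>)))"
    using pm hm by (subst nn_integral_distr) (simp_all add: g_def)
  also have "\<dots> = (\<integral>\<^sup>+a. \<integral>\<^sup>+b. ennreal ((cmod (g (a, b)))\<^sup>2) \<partial>P \<partial>distr M B \<alpha>)"
    unfolding law P_def[symmetric] by (rule P.nn_integral_fst[OF hm', symmetric])
  also have "\<dots> \<le> (\<integral>\<^sup>+a. ennreal (info_plus_noise.V C4 N L \<sigma> w) \<partial>distr M B \<alpha>)"
    using I.nn_variance_trace by (intro nn_integral_mono) (simp add: g_def tr_def mean_def P_def)
  also have "\<dots> = ennreal (info_plus_noise.V C4 N L \<sigma> w)"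
    using prob_space.emeasure_space_1[OF prob_space_distr[OF \<alpha>]] by (simp del: space_distr)
  finally show "(\<integral>\<^sup>+\<omega>. ennreal ((cmod (tr (\<alpha> \<omega>) (y \<omega>) - mean (\<alpha> \<omega>)))\<^sup>2) \<partial>M) \<le>
      ennreal (info_plus_noise.V C4 N L \<sigma> w)" .
qed

section \<open>The random model with growing dimensions\<close>

locale noise_model = prob_space M for M :: "'w measure" +
  fixes L :: "nat \<Rightarrow> nat" and G Y Ahalf :: "nat \<Rightarrow> 'w \<Rightarrow> complex mat" and s c :: real and C :: "nat \<Rightarrow> real"
    and \<mu> :: "real measure"
  assumes iid: "\<And>N. N > 0 \<Longrightarrow> iid_standardized M N (L N) (Y N)"
    and moments: "\<And>k N i j. N > 0 \<Longrightarrow> i < N \<Longrightarrow> j < L N \<Longrightarrow>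
        integrable M (\<lambda>\<omega>. norm (Y N \<omega> $$ (i, j)) ^ k) \<and> (LINT \<omega>|M. norm (Y N \<omega> $$ (i, j)) ^ k) \<le> C k"
    and G_eq: "\<And>N \<omega>. N > 0 \<Longrightarrow> \<omega> \<in> space M \<Longrightarrow> G N \<omega> = complex_of_real (1 / sqrt (real (L N))) \<cdot>\<^sub>m Y N \<omega>"
    and A_random: "\<And>N. N > 0 \<Longrightarrow> random_matrix M N (L N) (Ahalf N)"
    and indep: "\<And>N. N > 0 \<Longrightarrow> indep_matrices M N (L N) (Ahalf N) (G N)"
    and \<mu>: "real_distribution \<mu>"
    and A_conv: "AE \<omega> in M. weak_conv (\<lambda>N. esd (Ahalf N \<omega> * mat_adjoint (Ahalf N \<omega>))) (cdf \<mu>)"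
    and s: "s > 0" and L_inf: "filterlim L at_top sequentially"
    and ratio: "(\<lambda>N. real N / real (L N)) \<longlonglongrightarrow> c" and c: "c > 0"
begin

text \<open>Dominates \<open>s * N / L\<close> and \<open>\<bar>s * (N / L - 1)\<bar>\<close> as
  soon as \<open>N / L \<le> c + 1\<close>, as well as their limits. \<open>v0\<close> is the
  threshold for the contraction.\<close>

definition "bound = s * (c + 2)"
definition "v0 = 6 * bound + 5"
definition "D N = distr M borel (\<lambda>\<omega>. Y N \<omega> $$ (0, 0))"
definition "\<sigma> N = sqrt (s / real (L N))"
definition "\<alpha> N \<omega> = (\<lambda>p\<in>{..<N} \<times> {..<L N}. Ahalf N \<omega> $$ p)"
text \<open>Expressed through \<open>G\<close>, because independence of \<open>Ahalf\<close> is
  given for \<open>G\<close>: the factor undoes the normalisation, and \<open>y_eq\<close> recovers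
  the entries of \<open>Y\<close>. The inner restriction makes it literally a function of the random
  vector in \<open>indep_matrices\<close>.\<close>

definition "y N \<omega> = (\<lambda>p\<in>{..<N} \<times> {..<L N}. complex_of_real (sqrt (real (L N))) * (\<lambda>p\<in>{..<N} \<times> {..<L N}. G N \<omega> $$ p) p)"

abbreviation "T v N \<omega> \<equiv> info_plus_noise.t N (L N) (\<lambda>i j. \<alpha> N \<omega> (i, j)) (\<sigma> N) (diag_point v) (y N \<omega>)"
abbreviation "ET v N \<omega> \<equiv> info_plus_noise.Et (D N) N (L N) (\<lambda>i j. \<alpha> N \<omega> (i, j)) (\<sigma> N) (diag_point v)"
abbreviation "B N \<omega> \<equiv> (Ahalf N \<omega> + complex_of_real (sqrt s) \<cdot>\<^sub>m G N \<omega>) *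
            mat_adjoint (Ahalf N \<omega> + complex_of_real (sqrt s) \<cdot>\<^sub>m G N \<omega>)"
abbreviation "A N \<omega> \<equiv> Ahalf N \<omega> * mat_adjoint (Ahalf N \<omega>)"

text \<open>\<open>L N > 0\<close> excludes the degenerate value \<open>1 / sqrt 0 = 0\<close>. The
  bound on \<open>N / L\<close> controls the equation and the variance, the one on
  \<open>L / N\<close> the last term of \<open>err / N\<close>.\<close>

definition "good N \<longleftrightarrow> N > 0 \<and> L N > 0 \<and> real N / real (L N) \<le> c + 1 \<and> real (L N) / real N \<le> 2 / c"

lemma eventually_good: "\<forall>\<^sub>F N in sequentially. good N"
proof -
  have "\<forall>\<^sub>F N in sequentially. L N \<ge> 1"
    using L_inf by (simp add: filterlim_at_top)
  moreover have "\<forall>\<^sub>F N in sequentially. real N / real (L N) < c + 1"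
    by (rule order_tendstoD(2)[OF ratio]) simp
  moreover have "\<forall>\<^sub>F N in sequentially. real N / real (L N) > c / 2"
    by (rule order_tendstoD(1)[OF ratio]) (use c in simp)
  ultimately show ?thesis
    using eventually_gt_at_top[of 0]
  proof eventually_elim
    case (elim N)
    then have "real (L N) / real N \<le> 2 / c" using c by (simp add: field_simps)
    then show ?case using elim by (simp add: good_def)
  qed
qed

lemma bound_pos: "bound > 0" using s c by (simp add: bound_def)

lemma v0_pos: "v0 > 0" using bound_pos by (simp add: v0_def)

context
  fixes N assumes N: "N > 0" and LN: "L N > 0"
begin

lemma Y_measurable: "i < N \<Longrightarrow> j < L N \<Longrightarrow> (\<lambda>\<omega>. Y N \<omega> $$ (i, j)) \<in> borel_measurable M"
  using iid[OF N] by (auto simp: iid_standardized_def random_matrix_def)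

lemma entry_law_D: "entry_law (D N) (C 3) (C 4)"
proof -
  have m[measurable]: "(\<lambda>\<omega>. Y N \<omega> $$ (0, 0)) \<in> borel_measurable M" by (rule Y_measurable[OF N LN])
  have mean: "integrable M (\<lambda>\<omega>. Y N \<omega> $$ (0, 0))" "(LINT \<omega>|M. Y N \<omega> $$ (0, 0)) = 0"
     "(LINT \<omega>|M. (norm (Y N \<omega> $$ (0, 0)))\<^sup>2) = 1"
    using iid[OF N] N LN by (auto simp: iid_standardized_def)
  show ?thesis
  proof (rule entry_law.intro)
    show "prob_space (D N)" unfolding D_def by (rule prob_space_distr) measurable
    show "entry_law_axioms (D N) (C 3) (C 4)"
    proof
      show "sets (D N) = sets borel" by (simp add: D_def)
      show "integrable (D N) (\<lambda>x. x)" unfolding D_def by (subst integrable_distr_eq) (use mean in auto)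
      show "(LINT x|D N. x) = 0" unfolding D_def by (subst integral_distr) (use mean in auto)
      show "integrable (D N) (\<lambda>x. cmod x ^ k)" for k
        unfolding D_def by (subst integrable_distr_eq) (use moments[OF N N LN] in auto)
      show "(LINT x|D N. (cmod x)\<^sup>2) = 1" unfolding D_def by (subst integral_distr) (use mean in auto)
      show "(LINT x|D N. cmod x ^ 3) \<le> C 3" unfolding D_def by (subst integral_distr) (use moments[OF N N LN] in auto)
      show "(LINT x|D N. cmod x ^ 4) \<le> C 4" unfolding D_def by (subst integral_distr) (use moments[OF N N LN] in auto)
    qed
  qed
qed

lemma info_plus_noise_model: "v > 0 \<Longrightarrow> info_plus_noise (D N) (C 3) (C 4) (\<sigma> N) (diag_point v)"
  unfolding info_plus_noise_def info_plus_noise_axioms_def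
  using entry_law_D s by (auto simp: \<sigma>_def diag_point_def)

lemma y_eq: "\<omega> \<in> space M \<Longrightarrow> y N \<omega> = (\<lambda>p\<in>{..<N} \<times> {..<L N}. Y N \<omega> $$ p)"
proof -
  assume \<omega>: "\<omega> \<in> space M"
  have Yc: "Y N \<omega> \<in> carrier_mat N (L N)"
    using iid[OF N] \<omega> by (auto simp: iid_standardized_def random_matrix_def)
  have "complex_of_real (sqrt (real (L N))) * (complex_of_real (1 / sqrt (real (L N))) * x) = x" for x
    using LN by (simp add: mult.assoc[symmetric] flip: of_real_mult)
  then show ?thesis unfolding y_def G_eq[OF N \<omega>] using Yc by (auto intro!: restrict_ext)
qed

lemma \<alpha>_measurable: "\<alpha> N \<in> measurable M (PiM ({..<N} \<times> {..<L N}) (\<lambda>_. borel))"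
  unfolding \<alpha>_def using A_random[OF N] by (intro measurable_restrict) (auto simp: random_matrix_def)

text \<open>Independence passes from \<open>G\<close> to \<open>y\<close> through the measurable map
  \<open>\<phi>\<close>, and the i.i.d. entries of \<open>Y\<close> identify the second marginal as
  a power of \<open>D N\<close>.\<close>

lemma joint_law:
  "y N \<in> measurable M (PiM ({..<N} \<times> {..<L N}) (\<lambda>_. borel))"
  "distr M (PiM ({..<N} \<times> {..<L N}) (\<lambda>_. borel) \<Otimes>\<^sub>M PiM ({..<N} \<times> {..<L N}) (\<lambda>_. borel)) (\<lambda>\<omega>. (\<alpha> N \<omega>, y N \<omega>)) =
     distr M (PiM ({..<N} \<times> {..<L N}) (\<lambda>_. borel)) (\<alpha> N) \<Otimes>\<^sub>M PiM ({..<N} \<times> {..<L N}) (\<lambda>_. D N)"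
proof -
  define I where "I = {..<N} \<times> {..<L N}"
  define Bo :: "(nat \<times> nat \<Rightarrow> complex) measure" where "Bo = PiM I (\<lambda>_. borel)"
  define \<phi> :: "(nat \<times> nat \<Rightarrow> complex) \<Rightarrow> nat \<times> nat \<Rightarrow> complex"
    where "\<phi> g = (\<lambda>p\<in>I. complex_of_real (sqrt (real (L N))) * g p)" for g
  have \<phi>: "\<phi> \<in> measurable Bo Bo" unfolding \<phi>_def Bo_def by (intro measurable_restrict) measurable
  have iv: "indep_var Bo (\<alpha> N) Bo (\<lambda>\<omega>. \<lambda>p\<in>I. G N \<omega> $$ p)"
    using indep[OF N] unfolding indep_matrices_def Bo_def I_def \<alpha>_def .
  have ye: "\<phi> \<circ> (\<lambda>\<omega>. \<lambda>p\<in>I. G N \<omega> $$ p) = y N"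
    unfolding y_def[abs_def] \<phi>_def I_def comp_def ..
  have "indep_var Bo (id \<circ> \<alpha> N) Bo (\<phi> \<circ> (\<lambda>\<omega>. \<lambda>p\<in>I. G N \<omega> $$ p))"
    by (rule indep_var_compose[OF iv _ \<phi>]) (simp add: id_def)
  then have iv': "indep_var Bo (\<alpha> N) Bo (y N)" unfolding ye by (simp add: id_def comp_def)
  then have e: "y N \<in> measurable M Bo" "distr M Bo (\<alpha> N) \<Otimes>\<^sub>M distr M Bo (y N) = distr M (Bo \<Otimes>\<^sub>M Bo) (\<lambda>\<omega>. (\<alpha> N \<omega>, y N \<omega>))"
    unfolding indep_var_distribution_eq by auto
  have ivs: "indep_vars (\<lambda>_. borel) (\<lambda>p \<omega>. Y N \<omega> $$ p) I"
    using iid[OF N] by (simp add: iid_standardized_def I_def)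
  have DN: "distr M borel (\<lambda>\<omega>. Y N \<omega> $$ p) = D N" if "p \<in> I" for p
  proof -
    obtain D0 where "\<And>i j. i < N \<Longrightarrow> j < L N \<Longrightarrow> distr M borel (\<lambda>\<omega>. Y N \<omega> $$ (i, j)) = D0"
      using iid[OF N] by (auto simp: iid_standardized_def)
    then show ?thesis using that N LN by (auto simp: D_def I_def)
  qed
  have "distr M Bo (y N) = distr M Bo (\<lambda>\<omega>. \<lambda>p\<in>I. Y N \<omega> $$ p)"
    by (rule distr_cong) (auto simp: y_eq I_def)
  also have "\<dots> = PiM I (\<lambda>p. distr M borel (\<lambda>\<omega>. Y N \<omega> $$ p))"
    unfolding Bo_def using ivs
    by (subst (asm) indep_vars_iff_distr_eq_PiM') (use N LN Y_measurable in \<open>auto simp: I_def\<close>)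
  also have "\<dots> = PiM I (\<lambda>_. D N)" using DN by (intro PiM_cong) auto
  finally have law: "distr M Bo (y N) = PiM I (\<lambda>_. D N)" .
  show "y N \<in> measurable M (PiM ({..<N} \<times> {..<L N}) (\<lambda>_. borel))"
    using e(1) by (simp add: Bo_def I_def)
  show "distr M (PiM ({..<N} \<times> {..<L N}) (\<lambda>_. borel) \<Otimes>\<^sub>M PiM ({..<N} \<times> {..<L N}) (\<lambda>_. borel)) (\<lambda>\<omega>. (\<alpha> N \<omega>, y N \<omega>)) =
     distr M (PiM ({..<N} \<times> {..<L N}) (\<lambda>_. borel)) (\<alpha> N) \<Otimes>\<^sub>M PiM ({..<N} \<times> {..<L N}) (\<lambda>_. D N)"
    using e(2) law by (simp add: Bo_def I_def)
qed

lemma bmat_cong: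
  assumes "\<And>i j. i < N \<Longrightarrow> j < K \<Longrightarrow> X i j = X' i j" "inverse_pair (N + K) (bmat N p q X) R"
  shows "inverse_pair (N + K) (bmat N p q X') R"
proof -
  have eq: "bmat N p q X b d = bmat N p q X' b d" if "b < N + K" "d < N + K" for b d
    using assms(1)[of b "d - N"] assms(1)[of d "b - N"] that by (auto simp: bmat_def hermz_def)
  then show ?thesis using assms(2) unfolding inverse_pair_def by simp
qed

lemma trace_eq_stieltjes:
  assumes v: "v > 0" and \<omega>: "\<omega> \<in> space M"
  shows "T v N \<omega> / of_nat N = diag_point v * stieltjes (esd_measure (B N \<omega>)) (\<i> * complex_of_real (2 * v\<^sup>2))"
proof -
  interpret ipn: info_plus_noise "D N" "C 3" "C 4" N "L N" "\<lambda>i j. \<alpha> N \<omega> (i, j)" "\<sigma> N" "diag_point v"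
    by (rule info_plus_noise_model[OF v])
  define X where "X = Ahalf N \<omega> + complex_of_real (sqrt s) \<cdot>\<^sub>m G N \<omega>"
  have Ac: "Ahalf N \<omega> \<in> carrier_mat N (L N)" using A_random[OF N] \<omega> by (auto simp: random_matrix_def)
  have Yc: "Y N \<omega> \<in> carrier_mat N (L N)"
    using iid[OF N] \<omega> by (auto simp: iid_standardized_def random_matrix_def)
  then have Gc: "G N \<omega> \<in> carrier_mat N (L N)" unfolding G_eq[OF N \<omega>] by simp
  have Xc: "X \<in> carrier_mat N (L N)" unfolding X_def using Ac Gc by simp
  have Xe: "ipn.X (y N \<omega>) i j = X $$ (i, j)" if "i < N" "j < L N" for i j
  proof -
    have "sqrt (s / real (L N)) = sqrt s * (1 / sqrt (real (L N)))" by (simp add: real_sqrt_divide)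
    then show ?thesis
      unfolding ipn.X_def unfolding X_def y_eq[OF \<omega>] G_eq[OF N \<omega>] \<sigma>_def \<alpha>_def using that Ac Yc by (simp add: mult.assoc)
  qed
  have inv: "inverse_pair (N + L N) (bmat N (diag_point v) (diag_point v) (\<lambda>i j. X $$ (i, j))) (ipn.R (y N \<omega>))"
    by (rule bmat_cong[OF Xe ipn.inverse_R])
  have w0: "diag_point v \<noteq> 0" using v by (auto simp: diag_point_def complex_eq_iff)
  have "T v N \<omega> = of_nat N * diag_point v * stieltjes (esd_measure (X * mat_adjoint X)) (diag_point v * diag_point v)"
    unfolding ipn.t_def by (rule bmat_trace_stieltjes[OF Xc N inv w0]) (use v in \<open>simp add: diag_point_square\<close>)
  then show ?thesis unfolding X_def diag_point_square using N by simp
qed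

text \<open>Valid for every outcome: \<open>ET\<close> averages over the noise law with the
  deterministic part frozen at \<open>\<alpha> N \<omega>\<close>, so both sides see the same
  realisation of \<open>A\<close>.\<close>

lemma mean_trace_fixed_point:
  assumes v: "v \<ge> v0" and \<omega>: "\<omega> \<in> space M" and rat: "real N / real (L N) \<le> c + 1"
  shows "cmod (ET v N \<omega> / of_nat N) \<le> 1"
    and "cmod (ET v N \<omega> / of_nat N - fixed_point_map (s * (real N / real (L N))) (s * (real N / real (L N) - 1))
           (esd_measure (A N \<omega>)) (diag_point v) (ET v N \<omega> / of_nat N)) \<le>
         info_plus_noise.err (C 3) (C 4) N (L N) (\<sigma> N) (diag_point v) / real N"
proof -
  have v_pos: "v > 0" using v v0_pos by simp
  interpret ipn: info_plus_noise "D N" "C 3" "C 4" N "L N" "\<lambda>i j. \<alpha> N \<omega> (i, j)" "\<sigma> N" "diag_point v"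
    by (rule info_plus_noise_model[OF v_pos])
  define K where "K = s * (real N / real (L N))"
  define d where "d = s * (real N / real (L N) - 1)"
  define e where "e = ET v N \<omega> / of_nat N"
  define w where "w = diag_point v"
  \<comment> \<open>\<open>v0 \<ge> 5\<close> gives \<open>Im w \<ge> 1\<close>.\<close>
  have h: "ipn.h \<le> 1" unfolding ipn.h_def using v bound_pos by (simp add: diag_point_def v0_def)
  have "cmod (ET v N \<omega>) \<le> real N * 1"
    using ipn.Et_le h by (meson mult_left_mono of_nat_0_le_iff order_trans)
  then show e1: "cmod (ET v N \<omega> / of_nat N) \<le> 1" using N by (simp add: norm_divide)
  have r0: "0 \<le> real N / real (L N)" by simp
  have K: "0 \<le> K" "K \<le> bound"
  proof -
    show "0 \<le> K" using s by (simp add: K_def)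
    show "K \<le> bound" unfolding K_def bound_def by (rule mult_left_mono) (use rat s in auto)
  qed
  have d: "\<bar>d\<bar> \<le> bound"
  proof -
    have "\<bar>real N / real (L N) - 1\<bar> \<le> c + 2" using rat r0 c by linarith
    then show ?thesis unfolding d_def bound_def abs_mult using s by (simp add: mult_left_mono)
  qed
  have w0: "w \<noteq> 0" using v_pos by (auto simp: w_def diag_point_def complex_eq_iff)
  have sig2: "(\<sigma> N)\<^sup>2 = s / real (L N)" using s by (simp add: \<sigma>_def)
  have S2: "ipn.S2 = K * e"
    unfolding ipn.S2_def sig2 K_def e_def using N by simp
  have Er: "ipn.Er = ET v N \<omega> + (of_nat N - of_nat (L N)) / w"
    using ipn.mean_relation w0 by (simp add: w_def field_simps)
  \<comment> \<open>The difference \<open>N - L\<close> of the block sizes, from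
    \<open>mean_relation\<close>, becomes the parameter \<open>d\<close> after multiplication by
    \<open>s / L\<close>.\<close>
  have S1: "ipn.S1 = K * e + d / w"
    unfolding ipn.S1_def sig2 Er K_def e_def d_def using N LN w0 by (simp add: field_simps)
  have Ac: "Ahalf N \<omega> \<in> carrier_mat N (L N)" using A_random[OF N] \<omega> by (auto simp: random_matrix_def)
  have inv: "inverse_pair (N + L N) (bmat N (w + ipn.S1) (w + ipn.S2) (\<lambda>i j. Ahalf N \<omega> $$ (i, j))) ipn.E"
    unfolding w_def by (rule bmat_cong[OF _ ipn.inverse_E]) (simp add: \<alpha>_def)
  have zeta: "(w + ipn.S1) * (w + ipn.S2) = zeta_map K d w e"
    unfolding S1 S2 zeta_map_def by (simp add: add.assoc)
  have "v\<^sup>2 \<le> Im (zeta_map K d w e)"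
    unfolding w_def by (rule zeta_Im[OF K d]) (use v e1 in \<open>auto simp: v0_def e_def\<close>)
  then have Im_pos: "Im (zeta_map K d w e) > 0" using v_pos by (auto intro: less_le_trans[rotated])
  have q0: "w + ipn.S2 \<noteq> 0"
  proof
    assume "w + ipn.S2 = 0"
    then have "zeta_map K d w e = 0" unfolding zeta[symmetric] by simp
    then show False using Im_pos by simp
  qed
  have "ipn.trE = of_nat N * (w + ipn.S2) * stieltjes (esd_measure (A N \<omega>)) ((w + ipn.S1) * (w + ipn.S2))"
    unfolding ipn.trE_def by (rule bmat_trace_stieltjes[OF Ac N inv q0]) (use Im_pos in \<open>simp add: zeta\<close>)
  then have trE: "ipn.trE = of_nat N * fixed_point_map K d (esd_measure (A N \<omega>)) w e"
    unfolding fixed_point_map_def zeta unfolding S2 by (simp add: mult.assoc)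
  have "e - fixed_point_map K d (esd_measure (A N \<omega>)) w e = (ET v N \<omega> - ipn.trE) / of_nat N"
    unfolding trE e_def using N by (simp add: diff_divide_distrib)
  then have "cmod (e - fixed_point_map K d (esd_measure (A N \<omega>)) w e) = cmod (ET v N \<omega> - ipn.trE) / real N"
    by (simp add: norm_divide)
  also have "\<dots> \<le> ipn.err / real N" by (intro divide_right_mono ipn.mean_trace_approx) simp
  finally show "cmod (ET v N \<omega> / of_nat N - fixed_point_map (s * (real N / real (L N))) (s * (real N / real (L N) - 1))
           (esd_measure (A N \<omega>)) (diag_point v) (ET v N \<omega> / of_nat N)) \<le> ipn.err / real N"
    unfolding e_def K_def d_def w_def .
qed

end

end

context noise_model
begin

definition "Vmax v = 8 * s * (c + 2) * (1 / v) ^ 4 + (c + 1) * ((256 + 32 * C 4) * (1 / v) ^ 6) * s\<^sup>2"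

context
  fixes v :: real assumes v: "v > 0"
begin

lemma h_diag:
  assumes "good N"
  shows "info_plus_noise.h (diag_point v) = 1 / v"
proof -
  have "N > 0" "L N > 0" using assms by (auto simp: good_def)
  from info_plus_noise.h_def[OF info_plus_noise_model[OF this v]] show ?thesis by (simp add: diag_point_def)
qed

lemma sigma_squared: "(\<sigma> N)\<^sup>2 = s / real (L N)"
  using s by (simp add: \<sigma>_def)

lemma V_le:
  assumes g: "good N"
  shows "info_plus_noise.V (C 4) N (L N) (\<sigma> N) (diag_point v) \<le> Vmax v"
proof -
  have N: "N > 0" "L N > 0" and rat: "real N / real (L N) \<le> c + 1" using g by (auto simp: good_def)
  interpret ipn: info_plus_noise "D N" "C 3" "C 4" N "L N" a "\<sigma> N" "diag_point v" for a
    by (rule info_plus_noise_model[OF N v])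
  have hd: "ipn.h = 1 / v" by (rule h_diag[OF g])
  have Kv: "ipn.Kv = (256 + 32 * C 4) * (1 / v) ^ 6" by (simp only: ipn.Kv_def hd)
  have s4: "(\<sigma> N) ^ 4 = (s / real (L N))\<^sup>2" unfolding sigma_squared[symmetric] by (simp flip: power_mult)
  have "ipn.V = 8 * s * (real N / real (L N) + 1) * (1 / v) ^ 4 + real N / real (L N) * ipn.Kv * s\<^sup>2"
    unfolding ipn.V_def sigma_squared s4 hd using N by (simp add: power2_eq_square field_simps)
  also have "\<dots> \<le> 8 * s * (c + 2) * (1 / v) ^ 4 + (c + 1) * ipn.Kv * s\<^sup>2"
  proof -
    have r: "real N / real (L N) + 1 \<le> c + 2" using rat by simp
    show ?thesis
      by (rule add_mono; intro mult_right_mono mult_left_mono r rat) (use s v ipn.Kv_nonneg in auto)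
  qed
  finally show ?thesis by (simp only: Vmax_def Kv)
qed

lemma err_tendsto_zero:
  "(\<lambda>N. info_plus_noise.err (C 3) (C 4) N (L N) (\<sigma> N) (diag_point v) / real N) \<longlonglongrightarrow> 0"
proof -
  define Ke where "Ke = 4 * (1 / v) ^ 4 * (C 3 + 2)"
  \<comment> \<open>\<open>K1\<close> gathers the two contributions of order
    \<open>1 / sqrt L\<close>, \<open>K2\<close> the fluctuation term of order
    \<open>1 / L\<close>.\<close>
  define K1 where "K1 = 2 * Ke * (s * sqrt s) + 2 * s * (1 / v) ^ 3"
  define K2 where "K2 = s * (1 + 2 / c) * (1 / v)\<^sup>2 * ((1 + Vmax v) / 2)"
  have Linf: "filterlim (\<lambda>N. real (L N)) at_top sequentially"
    by (rule filterlim_compose[OF filterlim_real_sequentially L_inf])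
  have l1: "(\<lambda>N. inverse (sqrt (real (L N)))) \<longlonglongrightarrow> 0"
    by (rule tendsto_inverse_0_at_top[OF filterlim_compose[OF sqrt_at_top Linf]])
  have l2: "(\<lambda>N. inverse (real (L N))) \<longlonglongrightarrow> 0" by (rule tendsto_inverse_0_at_top[OF Linf])
  show ?thesis
  proof (rule Lim_null_comparison)
    show "\<forall>\<^sub>F N in sequentially. norm (info_plus_noise.err (C 3) (C 4) N (L N) (\<sigma> N) (diag_point v) / real N) \<le>
        K1 * inverse (sqrt (real (L N))) + K2 * inverse (real (L N))"
      using eventually_good
    proof eventually_elim
      case (elim N)
      have N: "N > 0" "L N > 0" and rat: "real (L N) / real N \<le> 2 / c" using elim by (auto simp: good_def)
      interpret ipn: info_plus_noise "D N" "C 3" "C 4" N "L N" a "\<sigma> N" "diag_point v" for a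
        by (rule info_plus_noise_model[OF N v])
      have hd: "ipn.h = 1 / v" by (rule h_diag[OF elim])
      have Ke: "ipn.Ke = Ke" by (simp only: ipn.Ke_def hd Ke_def)
      have V0: "0 \<le> ipn.V"
        using order_trans[OF _ ipn.variance_trace] by simp
      have V1: "ipn.V \<le> Vmax v" by (rule V_le[OF elim])
      define l where "l = sqrt (real (L N))"
      have l: "l > 0" "real (L N) = l * l" using N by (simp_all add: l_def)
      have sg: "\<sigma> N = sqrt s / l" using s by (simp add: \<sigma>_def l_def real_sqrt_divide)
      have ss: "sqrt s * sqrt s = s" using s by simp
      have Ke0: "Ke \<ge> 0" using v ipn.C3_nonneg by (simp add: Ke_def)
      have err0: "0 \<le> ipn.err"
        unfolding ipn.err_def Ke hd using Ke0 V0 v s by (simp add: \<sigma>_def)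
      have t1: "2 * real N * real (L N) * Ke * (\<sigma> N) ^ 3 / real N = 2 * Ke * (s * sqrt s) * inverse l"
        unfolding sg l(2) using N l ss by (simp add: field_simps power3_eq_cube)
      have t2: "2 * (\<sigma> N)\<^sup>2 * (real N * sqrt (real (L N)) * (1 / v) ^ 3) / real N = 2 * s * (1 / v) ^ 3 * inverse l"
        unfolding sigma_squared l_def[symmetric] unfolding l(2) using N l by (simp add: field_simps)
      define u where "u = (1 + ipn.V) / 2"
      have u: "0 \<le> u" "u \<le> (1 + Vmax v) / 2" using V0 V1 by (simp_all add: u_def)
      have t3: "(\<sigma> N)\<^sup>2 * (real (N + L N) * (1 / v)\<^sup>2) * u / real N =
          s * (1 + real (L N) / real N) * (1 / v)\<^sup>2 * u * inverse (real (L N))"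
        unfolding sigma_squared using N by (simp add: field_simps)
      have t3': "s * (1 + real (L N) / real N) * (1 / v)\<^sup>2 * u * inverse (real (L N)) \<le> K2 * inverse (real (L N))"
        unfolding K2_def using s c rat u v by (intro mult_right_mono mult_mono add_mono) auto
      have err: "ipn.err = 2 * real N * real (L N) * Ke * (\<sigma> N) ^ 3 +
          2 * (\<sigma> N)\<^sup>2 * (real N * sqrt (real (L N)) * (1 / v) ^ 3) +
          (\<sigma> N)\<^sup>2 * (real (N + L N) * (1 / v)\<^sup>2) * u"
        unfolding ipn.err_def hd Ke u_def ..
      have "ipn.err / real N = 2 * Ke * (s * sqrt s) * inverse l + 2 * s * (1 / v) ^ 3 * inverse l +
          s * (1 + real (L N) / real N) * (1 / v)\<^sup>2 * u * inverse (real (L N))"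
        unfolding err add_divide_distrib t1 t2 t3 ..
      also have "\<dots> \<le> K1 * inverse l + K2 * inverse (real (L N))"
        using t3' unfolding K1_def by (simp add: distrib_right)
      finally show ?case using err0 by (simp add: l_def)
    qed
    have "(\<lambda>N. K1 * inverse (sqrt (real (L N))) + K2 * inverse (real (L N))) \<longlonglongrightarrow> K1 * 0 + K2 * 0"
      by (intro tendsto_intros l1 l2)
    then show "(\<lambda>N. K1 * inverse (sqrt (real (L N))) + K2 * inverse (real (L N))) \<longlonglongrightarrow> 0" by simp
  qed
qed

lemma deviation_tendsto_zero: "AE \<omega> in M. (\<lambda>N. (T v N \<omega> - ET v N \<omega>) / of_nat N) \<longlonglongrightarrow> 0"
proof -
  obtain n0 where n0: "\<And>N. N \<ge> n0 \<Longrightarrow> good N" using eventually_good by (auto simp: eventually_sequentially)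
  have Vmax0: "Vmax v \<ge> 0"
  proof -
    have g: "good n0" using n0 by simp
    interpret ipn: info_plus_noise "D n0" "C 3" "C 4" n0 "L n0" a "\<sigma> n0" "diag_point v" for a
      by (rule info_plus_noise_model) (use g v in \<open>auto simp: good_def\<close>)
    have "0 \<le> ipn.V" using order_trans[OF _ ipn.variance_trace] by simp
    then show ?thesis using V_le[OF g] by simp
  qed
  show ?thesis
  proof (rule AE_tendsto_zero_of_second_moments[where C = "Vmax v"])
    fix N assume "N \<ge> n0"
    then have g: "good N" by (rule n0)
    then have N: "N > 0" "L N > 0" by (auto simp: good_def)
    note dev = info_plus_noise_model[OF N v] \<alpha>_measurable[OF N] joint_law[OF N]
    have m: "(\<lambda>\<omega>. T v N \<omega> - ET v N \<omega>) \<in> borel_measurable M"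
      by (rule conditional_deviation_measurable[OF dev])
    then show "(\<lambda>\<omega>. (T v N \<omega> - ET v N \<omega>) / of_nat N) \<in> borel_measurable M"
      by (rule borel_measurable_divide[OF _ borel_measurable_const])
    have "(\<integral>\<^sup>+\<omega>. ennreal ((cmod ((T v N \<omega> - ET v N \<omega>) / of_nat N))\<^sup>2) \<partial>M) =
        (\<integral>\<^sup>+\<omega>. ennreal (1 / (real N)\<^sup>2) * ennreal ((cmod (T v N \<omega> - ET v N \<omega>))\<^sup>2) \<partial>M)"
      by (intro nn_integral_cong) (simp add: norm_divide power_divide ennreal_mult[symmetric])
    also have "\<dots> = ennreal (1 / (real N)\<^sup>2) * (\<integral>\<^sup>+\<omega>. ennreal ((cmod (T v N \<omega> - ET v N \<omega>))\<^sup>2) \<partial>M)"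
      by (rule nn_integral_cmult)
         (rule measurable_compose[OF m], measurable)
    also have "\<dots> \<le> ennreal (1 / (real N)\<^sup>2) * ennreal (Vmax v)"
      by (intro mult_left_mono order_trans[OF conditional_variance_le[OF dev]] ennreal_leI V_le[OF g]) simp
    also have "\<dots> = ennreal (Vmax v / (real N)\<^sup>2)"
      using Vmax0 by (simp add: ennreal_mult[symmetric])
    finally show "(\<integral>\<^sup>+\<omega>. ennreal ((cmod ((T v N \<omega> - ET v N \<omega>) / of_nat N))\<^sup>2) \<partial>M) \<le> ennreal (Vmax v / (real N)\<^sup>2)" .
  qed (rule Vmax0)
qed

end

lemma limit_parameters: "0 \<le> s * c" "s * c \<le> bound" "\<bar>s * (c - 1)\<bar> \<le> bound"
proof -
  show "0 \<le> s * c" using s c by simp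
  show "s * c \<le> bound" unfolding bound_def by (rule mult_left_mono) (use s in auto)
  have "\<bar>c - 1\<bar> \<le> c + 2" using c by linarith
  then show "\<bar>s * (c - 1)\<bar> \<le> bound" unfolding bound_def abs_mult using s by (simp add: mult_left_mono)
qed

text \<open>Meaningful for \<open>v \<ge> v0\<close> only, where the contraction supplies a fixed
  point. It depends on the limit \<open>\<mu>\<close> and not on the outcome, which makes the limit
  law non-random.\<close>

definition "\<tau> v = (SOME t. cmod t \<le> 1 \<and> t = fixed_point_map (s * c) (s * (c - 1)) \<mu> (diag_point v) t)"

lemma tau:
  assumes "v \<ge> v0"
  shows "cmod (\<tau> v) \<le> 1" "\<tau> v = fixed_point_map (s * c) (s * (c - 1)) \<mu> (diag_point v) (\<tau> v)"
proof -
  have "cmod (\<tau> v) \<le> 1 \<and> \<tau> v = fixed_point_map (s * c) (s * (c - 1)) \<mu> (diag_point v) (\<tau> v)"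
    unfolding \<tau>_def
    by (rule someI_ex, rule fixed_point_exists[OF limit_parameters _ \<mu>]) (use assms in \<open>simp add: v0_def\<close>)
  then show "cmod (\<tau> v) \<le> 1" "\<tau> v = fixed_point_map (s * c) (s * (c - 1)) \<mu> (diag_point v) (\<tau> v)" by auto
qed

lemma hermitian_A: "N > 0 \<Longrightarrow> \<omega> \<in> space M \<Longrightarrow> hermitian_mat N (A N \<omega>)"
  using A_random by (intro hermitian_mat_gram) (auto simp: random_matrix_def)

lemma hermitian_B: "N > 0 \<Longrightarrow> \<omega> \<in> space M \<Longrightarrow> hermitian_mat N (B N \<omega>)"
proof (intro hermitian_mat_gram[where L = "L N"] add_carrier_mat)
  assume N: "N > 0" and \<omega>: "\<omega> \<in> space M"
  have "Y N \<omega> \<in> carrier_mat N (L N)"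
    using iid[OF N] \<omega> by (auto simp: iid_standardized_def random_matrix_def)
  then show "complex_of_real (sqrt s) \<cdot>\<^sub>m G N \<omega> \<in> carrier_mat N (L N)" unfolding G_eq[OF N \<omega>] by simp
qed

lemma trace_limit:
  assumes v: "v \<ge> v0"
  shows "AE \<omega> in M. (\<lambda>N. T v N \<omega> / of_nat N) \<longlonglongrightarrow> \<tau> v"
  using deviation_tendsto_zero[OF less_le_trans[OF v0_pos v]] A_conv AE_space
proof eventually_elim
  case (elim \<omega>)
  note dev = elim(1) and wc = elim(2) and \<omega> = elim(3)
  define e where "e N = ET v N \<omega> / of_nat N" for N
  \<comment> \<open>Shifted by one because \<open>esd_measure\<close> needs positive dimension and
    \<open>fixed_point_convergence\<close> wants a distribution for every index.\<close>
  have "(\<lambda>n. e (Suc n)) \<longlonglongrightarrow> \<tau> v"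
  proof (rule fixed_point_convergence[where \<mu>n = "\<lambda>n. esd_measure (A (Suc n) \<omega>)" and \<mu> = \<mu>
        and Kn = "\<lambda>n. s * (real (Suc n) / real (L (Suc n)))" and dn = "\<lambda>n. s * (real (Suc n) / real (L (Suc n)) - 1)"])
    show "0 \<le> s * c" "s * c \<le> bound" "\<bar>s * (c - 1)\<bar> \<le> bound" by (fact limit_parameters)+
    show "6 * bound + 5 \<le> v" using v by (simp add: v0_def)
    have ratio': "(\<lambda>n. real (Suc n) / real (L (Suc n))) \<longlonglongrightarrow> c" by (rule LIMSEQ_Suc[OF ratio])
    show "(\<lambda>n. s * (real (Suc n) / real (L (Suc n)))) \<longlonglongrightarrow> s * c"
      "(\<lambda>n. s * (real (Suc n) / real (L (Suc n)) - 1)) \<longlonglongrightarrow> s * (c - 1)"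
      by (intro tendsto_intros ratio')+
    have evg: "\<forall>\<^sub>F n in sequentially. good (Suc n)"
      using eventually_good by (simp add: eventually_sequentially_Suc)
    then show "\<forall>\<^sub>F n in sequentially. 0 \<le> s * (real (Suc n) / real (L (Suc n))) \<and>
        s * (real (Suc n) / real (L (Suc n))) \<le> bound \<and>
        \<bar>s * (real (Suc n) / real (L (Suc n)) - 1)\<bar> \<le> bound \<and> cmod (e (Suc n)) \<le> 1"
    proof eventually_elim
      case (elim n)
      then have g: "L (Suc n) > 0" "real (Suc n) / real (L (Suc n)) \<le> c + 1" unfolding good_def by auto
      define q where "q = real (Suc n) / real (L (Suc n))"
      have q: "0 \<le> q" "q \<le> c + 1" using g(2) by (simp_all add: q_def)
      have "0 \<le> s * q" using q s by simp
      moreover have "s * q \<le> bound" unfolding bound_def by (rule mult_left_mono) (use q s in auto)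
      moreover have "\<bar>s * (q - 1)\<bar> \<le> bound"
      proof -
        have "\<bar>q - 1\<bar> \<le> c + 2" using q c by linarith
        then show ?thesis unfolding bound_def abs_mult using s by (simp add: mult_left_mono)
      qed
      moreover have "cmod (e (Suc n)) \<le> 1"
        unfolding e_def by (rule mean_trace_fixed_point(1)[OF _ g(1) v \<omega> g(2)]) simp
      ultimately show ?case by (simp only: q_def)
    qed
    show "real_distribution (esd_measure (A (Suc n) \<omega>))" for n
      by (rule real_distribution_esd_measure[OF hermitian_A[OF _ \<omega>]]) auto
    have "cdf (esd_measure (A (Suc n) \<omega>)) = esd (A (Suc n) \<omega>)" for n
      by (rule cdf_esd_measure[OF hermitian_A[OF _ \<omega>]]) auto
    then show "weak_conv_m (\<lambda>n. esd_measure (A (Suc n) \<omega>)) \<mu>"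
      using wc unfolding weak_conv_m_def weak_conv_def by (auto intro: LIMSEQ_Suc)
    show "(\<lambda>n. e (Suc n) - fixed_point_map (s * (real (Suc n) / real (L (Suc n)))) (s * (real (Suc n) / real (L (Suc n)) - 1))
        (esd_measure (A (Suc n) \<omega>)) (diag_point v) (e (Suc n))) \<longlonglongrightarrow> 0"
    proof (rule Lim_null_comparison)
      show "\<forall>\<^sub>F n in sequentially. norm (e (Suc n) - fixed_point_map (s * (real (Suc n) / real (L (Suc n)))) (s * (real (Suc n) / real (L (Suc n)) - 1))
        (esd_measure (A (Suc n) \<omega>)) (diag_point v) (e (Suc n))) \<le>
        info_plus_noise.err (C 3) (C 4) (Suc n) (L (Suc n)) (\<sigma> (Suc n)) (diag_point v) / real (Suc n)"
        using evg
      proof eventually_elim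
        case (elim n)
        then have g: "L (Suc n) > 0" "real (Suc n) / real (L (Suc n)) \<le> c + 1" unfolding good_def by auto
        show ?case unfolding e_def by (rule mean_trace_fixed_point(2)[OF _ g(1) v \<omega> g(2)]) simp
      qed
      show "(\<lambda>n. info_plus_noise.err (C 3) (C 4) (Suc n) (L (Suc n)) (\<sigma> (Suc n)) (diag_point v) / real (Suc n)) \<longlonglongrightarrow> 0"
        by (rule LIMSEQ_Suc[OF err_tendsto_zero]) (use v v0_pos in simp)
    qed
    show "cmod (\<tau> v) \<le> 1" "\<tau> v = fixed_point_map (s * c) (s * (c - 1)) \<mu> (diag_point v) (\<tau> v)"
      by (rule tau[OF v])+
  qed (rule \<mu>)
  then have "e \<longlonglongrightarrow> \<tau> v" by (rule LIMSEQ_imp_Suc)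
  from tendsto_add[OF dev this] show ?case by (simp add: e_def diff_divide_distrib)
qed

definition "\<nu> n \<omega> = esd_measure (B (Suc n) \<omega>)"

lemma \<nu>:
  assumes "\<omega> \<in> space M"
  shows "real_distribution (\<nu> n \<omega>)" "cdf (\<nu> n \<omega>) = esd (B (Suc n) \<omega>)"
  unfolding \<nu>_def
  by (rule real_distribution_esd_measure[OF hermitian_B[OF _ assms]] cdf_esd_measure[OF hermitian_B[OF _ assms]], simp, simp)+

lemma stieltjes_limit:
  assumes v: "v \<ge> v0"
  shows "AE \<omega> in M. (\<lambda>n. stieltjes (\<nu> n \<omega>) (\<i> * complex_of_real (2 * v\<^sup>2))) \<longlonglongrightarrow> \<tau> v / diag_point v"
  using trace_limit[OF v] AE_space
proof eventually_elim
  case (elim \<omega>)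
  have v_pos: "v > 0" using v v0_pos by simp
  have w0: "diag_point v \<noteq> 0" using v_pos by (auto simp: diag_point_def complex_eq_iff)
  have "(\<lambda>n. T v (Suc n) \<omega> / of_nat (Suc n) / diag_point v) \<longlonglongrightarrow> \<tau> v / diag_point v"
    by (intro tendsto_divide tendsto_const LIMSEQ_Suc[OF elim(1)] w0)
  moreover have "\<forall>\<^sub>F n in sequentially. good (Suc n)"
    using eventually_good by (simp add: eventually_sequentially_Suc)
  then have "\<forall>\<^sub>F n in sequentially. T v (Suc n) \<omega> / of_nat (Suc n) / diag_point v =
      stieltjes (\<nu> n \<omega>) (\<i> * complex_of_real (2 * v\<^sup>2))"
  proof eventually_elim
    case (elim n)
    then have g: "L (Suc n) > 0" by (simp add: good_def)
    show ?case
      unfolding trace_eq_stieltjes[OF zero_less_Suc g v_pos \<open>\<omega> \<in> space M\<close>] \<nu>_def using w0 by simp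
  qed
  ultimately show ?case by (rule Lim_transform_eventually)
qed

text \<open>\<open>sqrt (Im z / 2)\<close> recovers \<open>v\<close> from the square of
  \<open>diag_point v\<close>.\<close>

definition "limit_value z = \<tau> (sqrt (Im z / 2)) / diag_point (sqrt (Im z / 2))"

lemma limit_value: "v \<ge> v0 \<Longrightarrow> limit_value (\<i> * complex_of_real (2 * v\<^sup>2)) = \<tau> v / diag_point v"
proof -
  assume "v \<ge> v0"
  then have "sqrt (Im (\<i> * complex_of_real (2 * v\<^sup>2)) / 2) = v"
    unfolding Im_i_times Re_complex_of_real using v0_pos by simp
  then show ?thesis by (simp only: limit_value_def)
qed

text \<open>Two countable families of heights: \<open>v0 + 1 / (k + 1)\<close> accumulates and
  identifies the limit, \<open>v0 + k\<close> escapes to infinity and gives tightness.\<close>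

lemma almost_surely_good:
  "AE \<omega> in M. tight (\<lambda>n. \<nu> n \<omega>) \<and> (\<forall>z\<in>imag_points v0. (\<lambda>n. stieltjes (\<nu> n \<omega>) z) \<longlonglongrightarrow> limit_value z)"
proof -
  have "AE \<omega> in M. \<forall>k. (\<lambda>n. stieltjes (\<nu> n \<omega>) (\<i> * complex_of_real (2 * (v0 + 1 / real (Suc k))\<^sup>2)))
      \<longlonglongrightarrow> \<tau> (v0 + 1 / real (Suc k)) / diag_point (v0 + 1 / real (Suc k))"
    unfolding AE_all_countable by (intro allI stieltjes_limit) simp
  moreover have "AE \<omega> in M. \<forall>k. (\<lambda>n. stieltjes (\<nu> n \<omega>) (\<i> * complex_of_real (2 * (v0 + real k)\<^sup>2)))
      \<longlonglongrightarrow> \<tau> (v0 + real k) / diag_point (v0 + real k)"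
    unfolding AE_all_countable by (intro allI stieltjes_limit) simp
  ultimately show ?thesis using AE_space
  proof eventually_elim
    case (elim \<omega>)
    have "tight (\<lambda>n. \<nu> n \<omega>)"
    proof (rule tight_of_stieltjes[where y = "\<lambda>k. 2 * (v0 + real k)\<^sup>2" and l = "\<lambda>k. \<tau> (v0 + real k) / diag_point (v0 + real k)"])
      show "real_distribution (\<nu> n \<omega>)" for n by (rule \<nu>[OF elim(3)])
      have vp: "v0 + real k > 0" for k using v0_pos by simp
      show "0 < 2 * (v0 + real k)\<^sup>2" for k using vp[of k] by simp
      show "(\<lambda>n. stieltjes (\<nu> n \<omega>) (\<i> * complex_of_real (2 * (v0 + real k)\<^sup>2)))
          \<longlonglongrightarrow> \<tau> (v0 + real k) / diag_point (v0 + real k)" for k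
        using elim(2) by blast
      have w0: "diag_point (v0 + real k) \<noteq> 0" for k
        using vp[of k] by (auto simp: diag_point_def complex_eq_iff)
      have "(\<lambda>k. diag_point (v0 + real k) * \<tau> (v0 + real k)) \<longlonglongrightarrow> - 1"
      proof (rule fixed_point_asymptotic[OF limit_parameters _ _ \<mu>])
        show "6 * bound + 5 \<le> v0 + real k" for k by (simp add: v0_def)
        show "filterlim (\<lambda>k. v0 + real k) at_top sequentially"
          by (rule filterlim_tendsto_add_at_top[OF tendsto_const filterlim_real_sequentially])
      qed (rule tau, simp)+
      moreover have "\<i> * complex_of_real (2 * (v0 + real k)\<^sup>2) * (\<tau> (v0 + real k) / diag_point (v0 + real k)) =
          diag_point (v0 + real k) * \<tau> (v0 + real k)" for k
        unfolding diag_point_square[symmetric] using w0[of k] by simp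
      ultimately show "(\<lambda>k. \<i> * complex_of_real (2 * (v0 + real k)\<^sup>2) * (\<tau> (v0 + real k) / diag_point (v0 + real k))) \<longlonglongrightarrow> - 1"
        by simp
    qed
    moreover have "(\<lambda>n. stieltjes (\<nu> n \<omega>) z) \<longlonglongrightarrow> limit_value z" if z: "z \<in> imag_points v0" for z
    proof -
      obtain k where k: "z = \<i> * complex_of_real (2 * (v0 + 1 / real (Suc k))\<^sup>2)"
        using z by (auto simp: imag_points_def)
      have "limit_value z = \<tau> (v0 + 1 / real (Suc k)) / diag_point (v0 + 1 / real (Suc k))"
        unfolding k by (rule limit_value) simp
      then show ?thesis using elim(1) k by simp
    qed
    ultimately show ?case by blast
  qed
qed

text \<open>A single good outcome produces \<open>\<rho>\<close>. Since \<open>limit_value\<close>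
  is non-random, all other good outcomes converge to the same \<open>\<rho>\<close>.\<close>

lemma limit_distribution_exists:
  "\<exists>\<rho>. as_converges_to M B \<rho> \<and> (\<forall>z\<in>imag_points v0. stieltjes \<rho> z = limit_value z)"
proof -
  have "\<exists>\<omega>. tight (\<lambda>n. \<nu> n \<omega>) \<and> (\<forall>z\<in>imag_points v0. (\<lambda>n. stieltjes (\<nu> n \<omega>) z) \<longlonglongrightarrow> limit_value z)"
    by (rule eventually_happens'[OF _ almost_surely_good]) (simp add: ae_filter_eq_bot_iff emeasure_space_1)
  then obtain \<omega>0 where \<omega>0: "tight (\<lambda>n. \<nu> n \<omega>0)" "\<And>z. z \<in> imag_points v0 \<Longrightarrow> (\<lambda>n. stieltjes (\<nu> n \<omega>0) z) \<longlonglongrightarrow> limit_value z"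
    by blast
  obtain \<rho> where \<rho>: "real_distribution \<rho>" "\<And>z. z \<in> imag_points v0 \<Longrightarrow> stieltjes \<rho> z = limit_value z"
    using tight_stieltjes_limit_exists[OF \<omega>0(1) imag_points_Im_pos[OF _ v0_pos] \<omega>0(2)] by blast
  have "AE \<omega> in M. weak_conv (\<lambda>N. esd (B N \<omega>)) (cdf \<rho>)"
    using almost_surely_good AE_space
  proof eventually_elim
    case (elim \<omega>)
    have "weak_conv_m (\<lambda>n. \<nu> n \<omega>) \<rho>"
      by (rule weak_conv_of_stieltjes[OF _ \<rho>(1) v0_pos]) (use elim \<rho>(2) in auto)
    then show ?case
      unfolding weak_conv_m_def weak_conv_def \<nu>(2)[OF elim(2)] by (auto intro: LIMSEQ_imp_Suc)
  qed
  then show ?thesis using \<rho> unfolding as_converges_to_def by blast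
qed

lemma as_converges_Malg_B:
  assumes alg: "algebraic_distribution \<mu>"
  shows "as_converges_Malg M B"
proof -
  obtain \<rho> where \<rho>: "as_converges_to M B \<rho>" "\<And>z. z \<in> imag_points v0 \<Longrightarrow> stieltjes \<rho> z = limit_value z"
    using limit_distribution_exists by blast
  obtain Lp where Lp: "Lp \<noteq> 0" "\<And>z. Im z > 0 \<Longrightarrow> bivar_eval Lp (stieltjes \<mu> z) z = 0"
    using alg by (auto simp: algebraic_distribution_def)
  define K d where "K = s * c" and "d = s * (c - 1)"
  obtain Q where Q: "Q \<noteq> 0 \<and> (\<forall>(m :: complex) (z :: complex). 1 + K * m \<noteq> 0 \<longrightarrow>
      bivar_eval Lp (m / (1 + K * m)) (z * (1 + K * m)\<^sup>2 + d * (1 + K * m)) = 0 \<longrightarrow> bivar_eval Q m z = 0)"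
    using algebraic_substitution[OF Lp(1), of K d] by (rule exE)
  note Q0 = conjunct1[OF Q] and Q_zero = conjunct2[OF Q, rule_format]
  have "algebraic_distribution \<rho>"
  proof (rule algebraic_of_imag_points[OF _ v0_pos Q0])
    show "real_distribution \<rho>" using \<rho>(1) by (simp add: as_converges_to_def)
    fix z assume z: "z \<in> imag_points v0"
    then obtain k where k: "z = \<i> * complex_of_real (2 * (v0 + 1 / real (Suc k))\<^sup>2)"
      by (auto simp: imag_points_def)
    define v where "v = v0 + 1 / real (Suc k)"
    have v: "v \<ge> v0" by (simp add: v_def)
    then have v_pos: "v > 0" using v0_pos by simp
    define w where "w = diag_point v"
    define m where "m = \<tau> v / w"
    have w0: "w \<noteq> 0" using v_pos by (auto simp: w_def diag_point_def complex_eq_iff)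
    have zw: "z = w * w" unfolding k v_def[symmetric] w_def diag_point_square ..
    have sm: "stieltjes \<rho> z = m"
      unfolding \<rho>(2)[OF z] unfolding k v_def[symmetric] limit_value[OF v] m_def w_def ..
    have "\<tau> v = w * m" unfolding m_def using w0 by simp
    then have f: "w + K * \<tau> v = w * (1 + K * m)" by (simp only: distrib_left mult_1_right mult.left_commute)
    have factor: "(w * p + d / w) * (w * p) = z * p\<^sup>2 + d * p" for p :: complex
      unfolding zw using w0 by (simp add: field_simps power2_eq_square)
    have zeta: "zeta_map K d w (\<tau> v) = z * (1 + K * m)\<^sup>2 + d * (1 + K * m)"
      unfolding zeta_map_def f by (rule factor)
    have "v\<^sup>2 \<le> Im (zeta_map K d w (\<tau> v))"
      unfolding K_def d_def w_def
      by (rule zeta_Im[OF limit_parameters]) (use v tau[OF v] in \<open>auto simp: v0_def\<close>)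
    then have Im_pos: "Im (zeta_map K d w (\<tau> v)) > 0" using v_pos by (auto intro: less_le_trans[rotated])
    \<comment> \<open>Otherwise \<open>\<zeta>\<close> would be 0, against its positive imaginary
      part.\<close>
    have \<delta>0: "1 + K * m \<noteq> 0"
    proof
      assume "1 + K * m = 0"
      then show False using Im_pos unfolding zeta by simp
    qed
    define \<delta> S where "\<delta> = 1 + K * m" and "S = stieltjes \<mu> (zeta_map K d w (\<tau> v))"
    have t: "\<tau> v = w * \<delta> * S"
      using tau(2)[OF v]
      unfolding fixed_point_map_def K_def[symmetric] d_def[symmetric] w_def[symmetric] f \<delta>_def S_def .
    have \<delta>nz: "\<delta> \<noteq> 0" using \<delta>0 by (simp only: \<delta>_def not_False_eq_True)
    have m: "m = \<delta> * S" unfolding m_def t using w0 by simp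
    have "m / \<delta> = S" by (simp only: m nonzero_mult_div_cancel_left[OF \<delta>nz])
    then have "m / (1 + K * m) = stieltjes \<mu> (zeta_map K d w (\<tau> v))" unfolding \<delta>_def S_def .
    then have "bivar_eval Lp (m / (1 + K * m)) (z * (1 + K * m)\<^sup>2 + d * (1 + K * m)) = 0"
      using Lp(2)[OF Im_pos] unfolding zeta by simp
    then show "bivar_eval Q (stieltjes \<rho> z) z = 0" unfolding sm by (rule Q_zero[OF \<delta>0])
  qed
  then show ?thesis using \<rho>(1) unfolding as_converges_Malg_def by blast
qed

end

theorem theorem5p21:
  fixes M :: "'w measure"
    and L :: "nat \<Rightarrow> nat"
    and G Ahalf :: "nat \<Rightarrow> 'w \<Rightarrow> complex mat"
    and s c :: real
  assumes "prob_space M"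
    and "gaussian_like M L G"
    and "\<And>N. N > 0 \<Longrightarrow> random_matrix M N (L N) (Ahalf N)"
    and "\<And>N. N > 0 \<Longrightarrow> indep_matrices M N (L N) (Ahalf N) (G N)"
    and "as_converges_Malg M (\<lambda>N \<omega>. Ahalf N \<omega> * mat_adjoint (Ahalf N \<omega>))"
    and "s > 0"
    and "filterlim L at_top sequentially"
    and "(\<lambda>N. real N / real (L N)) \<longlonglongrightarrow> c"
    and "c > 0"
  shows "as_converges_Malg M
    (\<lambda>N \<omega>. (Ahalf N \<omega> + complex_of_real (sqrt s) \<cdot>\<^sub>m G N \<omega>) *
            mat_adjoint (Ahalf N \<omega> + complex_of_real (sqrt s) \<cdot>\<^sub>m G N \<omega>))"
proof -
  obtain Y where Y: "(\<forall>N>0. iid_standardized M N (L N) (Y N)) \<and>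
      (\<forall>k. \<exists>C. \<forall>N>0. \<forall>i<N. \<forall>j<L N.
         integrable M (\<lambda>\<omega>. norm (Y N \<omega> $$ (i, j)) ^ k) \<and>
         (LINT \<omega>|M. norm (Y N \<omega> $$ (i, j)) ^ k) \<le> C) \<and>
      (\<forall>N>0. \<forall>\<omega>\<in>space M. G N \<omega> = complex_of_real (1 / sqrt (real (L N))) \<cdot>\<^sub>m Y N \<omega>)"
    using assms(2) unfolding gaussian_like_def by (rule exE)
  note iid = conjunct1[OF Y, rule_format] and G_eq = conjunct2[OF conjunct2[OF Y], rule_format]
  obtain C where C: "\<forall>k. \<forall>N>0. \<forall>i<N. \<forall>j<L N.
      integrable M (\<lambda>\<omega>. norm (Y N \<omega> $$ (i, j)) ^ k) \<and> (LINT \<omega>|M. norm (Y N \<omega> $$ (i, j)) ^ k) \<le> C k"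
    using choice[OF conjunct1[OF conjunct2[OF Y]]] by (rule exE)
  obtain \<mu> where mu: "real_distribution \<mu>"
    "AE \<omega> in M. weak_conv (\<lambda>N. esd (Ahalf N \<omega> * mat_adjoint (Ahalf N \<omega>))) (cdf \<mu>)" "algebraic_distribution \<mu>"
    using assms(5) unfolding as_converges_Malg_def as_converges_to_def by blast
  interpret noise_model M L G Y Ahalf s c C \<mu>
    by (intro noise_model.intro noise_model_axioms.intro) (fact assms(1) iid G_eq C[rule_format] mu(1,2) assms(3,4,6-9))+
  show ?thesis by (rule as_converges_Malg_B[OF mu(3)])
qed

end
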